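(* For all $y\in K$ and for every $q=0,1,2,\ldots$, the asymptotic expansions (as $\varepsilon\downarrow 0$) of the CSP fiber of order $q$, $\mathcal{L}_\varepsilon^{(q)}(y)$, and of the tangent space $\mathcal{T}_p\mathcal{F}_\varepsilon$ to the fast fiber $\mathcal{F}_\varepsilon^p$ at its base point $p=(y,h_\varepsilon(y))\in\mathcal{M}_\varepsilon$ agree up to and including terms of $\mathcal{O}(\varepsilon^q)$.
   Context: **Fast--slow system.** Let $m,n\ge 1$ and consider the smooth system $y'=\varepsilon g_1(y,z,\varepsilon)$, $z'=g_2(y,z,\varepsilon)$ with $y\in\mathbf{R}^m$ (slow), $z\in\mathbf{R}^n$ (fast), prime $=d/dt$, and small parameter $\varepsilon>0$. Write $x=(y,z)\in\mathbf{R}^{m+n}$ and $g=\left(\begin{array}{c}\varepsilon g_1\\ g_2\end{array}\right)$, so that $x'=g(x)$. Assume there are a compact domain $K\subset\mathbf{R}^m$ and a smooth function $h_0$ on $K$ with $g_2(y,h_0(y),0)=0$ for $y\in K$, and that all eigenvalues of $D_zg_2(y,h_0(y),0)$ have negative real part for $y\in K$. Put $\mathcal{M}_0=\{(y,z): z=h_0(y),\ y\in K\}$; for $p=(y,h_0(y))\in\mathcal{M}_0$ the unperturbed fast fiber is $\mathcal{F}_0^p=\{(y,z): z\in\mathbf{R}^n\}$. **Slow manifold and fast fibers (Fenichel theory).** For all sufficiently small $\varepsilon>0$ there is a function $h_\varepsilon$ on $K$, with expansion $h_\varepsilon=h_0+\varepsilon h_1+\varepsilon^2h_2+\cdots$ as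 $\varepsilon\downarrow 0$, whose graph $\mathcal{M}_\varepsilon=\{(y,z): z=h_\varepsilon(y),\ y\in K\}$ is locally invariant (the slow manifold). There is also an invariant family $\mathcal{F}_\varepsilon=\bigcup_{p\in\mathcal{M}_\varepsilon}\mathcal{F}_\varepsilon^p$ of $n$-dimensional fast stable fibers with base points $p\in\mathcal{M}_\varepsilon$, along which solutions relax to $\mathcal{M}_\varepsilon$. It foliates a neighborhood of $\mathcal{M}_\varepsilon$, is $\mathcal{O}(\varepsilon)$-close to the unperturbed fibers, and satisfies $\phi_t(\mathcal{F}_\varepsilon^p)\subset\mathcal{F}_\varepsilon^{\phi_t(p)}$, where $\phi_t$ is the time-$t$ map (as long as the base point stays in $\mathcal{M}_\varepsilon$). $\mathcal{T}_p\mathcal{F}_\varepsilon$ is the $n$-dimensional tangent space to $\mathcal{F}_\varepsilon^p$ at $p$. $\mathcal{M}_\varepsilon$ is typically not unique, but all choices have the same asymptotic expansion. **CSP algorithm.** Start from a constant invertible matrix $$A^{(0)}=(A_1^{(0)},A_2^{(0)})=\left(\begin{array}{cc}0&A_{12}^{(0)}\\ A_{21}^{(0)}&A_{22}^{(0)}\end{array}\right),$$ where $A_1^{(0)}$ has $n$ columns, $A_2^{(0)}$ has $m$ columns, $A_{12}^{(0)}$ is $m\times m$ invertible, $A_{21}^{(0)}$ is $n\times n$ invertible, and $A_{22}^{(0)}$ is $n\times m$. Let $B_{(0)}=(A^{(0)})^{-1}$. For $q=0,1,2,\ldots$ write $A^{(q)}=(A_1^{(q)},A_2^{(q)})$ with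 $A_1^{(q)}$ of size $(m+n)\times n$ and $A_2^{(q)}$ of size $(m+n)\times m$, and $B_{(q)}=\left(\begin{array}{c}B^1_{(q)}\\ B^2_{(q)}\end{array}\right)$ with $B^1_{(q)}$ of size $n\times(m+n)$ and $B^2_{(q)}$ of size $m\times(m+n)$. These are matrix functions of $(y,z,\varepsilon)$. Define $$\Lambda_{(q)}=B_{(q)}(Dg)A^{(q)}-B_{(q)}\frac{dA^{(q)}}{dt}=\left(\begin{array}{cc}\Lambda^{11}_{(q)}&\Lambda^{12}_{(q)}\\ \Lambda^{21}_{(q)}&\Lambda^{22}_{(q)}\end{array}\right),\qquad \frac{dA^{(q)}}{dt}=(DA^{(q)})g,$$ with $\Lambda^{11}_{(q)}$ of size $n\times n$ and $D$ the derivative with respect to $x=(y,z)$, and $$U_{(q)}=\left(\begin{array}{cc}0&(\Lambda^{11}_{(q)})^{-1}\Lambda^{12}_{(q)}\\0&0\end{array}\right),\qquad L_{(q)}=\left(\begin{array}{cc}0&0\\ \Lambda^{21}_{(q)}(\Lambda^{11}_{(q)})^{-1}&0\end{array}\right),$$ $$A^{(q+1)}=A^{(q)}(I-U_{(q)})(I+L_{(q)}),\qquad B_{(q+1)}=(I-L_{(q)})(I+U_{(q)})B_{(q)}.$$ **CSP manifolds.** $z=\psi_{(0)}(y,\varepsilon)$ is the solution of $B^1_{(0)}g(y,z,\varepsilon)=0$, and for $q\ge1$, $z=\psi_{(q)}(y,\varepsilon)$ is the solution of $B^1_{(q)}(y,\psi_{(q-1)}(y,\varepsilon),\varepsilon)\,g(y,z,\varepsilon)=0$;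 in each case the solution branch chosen is the one coinciding with $h_0(y)$ at leading order as $\varepsilon\downarrow0$. The CSP manifold of order $q$ is $\mathcal{K}_\varepsilon^{(q)}=\{(y,z): z=\psi_{(q)}(y,\varepsilon),\ y\in K\}$. **CSP fibers.** The CSP fiber of order $q$ at $p=(y,h_\varepsilon(y))$ is the linear space $$\mathcal{L}_\varepsilon^{(q)}(y)=\mathrm{span}\big(\mathrm{columns\ of\ }A_1^{(q)}(y,\psi_{(q)}(y,\varepsilon),\varepsilon)\big).$$ **Agreement of expansions of subspaces.** Two $\varepsilon$-dependent families of $n$-dimensional linear subspaces of $\mathbf{R}^{m+n}$ have asymptotic expansions that agree up to and including terms of $\mathcal{O}(\varepsilon^q)$ if one can choose bases of them (columns of $(m+n)\times n$ matrices with asymptotic expansions in powers of $\varepsilon$, of full rank at $\varepsilon=0$) whose difference is $\mathcal{O}(\varepsilon^{q+1})$ as $\varepsilon\downarrow0$. *)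

theory Defs
  imports "HOL-Analysis.Analysis" "HOL-Library.Landau_Symbols"
begin

section \<open>Smooth maps\<close>

text \<open>For an open set \<open>U\<close> of a Euclidean space: all partial derivatives up to order \<open>k\<close> exist
  and are continuous on \<open>U\<close>.\<close>

primrec Ck_open :: "nat \<Rightarrow> 'a::euclidean_space set \<Rightarrow> ('a \<Rightarrow> 'b::euclidean_space) \<Rightarrow> bool" where
  "Ck_open 0 U f \<longleftrightarrow> continuous_on U f"
| "Ck_open (Suc k) U f \<longleftrightarrow>
     (\<forall>x\<in>U. f differentiable (at x)) \<and>
     (\<forall>v. Ck_open k U (\<lambda>x. frechet_derivative f (at x) v))"

text \<open>On an arbitrary set, such as a compact domain or a half-open parameter interval
  \<open>{0..<e}\<close>, regularity means that there is an extension of that regularity to an open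
  neighbourhood.\<close>

definition Ck_on :: "nat \<Rightarrow> 'a::euclidean_space set \<Rightarrow> ('a \<Rightarrow> 'b::euclidean_space) \<Rightarrow> bool" where
  "Ck_on k S f \<longleftrightarrow> (\<exists>U f'. open U \<and> S \<subseteq> U \<and> Ck_open k U f' \<and> (\<forall>x\<in>S. f' x = f x))"

definition smooth_on :: "'a::euclidean_space set \<Rightarrow> ('a \<Rightarrow> 'b::euclidean_space) \<Rightarrow> bool" where
  "smooth_on S f \<longleftrightarrow> (\<exists>U f'. open U \<and> S \<subseteq> U \<and> (\<forall>k. Ck_open k U f') \<and> (\<forall>x\<in>S. f' x = f x))"

definition compact_domain :: "'a::euclidean_space set \<Rightarrow> bool" where
  "compact_domain K \<longleftrightarrow>
     K \<noteq> {} \<and> compact K \<and> connected (interior K) \<and> closure (interior K) = K"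

section \<open>Block vectors and block matrices\<close>

definition join :: "real^'m \<Rightarrow> real^'n \<Rightarrow> real^('m + 'n)" where
  "join y z = (\<chi> i. case i of Inl a \<Rightarrow> y $ a | Inr b \<Rightarrow> z $ b)"

definition slow :: "real^('m + 'n::finite) \<Rightarrow> real^'m" where
  "slow x = (\<chi> a. x $ Inl a)"

definition fast :: "real^('m::finite + 'n) \<Rightarrow> real^'n" where
  "fast x = (\<chi> b. x $ Inr b)"

definition block_mat ::
  "real^'c^'a \<Rightarrow> real^'d^'a \<Rightarrow> real^'c^'b \<Rightarrow> real^'d^'b \<Rightarrow> real^('c + 'd)^('a + 'b)" where
  "block_mat P Q R S = (\<chi> i j. case i of
       Inl a \<Rightarrow> (case j of Inl c \<Rightarrow> P $ a $ c | Inr d \<Rightarrow> Q $ a $ d)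
     | Inr b \<Rightarrow> (case j of Inl c \<Rightarrow> R $ b $ c | Inr d \<Rightarrow> S $ b $ d))"

definition block11 :: "real^('c + 'd::finite)^('a::finite + 'b::finite) \<Rightarrow> real^'c^'a" where
  "block11 M = (\<chi> i j. M $ Inl i $ Inl j)"

definition block12 :: "real^('c::finite + 'd)^('a::finite + 'b::finite) \<Rightarrow> real^'d^'a" where
  "block12 M = (\<chi> i j. M $ Inl i $ Inr j)"

definition block21 :: "real^('c + 'd::finite)^('a::finite + 'b::finite) \<Rightarrow> real^'c^'b" where
  "block21 M = (\<chi> i j. M $ Inr i $ Inl j)"

definition left_cols :: "real^('c + 'd::finite)^'r \<Rightarrow> real^'c^'r" where
  "left_cols M = (\<chi> i j. M $ i $ Inl j)"

definition upper_rows :: "real^'r^('a::finite + 'b::finite) \<Rightarrow> real^'r^'a" where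
  "upper_rows M = (\<chi> i. M $ Inl i)"

definition complex_eigenvalue :: "real^'n^'n \<Rightarrow> complex \<Rightarrow> bool" where
  "complex_eigenvalue M l \<longleftrightarrow>
     (\<exists>v::complex^'n. v \<noteq> 0 \<and> map_matrix complex_of_real M *v v = l *s v)"

section \<open>Fast--slow systems and their Fenichel structures\<close>

text \<open>The vector field of \<open>y' = \<epsilon> g\<^sub>1(y,z,\<epsilon>)\<close>, \<open>z' = g\<^sub>2(y,z,\<epsilon>)\<close> on the state space
  of points \<open>x = (y,z)\<close>.\<close>

definition fs_field ::
  "(real^'m \<Rightarrow> real^'n \<Rightarrow> real \<Rightarrow> real^'m) \<Rightarrow> (real^'m \<Rightarrow> real^'n \<Rightarrow> real \<Rightarrow> real^'n)
   \<Rightarrow> real \<Rightarrow> real^('m + 'n) \<Rightarrow> real^('m + 'n)" where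
  "fs_field g1 g2 \<epsilon> x =
     join (\<epsilon> *\<^sub>R g1 (slow x) (fast x) \<epsilon>) (g2 (slow x) (fast x) \<epsilon>)"

definition solution_on ::
  "('a::real_normed_vector \<Rightarrow> 'a) \<Rightarrow> real set \<Rightarrow> (real \<Rightarrow> 'a) \<Rightarrow> bool" where
  "solution_on f I x \<longleftrightarrow> (\<forall>t\<in>I. (x has_vector_derivative f (x t)) (at t within I))"

definition graph_over :: "(real^'m) set \<Rightarrow> (real^'m \<Rightarrow> real^'n) \<Rightarrow> (real^('m + 'n)) set" where
  "graph_over K u = (\<lambda>y. join y (u y)) ` K"

text \<open>Trajectories stay in the graph as long as (forward and backward in time) their slow
  component stays in \<open>K\<close>, so they can leave it only through its boundary.\<close>

definition locally_invariant_graph ::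
  "(real^('m + 'n) \<Rightarrow> real^('m + 'n)) \<Rightarrow> (real^'m) set \<Rightarrow> (real^'m \<Rightarrow> real^'n) \<Rightarrow> bool" where
  "locally_invariant_graph f K u \<longleftrightarrow>
     (\<forall>a b x. a \<le> 0 \<and> 0 \<le> b \<and> solution_on f {a..b} x \<and> x 0 \<in> graph_over K u
              \<and> (\<forall>t\<in>{a..b}. slow (x t) \<in> K)
        \<longrightarrow> (\<forall>t\<in>{a..b}. x t \<in> graph_over K u))"

text \<open>The family \<open>h \<epsilon>\<close> (with the convention that \<open>h 0\<close> is the unperturbed \<open>h\<^sub>0\<close>) of
  functions whose graphs are slow manifolds. As in Fenichel's theorem for smooth systems,
  \<open>h\<close> is jointly \<open>C\<^sup>r\<close> in \<open>(y,\<epsilon>)\<close>, including \<open>\<epsilon> = 0\<close>, for every finite \<open>r\<close>, on a parameter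
  interval that may shrink as \<open>r\<close> grows.\<close>

definition slow_manifold_family ::
  "(real \<Rightarrow> real^('m + 'n) \<Rightarrow> real^('m + 'n)) \<Rightarrow> (real^'m) set \<Rightarrow> (real^'m \<Rightarrow> real^'n)
   \<Rightarrow> (real \<Rightarrow> real^'m \<Rightarrow> real^'n) \<Rightarrow> bool" where
  "slow_manifold_family g K h0 h \<longleftrightarrow>
     (\<forall>y\<in>K. h 0 y = h0 y) \<and>
     (\<forall>r. \<exists>e>0. Ck_on r (K \<times> {0..<e}) (\<lambda>(y, \<epsilon>). h \<epsilon> y)) \<and>
     (\<exists>c :: nat \<Rightarrow> real^'m \<Rightarrow> real^'n.
        (\<forall>y\<in>K. c 0 y = h0 y) \<and> (\<forall>k. smooth_on K (c k)) \<and>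
        (\<forall>N. \<exists>C. \<forall>\<^sub>F \<epsilon> in at_right 0. \<forall>y\<in>K.
           norm (h \<epsilon> y - (\<Sum>k\<le>N. \<epsilon> ^ k *\<^sub>R c k y)) \<le> C * \<epsilon> ^ (N + 1))) \<and>
     (\<forall>\<^sub>F \<epsilon> in at_right 0. locally_invariant_graph (g \<epsilon>) K (h \<epsilon>))"

text \<open>The fiber \<open>F \<epsilon> p\<close> with base point \<open>p = (y, h \<epsilon> y)\<close> is the graph of \<open>z \<mapsto> Y y z \<epsilon>\<close> over an
  open neighbourhood \<open>N \<epsilon> y\<close> of uniform size of \<open>h\<^sub>0(y)\<close>. Here \<open>Y\<close> has the same joint
  regularity as \<open>h\<close>, and \<open>Y y z 0 = y\<close>, so the fibers are \<open>O(\<epsilon>)\<close>-close to the unperturbed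
  fibers \<open>{y} \<times> \<real>\<^sup>n\<close>. The sets \<open>N \<epsilon> y\<close> are not required to be balls, because
  Euclidean balls need not be forward invariant.\<close>

definition smooth_fiber_graphs ::
  "(real^'m) set \<Rightarrow> (real^'m \<Rightarrow> real^'n) \<Rightarrow> (real \<Rightarrow> real^'m \<Rightarrow> real^'n)
   \<Rightarrow> (real \<Rightarrow> real^('m + 'n) \<Rightarrow> (real^('m + 'n)) set) \<Rightarrow> bool" where
  "smooth_fiber_graphs K h0 h F \<longleftrightarrow>
     (\<exists>(Y :: real^'m \<Rightarrow> real^'n \<Rightarrow> real \<Rightarrow> real^'m) (N :: real \<Rightarrow> real^'m \<Rightarrow> (real^'n) set) \<delta> \<Delta>.
        0 < \<delta> \<and>
        (\<forall>r. \<exists>e>0. Ck_on r {(y, z, \<epsilon>). y \<in> K \<and> z \<in> cball (h0 y) \<Delta> \<and> \<epsilon> \<in> {0..<e}}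
                          (\<lambda>(y, z, \<epsilon>). Y y z \<epsilon>)) \<and>
        (\<forall>y\<in>K. \<forall>z\<in>cball (h0 y) \<Delta>. Y y z 0 = y) \<and>
        (\<forall>\<^sub>F \<epsilon> in at_right 0. \<forall>y\<in>K.
           open (N \<epsilon> y) \<and> ball (h0 y) \<delta> \<subseteq> N \<epsilon> y \<and> N \<epsilon> y \<subseteq> cball (h0 y) \<Delta> \<and>
           Y y (h \<epsilon> y) \<epsilon> = y \<and>
           F \<epsilon> (join y (h \<epsilon> y)) = (\<lambda>z. join (Y y z \<epsilon>) z) ` N \<epsilon> y))"

text \<open>Fibers over points of the boundary of \<open>K\<close> cannot have a full neighbourhood covered by the
  family, hence the restriction to the interior in the covering condition. The invariance
  \<open>\<phi>\<^sub>t(F\<^sup>p) \<subseteq> F\<^bsup>\<phi>\<^sub>t(p)\<^esup>\<close>, \<open>t \<ge> 0\<close>, is expressed through pairs of solutions, since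
  the flow need not be globally defined.\<close>

definition fast_fiber_family ::
  "(real \<Rightarrow> real^('m + 'n) \<Rightarrow> real^('m + 'n)) \<Rightarrow> (real^'m) set \<Rightarrow> (real^'m \<Rightarrow> real^'n)
   \<Rightarrow> (real \<Rightarrow> real^'m \<Rightarrow> real^'n) \<Rightarrow> (real \<Rightarrow> real^('m + 'n) \<Rightarrow> (real^('m + 'n)) set) \<Rightarrow> bool" where
  "fast_fiber_family g K h0 h F \<longleftrightarrow>
     smooth_fiber_graphs K h0 h F \<and>
     (\<forall>\<^sub>F \<epsilon> in at_right 0.
        disjoint_family_on (F \<epsilon>) (graph_over K (h \<epsilon>)) \<and>
        (\<exists>W. open W \<and> graph_over (interior K) (h \<epsilon>) \<subseteq> W \<and>
             W \<subseteq> (\<Union>p\<in>graph_over K (h \<epsilon>). F \<epsilon> p))) \<and>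
     (\<exists>C \<gamma>. 0 < \<gamma> \<and>
        (\<forall>\<^sub>F \<epsilon> in at_right 0. \<forall>T\<ge>0. \<forall>x p.
           solution_on (g \<epsilon>) {0..T} x \<and> solution_on (g \<epsilon>) {0..T} p \<and>
           (\<forall>t\<in>{0..T}. p t \<in> graph_over K (h \<epsilon>)) \<and> x 0 \<in> F \<epsilon> (p 0)
           \<longrightarrow> (\<forall>t\<in>{0..T}. x t \<in> F \<epsilon> (p t) \<and>
                  norm (x t - p t) \<le> C * exp (- \<gamma> * t) * norm (x 0 - p 0))))"

text \<open>Velocities at \<open>p\<close> of curves in \<open>S\<close>; for a submanifold this is the usual tangent space,
  as a linear subspace (not translated to \<open>p\<close>).\<close>

definition tangent_space :: "'a::real_normed_vector set \<Rightarrow> 'a \<Rightarrow> 'a set" where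
  "tangent_space S p =
     {v. \<exists>c :: real \<Rightarrow> 'a. c 0 = p \<and> (\<forall>\<^sub>F t in nhds 0. c t \<in> S) \<and>
                           (c has_vector_derivative v) (at 0)}"

section \<open>The CSP algorithm\<close>

text \<open>\<open>\<Lambda> = B (Dg) A - B (DA) g\<close> for matrix-valued functions \<open>A\<close>, \<open>B\<close> of the state.\<close>

definition csp_Lambda ::
  "(real^('m::finite + 'n::finite) \<Rightarrow> real^('m + 'n)) \<Rightarrow> (real^('m + 'n) \<Rightarrow> real^('n + 'm)^('m + 'n))
   \<Rightarrow> (real^('m + 'n) \<Rightarrow> real^('m + 'n)^('n + 'm)) \<Rightarrow> real^('m + 'n) \<Rightarrow> real^('n + 'm)^('n + 'm)" where
  "csp_Lambda f A B x =
     B x ** jacobian f (at x) ** A x - B x ** frechet_derivative A (at x) (f x)"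

definition csp_U :: "real^('n::finite + 'm::finite)^('n + 'm) \<Rightarrow> real^('n + 'm)^('n + 'm)" where
  "csp_U L = block_mat 0 (matrix_inv (block11 L) ** block12 L) 0 0"

definition csp_L :: "real^('n::finite + 'm::finite)^('n + 'm) \<Rightarrow> real^('n + 'm)^('n + 'm)" where
  "csp_L L = block_mat 0 0 (block21 L ** matrix_inv (block11 L)) 0"

fun csp_A :: "(real \<Rightarrow> real^('m::finite + 'n::finite) \<Rightarrow> real^('m + 'n)) \<Rightarrow> real^('n + 'm)^('m + 'n)
    \<Rightarrow> nat \<Rightarrow> real \<Rightarrow> real^('m + 'n) \<Rightarrow> real^('n + 'm)^('m + 'n)"
  and csp_B :: "(real \<Rightarrow> real^('m + 'n) \<Rightarrow> real^('m + 'n)) \<Rightarrow> real^('n + 'm)^('m + 'n)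
    \<Rightarrow> nat \<Rightarrow> real \<Rightarrow> real^('m + 'n) \<Rightarrow> real^('m + 'n)^('n + 'm)" where
  "csp_A g A0 0 \<epsilon> x = A0"
| "csp_B g A0 0 \<epsilon> x = matrix_inv A0"
| "csp_A g A0 (Suc q) \<epsilon> x =
     (let L = csp_Lambda (g \<epsilon>) (csp_A g A0 q \<epsilon>) (csp_B g A0 q \<epsilon>) x
      in csp_A g A0 q \<epsilon> x ** (mat 1 - csp_U L) ** (mat 1 + csp_L L))"
| "csp_B g A0 (Suc q) \<epsilon> x =
     (let L = csp_Lambda (g \<epsilon>) (csp_A g A0 q \<epsilon>) (csp_B g A0 q \<epsilon>) x
      in (mat 1 - csp_L L) ** (mat 1 + csp_U L) ** csp_B g A0 q \<epsilon> x)"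

text \<open>\<open>\<psi> q y \<epsilon>\<close> is the solution branch that defines the CSP manifold of order \<open>q\<close>.\<close>

definition csp_manifold_functions ::
  "(real \<Rightarrow> real^('m + 'n) \<Rightarrow> real^('m + 'n)) \<Rightarrow> real^('n + 'm)^('m + 'n) \<Rightarrow> (real^'m) set
   \<Rightarrow> (real^'m \<Rightarrow> real^'n) \<Rightarrow> (nat \<Rightarrow> real^'m \<Rightarrow> real \<Rightarrow> real^'n) \<Rightarrow> bool" where
  "csp_manifold_functions g A0 K h0 \<psi> \<longleftrightarrow>
     (\<forall>y\<in>K.
        (\<forall>\<^sub>F \<epsilon> in at_right 0.
           upper_rows (matrix_inv A0) *v g \<epsilon> (join y (\<psi> 0 y \<epsilon>)) = 0) \<and>
        (\<forall>q. \<forall>\<^sub>F \<epsilon> in at_right 0.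
           upper_rows (csp_B g A0 (Suc q) \<epsilon> (join y (\<psi> q y \<epsilon>)))
             *v g \<epsilon> (join y (\<psi> (Suc q) y \<epsilon>)) = 0) \<and>
        (\<forall>q. (\<psi> q y \<longlongrightarrow> h0 y) (at_right 0)))"

definition csp_fiber ::
  "(real \<Rightarrow> real^('m + 'n) \<Rightarrow> real^('m + 'n)) \<Rightarrow> real^('n + 'm)^('m + 'n)
   \<Rightarrow> (nat \<Rightarrow> real^'m \<Rightarrow> real \<Rightarrow> real^'n) \<Rightarrow> nat \<Rightarrow> real \<Rightarrow> real^'m \<Rightarrow> (real^('m + 'n)) set" where
  "csp_fiber g A0 \<psi> q \<epsilon> y = span (columns (left_cols (csp_A g A0 q \<epsilon> (join y (\<psi> q y \<epsilon>)))))"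

section \<open>Agreement of asymptotic expansions of subspaces\<close>

definition asymp_expansion :: "(real \<Rightarrow> 'a::real_normed_vector) \<Rightarrow> (nat \<Rightarrow> 'a) \<Rightarrow> bool" where
  "asymp_expansion f c \<longleftrightarrow>
     (\<forall>N. (\<lambda>\<epsilon>. norm (f \<epsilon> - (\<Sum>k\<le>N. \<epsilon> ^ k *\<^sub>R c k))) \<in> O[at_right 0](\<lambda>\<epsilon>. \<epsilon> ^ (N + 1)))"

text \<open>The type argument \<open>'n\<close> carries the dimension of the subspaces.\<close>

definition subspaces_agree ::
  "'n::finite itself \<Rightarrow> nat \<Rightarrow> (real \<Rightarrow> (real^'k) set) \<Rightarrow> (real \<Rightarrow> (real^'k) set) \<Rightarrow> bool" where
  "subspaces_agree _ q S T \<longleftrightarrow>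
     (\<exists>(X :: real \<Rightarrow> real^'n^'k) (Y :: real \<Rightarrow> real^'n^'k) a b.
        asymp_expansion X a \<and> rank (a 0) = CARD('n) \<and>
        asymp_expansion Y b \<and> rank (b 0) = CARD('n) \<and>
        (\<forall>\<^sub>F \<epsilon> in at_right 0. S \<epsilon> = span (columns (X \<epsilon>)) \<and> T \<epsilon> = span (columns (Y \<epsilon>))) \<and>
        (\<lambda>\<epsilon>. norm (X \<epsilon> - Y \<epsilon>)) \<in> O[at_right 0](\<lambda>\<epsilon>. \<epsilon> ^ (q + 1)))"

end

theory Submission
  imports Defs
begin

text \<open>Over the slow manifold the theorem is a statement of linear algebra over functions of
  \<open>(y, \<epsilon>)\<close>, filtered by powers of \<open>\<epsilon>\<close>. Two bundles over \<open>M\<^sub>\<epsilon>\<close> are invariant under the linearised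
  flow: the tangent spaces of \<open>M\<^sub>\<epsilon>\<close>, with basis \<open>T = (I; D\<^sub>y h)\<close>, and the tangent spaces of the
  fibers, with basis \<open>E = (\<tau>; I)\<close>, \<open>\<tau> = D\<^sub>z Y\<close>. With \<open>J = Dg\<close> and \<open>\<partial>\<close> the derivative along the flow on
  \<open>M\<^sub>\<epsilon>\<close>, invariance reads \<open>J E - \<partial>E = E \<nu>\<close> and \<open>J T - \<partial>T = T \<kappa>\<close>, where \<open>\<nu>\<close> is close to
  \<open>D\<^sub>z g\<^sub>2\<close>, hence invertible, and \<open>\<kappa> = O(\<epsilon>)\<close>. These equations are the derivatives of the first-order
  statements that solutions which start in the manifold (in a fiber) stay there; getting from
  sets to equations takes local existence of solutions and symmetry of second
  derivatives (\<open>slow_equation\<close>, \<open>fiber_equation\<close>).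

  A CSP frame \<open>(A, B)\<close> is exact when the lower rows \<open>B\<^sup>2\<close> annihilate \<open>E\<close> and the upper rows \<open>B\<^sup>1\<close>
  annihilate \<open>T\<close>. In the coordinates \<open>Z = B E\<close> of the frame, invariance becomes
  \<open>Z \<nu> = \<Lambda> Z - \<partial>Z\<close>, and likewise for \<open>T\<close>. Solving its two block rows for the off-diagonal blocks
  of \<open>\<Lambda>\<close> expresses the residuals of the refined frame through those of the old one, for
  instance \<open>R' = (\<Lambda>\<^sup>1\<^sup>1)\<^sup>-\<^sup>1 (R \<kappa> + \<partial>R)\<close> for \<open>R = B\<^sup>1 T\<close>. As \<open>\<partial>\<close> is \<open>\<epsilon>\<close> times a derivative with respect
  to \<open>y\<close>, every term gains a factor \<open>\<epsilon>\<close>, provided that the bound on \<open>R\<close> survives differentiation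
  in \<open>y\<close>. Orders are therefore measured by jets: a function has order \<open>q\<close> if it and all its
  \<open>y\<close>-derivatives are \<open>O(\<epsilon>\<^sup>q)\<close>. This is \<open>refinement_step\<close>; by induction
  (\<open>csp_order_exists\<close>) \<open>B\<^sup>2 E\<close> has order \<open>q + 1\<close> and \<open>B\<^sup>1 T\<close> has order \<open>q\<close> after \<open>q\<close> refinements.

  The second of these bounds makes \<open>B\<^sup>1 g\<close> of order \<open>q + 1\<close> on \<open>M\<^sub>\<epsilon>\<close>, because \<open>g\<close> is \<open>\<epsilon>\<close> times a
  tangent vector there, so \<open>\<psi>\<^sub>q - h\<^sub>\<epsilon> = O(\<epsilon>\<^bsup>q + 1\<^esup>)\<close> (\<open>manifold_step\<close>). By the first one
  \<open>E - A\<^sub>1 B\<^sup>1 E = A\<^sub>2 B\<^sup>2 E\<close> is \<open>O(\<epsilon>\<^bsup>q + 1\<^esup>)\<close>, also at the point of the CSP manifold, and the columns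
  of \<open>A\<^sub>1 B\<^sup>1 E\<close> are a basis of the CSP fiber (\<open>fiber_agreement\<close>). Both bases have asymptotic
  expansions because a function of \<open>\<epsilon>\<close> all of whose derivatives are bounded near \<open>0\<close> has one; for
  \<open>\<psi>\<^sub>q\<close> this regularity comes from a smooth implicit function theorem.

  The point \<open>y\<close> may lie on the boundary of \<open>K\<close>, where the invariance equations are not available.
  All order estimates are made over the interior of \<open>K\<close> near \<open>y\<close> and reach \<open>y\<close> by
  continuity (\<open>bound_on_boundary_line\<close>).\<close>

section \<open>Calculus of \<open>C\<^sup>k\<close> maps\<close>

lemma Ck_open_has_derivative:
  assumes "Ck_open (Suc k) U f" "x \<in> U"
  shows "(f has_derivative frechet_derivative f (at x)) (at x)"
  using assms frechet_derivative_works by auto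

lemma Ck_open_cong:
  assumes "open U" "\<And>x. x \<in> U \<Longrightarrow> f x = g x" "Ck_open k U f"
  shows "Ck_open k U g"
  using assms(2,3)
proof (induction k arbitrary: f g)
  case 0
  then show ?case by (auto cong: continuous_on_cong)
next
  case (Suc k)
  have d: "(g has_derivative frechet_derivative f (at x)) (at x)" if "x \<in> U" for x
    using has_derivative_transform_within_open[OF Ck_open_has_derivative[OF Suc.prems(2) that] assms(1) that]
      Suc.prems(1) by auto
  have eq: "frechet_derivative f (at x) = frechet_derivative g (at x)" if "x \<in> U" for x
    using frechet_derivative_at[OF d[OF that]] .
  have "Ck_open k U (\<lambda>x. frechet_derivative g (at x) v)" for v
    by (rule Suc.IH[of "\<lambda>x. frechet_derivative f (at x) v"]) (use Suc.prems(2) eq in auto)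
  then show ?case using d by (auto simp: differentiable_def)
qed

text \<open>The induction on \<open>k\<close> in the closure properties below runs through this rule: it suffices to
  exhibit some derivative, so that \<open>frechet_derivative\<close> never has to be computed.\<close>
lemma Ck_open_SucI:
  assumes "open U" "\<And>x. x \<in> U \<Longrightarrow> (f has_derivative f' x) (at x)"
    "\<And>v. Ck_open k U (\<lambda>x. f' x v)"
  shows "Ck_open (Suc k) U f"
proof -
  have "Ck_open k U (\<lambda>x. frechet_derivative f (at x) v)" for v
    by (rule Ck_open_cong[OF assms(1) _ assms(3)[of v]])
      (use frechet_derivative_at[OF assms(2)] in auto)
  then show ?thesis using assms(2) by (auto simp: differentiable_def)
qed

lemma Ck_open_subset: "Ck_open k U f \<Longrightarrow> V \<subseteq> U \<Longrightarrow> Ck_open k V f"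
  by (induction k arbitrary: f) (auto intro: continuous_on_subset)

lemma Ck_open_Suc_imp: "Ck_open (Suc k) U f \<Longrightarrow> Ck_open k U f"
proof (induction k arbitrary: f)
  case 0
  then show ?case
    by (auto intro!: continuous_at_imp_continuous_on differentiable_imp_continuous_within)
qed auto

lemma Ck_open_mono: "Ck_open k U f \<Longrightarrow> j \<le> k \<Longrightarrow> Ck_open j U f"
proof (induction k)
  case (Suc k)
  then show ?case using Ck_open_Suc_imp[of k U f] by (cases "j = Suc k") auto
qed simp

lemma Ck_open_continuous_on: "Ck_open k U f \<Longrightarrow> continuous_on U f"
  using Ck_open_mono[of k U f 0] by simp

lemma Ck_open_const [simp]: "Ck_open k U (\<lambda>x. c)"
  by (induction k arbitrary: c) auto

lemma Ck_open_bounded_linear: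
  assumes "bounded_linear L" "open U"
  shows "Ck_open k U L"
proof (cases k)
  case 0
  then show ?thesis using assms(1) by (simp add: linear_continuous_on)
next
  case (Suc j)
  show ?thesis unfolding Suc
    by (rule Ck_open_SucI[where f' = "\<lambda>x. L"])
      (use assms bounded_linear_imp_has_derivative in auto)
qed

lemma Ck_open_add:
  assumes "open U" "Ck_open k U f" "Ck_open k U g"
  shows "Ck_open k U (\<lambda>x. f x + g x)"
  using assms(2,3)
proof (induction k arbitrary: f g)
  case 0
  then show ?case by (auto intro: continuous_on_add)
next
  case (Suc k)
  show ?case
    by (rule Ck_open_SucI[OF assms(1)
          has_derivative_add[OF Ck_open_has_derivative[OF Suc.prems(1)] Ck_open_has_derivative[OF Suc.prems(2)]]])
      (use Suc in auto)
qed

lemma Ck_open_bilinear: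
  assumes "bounded_bilinear pr" "open U" "Ck_open k U f" "Ck_open k U g"
  shows "Ck_open k U (\<lambda>x. pr (f x) (g x))"
  using assms(3,4)
proof (induction k arbitrary: f g)
  case 0
  then show ?case using bounded_bilinear.continuous_on[OF assms(1)] by auto
next
  case (Suc k)
  show ?case
    by (rule Ck_open_SucI[OF assms(2)
          bounded_bilinear.FDERIV[OF assms(1) Ck_open_has_derivative[OF Suc.prems(1)] Ck_open_has_derivative[OF Suc.prems(2)]]])
      (use Suc Ck_open_Suc_imp[OF Suc.prems(1)] Ck_open_Suc_imp[OF Suc.prems(2)] in
        \<open>auto intro!: Ck_open_add[OF assms(2)]\<close>)
qed

lemma Ck_open_linear_compose:
  assumes "bounded_linear L" "open U" "Ck_open k U f"
  shows "Ck_open k U (\<lambda>x. L (f x))"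
  using assms(3)
proof (induction k arbitrary: f)
  case 0
  then show ?case using bounded_linear.continuous_on[OF assms(1)] by auto
next
  case (Suc k)
  show ?case
    by (rule Ck_open_SucI[OF assms(2)
          bounded_linear.has_derivative[OF assms(1) Ck_open_has_derivative[OF Suc.prems]]])
      (use Suc in auto)
qed

lemma Ck_open_sum:
  assumes "open U" "\<And>i. i \<in> I \<Longrightarrow> Ck_open k U (f i)"
  shows "Ck_open k U (\<lambda>x. \<Sum>i\<in>I. f i x)"
  using assms(2) by (induction I rule: infinite_finite_induct) (auto intro!: Ck_open_add[OF assms(1)])

lemma linear_expand_Basis:
  fixes L :: "'a::euclidean_space \<Rightarrow> 'b::real_vector"
  assumes "linear L"
  shows "L v = (\<Sum>b\<in>Basis. (v \<bullet> b) *\<^sub>R L b)"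
proof -
  have "L v = L (\<Sum>b\<in>Basis. (v \<bullet> b) *\<^sub>R b)" by (simp add: euclidean_representation)
  then show ?thesis by (simp add: linear_sum[OF assms] linear_scale[OF assms])
qed

text \<open>Expanding the outer derivative in the standard basis turns the chain rule into a finite sum of
  products to which the induction hypothesis applies.\<close>
lemma Ck_open_compose:
  fixes G :: "'b::euclidean_space \<Rightarrow> 'c::euclidean_space" and u :: "'a::euclidean_space \<Rightarrow> 'b"
  assumes "open U" "Ck_open k V G" "Ck_open k U u" "u ` U \<subseteq> V"
  shows "Ck_open k U (\<lambda>x. G (u x))"
  using assms(2,3)
proof (induction k arbitrary: G)
  case 0
  then show ?case using continuous_on_compose2[of V G U u] assms(4) by auto
next
  case (Suc k)
  have d: "((\<lambda>x. G (u x)) has_derivative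
      (\<lambda>v. \<Sum>b\<in>Basis. (frechet_derivative u (at x) v \<bullet> b) *\<^sub>R frechet_derivative G (at (u x)) b)) (at x)"
    if "x \<in> U" for x
  proof -
    have "u x \<in> V" using that assms(4) by auto
    note G = Ck_open_has_derivative[OF Suc.prems(1) this]
    from has_derivative_compose[OF Ck_open_has_derivative[OF Suc.prems(2) that] G]
    show ?thesis
      by (simp add: linear_expand_Basis[OF has_derivative_linear[OF G], symmetric] o_def)
  qed
  show ?case
    by (rule Ck_open_SucI[OF assms(1) d])
      (use Suc Ck_open_Suc_imp[OF Suc.prems(2)] in
        \<open>auto intro!: Ck_open_sum[OF assms(1)] Ck_open_bilinear[OF bounded_bilinear_scaleR assms(1)]
          Ck_open_linear_compose[OF bounded_linear_inner_left assms(1)]\<close>)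
qed

lemma Ck_open_Pair:
  assumes "open U" "Ck_open k U f" "Ck_open k U g"
  shows "Ck_open k U (\<lambda>x. (f x, g x))"
proof -
  have 1: "bounded_linear (\<lambda>a::'b. (a, 0::'c))" and 2: "bounded_linear (\<lambda>b::'c. (0::'b, b))"
    by (auto intro!: bounded_linear_Pair bounded_linear_ident)
  show ?thesis
    using Ck_open_add[OF assms(1) Ck_open_linear_compose[OF 1 assms(1,2)] Ck_open_linear_compose[OF 2 assms(1,3)]]
    by simp
qed

lemma bounded_bilinear_matrix_mult:
  "bounded_bilinear (matrix_matrix_mult :: real^'a^'b \<Rightarrow> real^'c^'a \<Rightarrow> real^'c^'b)"
  unfolding bilinear_conv_bounded_bilinear[symmetric] bilinear_def
  by (auto intro!: linearI simp: matrix_add_ldistrib matrix_scalar_ac scalar_matrix_assoc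
      matrix_matrix_mult_def vec_eq_iff sum.distrib algebra_simps sum_distrib_left)

lemma bounded_bilinear_matrix_vector:
  "bounded_bilinear ((*v) :: real^'a^'b \<Rightarrow> real^'a \<Rightarrow> real^'b)"
  unfolding bilinear_conv_bounded_bilinear[symmetric] bilinear_def
  by (auto intro!: linearI simp: matrix_vector_mult_def vec_eq_iff sum.distrib algebra_simps sum_distrib_left)

lemma matrix_inv_mult:
  fixes M :: "real^'n^'m"
  assumes "invertible M"
  shows "matrix_inv M ** M = mat 1" "M ** matrix_inv M = mat 1"
  using someI_ex[OF assms[unfolded invertible_def]] unfolding matrix_inv_def by blast+

lemma open_invertible: "open {M :: real^'n^'n. invertible M}"
proof -
  have "continuous_on UNIV (det :: real^'n^'n \<Rightarrow> real)"
    unfolding det_def by (intro continuous_intros)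
  then have "open (det -` (-{0}) :: (real^'n^'n) set)"
    by (intro open_vimage) auto
  then show ?thesis by (simp add: invertible_det_nz vimage_def Compl_eq)
qed

text \<open>By Cramer's rule the entries of the inverse are quotients of determinants.\<close>
lemma continuous_on_matrix_inv: "continuous_on {M :: real^'n^'n. invertible M} matrix_inv"
proof -
  have entry: "matrix_inv M $ k $ j = det (\<chi> i l. if l = k then axis j 1 $ i else M $ i $ l) / det M"
    if "invertible M" for M :: "real^'n^'n" and k j
  proof -
    have "M *v (matrix_inv M *v axis j 1) = axis j 1"
      by (simp add: matrix_vector_mul_assoc matrix_inv_mult[OF that])
    with cramer[of M] that
    have "matrix_inv M *v axis j 1 = (\<chi> k. det (\<chi> i l. if l = k then axis j 1 $ i else M $ i $ l) / det M)"
      by (simp add: invertible_det_nz)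
    then have "(matrix_inv M *v axis j 1) $ k = det (\<chi> i l. if l = k then axis j 1 $ i else M $ i $ l) / det M"
      by simp
    then show ?thesis by (simp add: matrix_vector_mul_component inner_axis column_def matrix_vector_mult_basis)
  qed
  have c: "continuous_on S (\<lambda>M :: real^'n^'n. if l = k then c else M $ i $ l)" for S l k c i
    by (cases "l = k") (auto intro!: continuous_intros)
  have "continuous_on {M :: real^'n^'n. invertible M}
      (\<lambda>M. \<chi> k j. det (\<chi> i l. if l = k then axis j 1 $ i else M $ i $ l) / det M)"
    unfolding det_def
    by (intro continuous_on_vec_lambda continuous_on_divide continuous_intros)
      (auto simp: det_def[symmetric] invertible_det_nz intro!: continuous_intros c)
  then show ?thesis
    by (rule continuous_on_eq) (auto simp: vec_eq_iff entry)
qed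

text \<open>Given continuity, differentiability follows from
  \<open>X\<^sup>-\<^sup>1 - M\<^sup>-\<^sup>1 = - X\<^sup>-\<^sup>1 (X - M) M\<^sup>-\<^sup>1\<close>, and the derivative is again made of inverses, which yields all
  orders of smoothness at once.\<close>
lemma has_derivative_matrix_inv:
  fixes M :: "real^'n^'n"
  assumes "invertible M"
  shows "(matrix_inv has_derivative (\<lambda>H. - (matrix_inv M ** H ** matrix_inv M))) (at M)"
proof -
  interpret mm: bounded_bilinear "matrix_matrix_mult :: real^'n^'n \<Rightarrow> real^'n^'n \<Rightarrow> real^'n^'n"
    by (rule bounded_bilinear_matrix_mult)
  obtain B where B: "B > 0" "\<And>a b. norm ((a :: real^'n^'n) ** (b :: real^'n^'n)) \<le> norm a * norm b * B"
    using mm.pos_bounded by auto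
  let ?i = "matrix_inv :: real^'n^'n \<Rightarrow> real^'n^'n"
  have bl: "bounded_linear (\<lambda>H. - (?i M ** H ** ?i M))"
    by (intro bounded_linear_minus bounded_linear_compose[OF mm.bounded_linear_left]
        mm.bounded_linear_right)
  have cont: "isCont ?i M"
    using continuous_on_matrix_inv open_invertible assms continuous_on_eq_continuous_at by blast
  have ev: "eventually (\<lambda>X. invertible X) (at M)"
    using open_invertible assms eventually_at_topological by blast
  have "((\<lambda>X. norm (?i X - ?i M) * (B * B * norm (?i M))) \<longlongrightarrow> 0) (at M)"
    using cont by (intro tendsto_mult_left_zero tendsto_norm_zero) (simp add: isCont_def LIM_zero)
  then have "((\<lambda>X. (1 / norm (X - M)) *\<^sub>R (?i X - (?i M + - (?i M ** (X - M) ** ?i M)))) \<longlongrightarrow> 0) (at M)"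
  proof (rule Lim_null_comparison[rotated])
    show "\<forall>\<^sub>F X in at M. norm ((1 / norm (X - M)) *\<^sub>R (?i X - (?i M + - (?i M ** (X - M) ** ?i M))))
        \<le> norm (?i X - ?i M) * (B * B * norm (?i M))"
      using ev eventually_neq_at_within[of M M UNIV]
    proof eventually_elim
      case (elim X)
      have id: "?i X - ?i M = - (?i X ** (X - M) ** ?i M)"
        by (simp add: mm.diff_left mm.diff_right matrix_inv_mult[OF elim(1)]
            matrix_mul_assoc[symmetric] matrix_inv_mult[OF assms])
      define e where "e = ?i X - (?i M + - (?i M ** (X - M) ** ?i M))"
      have "e = - ((?i X - ?i M) ** (X - M) ** ?i M)"
        using id by (simp add: e_def mm.diff_left algebra_simps)
      also have "norm \<dots> \<le> norm ((?i X - ?i M) ** (X - M)) * norm (?i M) * B"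
        using B(2) by simp
      also have "\<dots> \<le> (norm (?i X - ?i M) * norm (X - M) * B) * norm (?i M) * B"
        using B by (intro mult_right_mono) auto
      finally show ?case using elim(2) unfolding e_def[symmetric] by (simp add: field_simps)
    qed
  qed
  then show ?thesis using bl unfolding has_derivative_within by simp
qed

lemma Ck_open_matrix_inv: "Ck_open k {M :: real^'n^'n. invertible M} matrix_inv"
proof (induction k)
  case 0
  then show ?case by (simp add: continuous_on_matrix_inv)
next
  case (Suc k)
  have "Ck_open k {M :: real^'n^'n. invertible M} (\<lambda>M. - (matrix_inv M ** v ** matrix_inv M))" for v :: "real^'n^'n"
    by (intro Ck_open_linear_compose[OF bounded_linear_minus[OF bounded_linear_ident] open_invertible]
        Ck_open_bilinear[OF bounded_bilinear_matrix_mult open_invertible] Suc Ck_open_const)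
  then show ?case
    by (intro Ck_open_SucI[OF open_invertible has_derivative_matrix_inv]) auto
qed

section \<open>Orders of magnitude that survive differentiation\<close>

text \<open>Along the filter \<open>F\<close>, all iterated derivatives of \<open>f\<close> of order at most \<open>k\<close> in directions from \<open>D\<close>
  are \<open>O(w\<^sup>q)\<close>. Three instances occur: directions \<open>y\<close> with weight \<open>\<epsilon>\<close>, for orders that survive
  differentiation along the slow manifold; all directions with weight \<open>1\<close>, for functions of \<open>\<epsilon>\<close>
  with bounded derivatives; and no direction with weight \<open>\<epsilon>\<close>, for plain orders of magnitude.\<close>
primrec jetO :: "'a filter \<Rightarrow> 'a set \<Rightarrow> ('a \<Rightarrow> real) \<Rightarrow> nat \<Rightarrow> nat
    \<Rightarrow> ('a::euclidean_space \<Rightarrow> 'b::euclidean_space) \<Rightarrow> bool" where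
  "jetO F D w 0 q f \<longleftrightarrow> (\<exists>C. \<forall>\<^sub>F x in F. norm (f x) \<le> C * w x ^ q)"
| "jetO F D w (Suc k) q f \<longleftrightarrow>
     (\<exists>C. \<forall>\<^sub>F x in F. norm (f x) \<le> C * w x ^ q) \<and>
     (\<forall>\<^sub>F x in F. f differentiable (at x)) \<and>
     (\<forall>v\<in>D. jetO F D w k q (\<lambda>x. frechet_derivative f (at x) v))"

text \<open>The first assumption says that \<open>F\<close> lives on open sets, so that derivatives depend only on what
  happens eventually. The last one makes \<open>w\<close> a constant for differentiation in directions \<open>D\<close>; without it
  a derivative could lose a power of \<open>w\<close>.\<close>
locale jets =
  fixes F :: "'a::euclidean_space filter" and D :: "'a set" and w :: "'a \<Rightarrow> real"
  assumes ev_nhds: "eventually P F \<Longrightarrow> eventually (\<lambda>x. eventually P (nhds x)) F"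
    and w_unit: "\<forall>\<^sub>F x in F. 0 \<le> w x \<and> w x \<le> 1"
    and w_flat: "\<forall>\<^sub>F x in F. w differentiable (at x) \<and> (\<forall>v\<in>D. frechet_derivative w (at x) v = 0)"
begin

abbreviation jet :: "nat \<Rightarrow> nat \<Rightarrow> ('a \<Rightarrow> 'b::euclidean_space) \<Rightarrow> bool" where
  "jet \<equiv> jetO F D w"

definition Jet :: "nat \<Rightarrow> ('a \<Rightarrow> 'b::euclidean_space) \<Rightarrow> bool" where
  "Jet q f \<longleftrightarrow> (\<forall>k. jet k q f)"

lemma jet_bound_raw: "jet k q f \<Longrightarrow> \<exists>C. \<forall>\<^sub>F x in F. norm (f x) \<le> C * w x ^ q"
  by (cases k) auto

lemma jet_bound:
  assumes "jet k q f"
  obtains C where "C > 0" "\<forall>\<^sub>F x in F. norm (f x) \<le> C * w x ^ q"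
proof -
  obtain C where C: "\<forall>\<^sub>F x in F. norm (f x) \<le> C * w x ^ q" using jet_bound_raw[OF assms] by blast
  show ?thesis
  proof (rule that[of "max C 1"])
    show "\<forall>\<^sub>F x in F. norm (f x) \<le> max C 1 * w x ^ q"
      using C w_unit
    proof eventually_elim
      case (elim x)
      have "C * w x ^ q \<le> max C 1 * w x ^ q"
        using elim by (intro mult_right_mono) auto
      then show ?case using elim by simp
    qed
  qed auto
qed

lemma eventually_frechet_cong:
  assumes "\<forall>\<^sub>F x in F. f x = g x" "\<forall>\<^sub>F x in F. f differentiable (at x)"
  shows "\<forall>\<^sub>F x in F. g differentiable (at x) \<and> frechet_derivative g (at x) = frechet_derivative f (at x)"
  using ev_nhds[OF assms(1)] assms(2)
proof eventually_elim
  case (elim x)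
  then obtain U where U: "open U" "x \<in> U" "\<And>z. z \<in> U \<Longrightarrow> f z = g z"
    unfolding eventually_nhds by auto
  have "(g has_derivative frechet_derivative f (at x)) (at x)"
    using has_derivative_transform_within_open[OF _ U(1,2)] U(3) elim(2)
    unfolding frechet_derivative_works by metis
  then show ?case using frechet_derivative_at differentiableI by metis
qed

lemma jet_cong:
  assumes "\<forall>\<^sub>F x in F. f x = g x" "jet k q f"
  shows "jet k q g"
  using assms
proof (induction k arbitrary: f g)
  case 0
  then obtain C where "\<forall>\<^sub>F x in F. norm (f x) \<le> C * w x ^ q" by auto
  with 0(1) have "\<forall>\<^sub>F x in F. norm (g x) \<le> C * w x ^ q" by eventually_elim simp
  then show ?case by auto
next
  case (Suc k)
  obtain C where "\<forall>\<^sub>F x in F. norm (f x) \<le> C * w x ^ q" using Suc.prems by auto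
  with Suc.prems(1) have 1: "\<forall>\<^sub>F x in F. norm (g x) \<le> C * w x ^ q" by eventually_elim simp
  have e: "\<forall>\<^sub>F x in F. g differentiable (at x) \<and> frechet_derivative g (at x) = frechet_derivative f (at x)"
    using eventually_frechet_cong[OF Suc.prems(1)] Suc.prems(2) by auto
  have "jet k q (\<lambda>x. frechet_derivative g (at x) v)" if "v \<in> D" for v
    by (rule Suc.IH[of "\<lambda>x. frechet_derivative f (at x) v"])
      (use e Suc.prems(2) that in \<open>auto elim: eventually_mono\<close>)
  with 1 e show ?case by (auto elim: eventually_mono)
qed

lemma jet_SucI:
  assumes "\<exists>C. \<forall>\<^sub>F x in F. norm (f x) \<le> C * w x ^ q"
    "\<forall>\<^sub>F x in F. (f has_derivative f' x) (at x)"
    "\<And>v. v \<in> D \<Longrightarrow> jet k q (\<lambda>x. f' x v)"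
  shows "jet (Suc k) q f"
proof -
  have "jet k q (\<lambda>x. frechet_derivative f (at x) v)" if "v \<in> D" for v
  proof (rule jet_cong[OF _ assms(3)[OF that]])
    show "\<forall>\<^sub>F x in F. f' x v = frechet_derivative f (at x) v"
      using assms(2) by eventually_elim (metis frechet_derivative_at)
  qed
  then show ?thesis using assms(1,2) by (auto elim: eventually_mono simp: differentiable_def)
qed

lemma jet_SucD:
  assumes "jet (Suc k) q f"
  shows "\<forall>\<^sub>F x in F. (f has_derivative frechet_derivative f (at x)) (at x)"
    and "v \<in> D \<Longrightarrow> jet k q (\<lambda>x. frechet_derivative f (at x) v)"
  using assms by (auto simp: frechet_derivative_works)

lemma jet_Suc_imp: "jet (Suc k) q f \<Longrightarrow> jet k q f"
  by (induction k arbitrary: f) auto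

lemma jet_weaken:
  assumes "jet k p f" "q \<le> p"
  shows "jet k q f"
proof -
  have *: "\<exists>C. \<forall>\<^sub>F x in F. norm (f x) \<le> C * w x ^ q" if j: "jet j p f" for j and f :: "'a \<Rightarrow> 'b"
  proof -
    obtain C where C: "C > 0" "\<forall>\<^sub>F x in F. norm (f x) \<le> C * w x ^ p"
      using j by (rule jet_bound)
    from C(2) w_unit have "\<forall>\<^sub>F x in F. norm (f x) \<le> C * w x ^ q"
    proof eventually_elim
      case (elim x)
      have "C * w x ^ p \<le> C * w x ^ q"
        using elim C(1) assms(2) by (intro mult_left_mono power_decreasing) auto
      then show ?case using elim by simp
    qed
    then show ?thesis by blast
  qed
  from assms(1) show ?thesis
  proof (induction k arbitrary: f)
    case 0 then show ?case using *[of 0 f] by simp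
  next
    case (Suc k) then show ?case using *[of "Suc k" f] by auto
  qed
qed

lemma jet_zero: "jet k q (\<lambda>x. 0)"
  by (induction k) (auto intro!: exI[of _ 0])

lemma jet_const: "jet k 0 (\<lambda>x. c)"
  by (cases k) (auto intro!: exI[of _ "norm c"] jet_zero)

lemma jet_add:
  assumes "jet k q f" "jet k q g"
  shows "jet k q (\<lambda>x. f x + g x)"
  using assms
proof (induction k arbitrary: f g)
  case 0
  then obtain C C' where "\<forall>\<^sub>F x in F. norm (f x) \<le> C * w x ^ q" "\<forall>\<^sub>F x in F. norm (g x) \<le> C' * w x ^ q"
    by (auto simp only: jetO.simps)
  then have "\<forall>\<^sub>F x in F. norm (f x + g x) \<le> (C + C') * w x ^ q"
  proof eventually_elim
    case (elim x)
    then show ?case using norm_triangle_ineq[of "f x" "g x"] by (simp add: distrib_right)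
  qed
  then show ?case by auto
next
  case (Suc k)
  have "\<forall>\<^sub>F x in F. ((\<lambda>x. f x + g x) has_derivative
      (\<lambda>v. frechet_derivative f (at x) v + frechet_derivative g (at x) v)) (at x)"
    using jet_SucD(1)[OF Suc.prems(1)] jet_SucD(1)[OF Suc.prems(2)]
    by eventually_elim (rule has_derivative_add)
  moreover have "\<exists>C. \<forall>\<^sub>F x in F. norm (f x + g x) \<le> C * w x ^ q"
    by (rule jet_bound_raw[of k], rule Suc.IH[OF Suc.prems[THEN jet_Suc_imp]])
  ultimately show ?case
    by (intro jet_SucI) (auto intro!: Suc.IH jet_SucD(2)[OF Suc.prems(1)] jet_SucD(2)[OF Suc.prems(2)])
qed

lemma jet_bilinear:
  assumes pr: "bounded_bilinear pr" and "jet k p f" "jet k q g"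
  shows "jet k (p + q) (\<lambda>x. pr (f x) (g x))"
  using assms(2,3)
proof (induction k arbitrary: f g)
  case 0
  obtain B where B: "B > 0" "\<And>a b. norm (pr a b) \<le> norm a * norm b * B"
    using bounded_bilinear.pos_bounded[OF pr] by auto
  obtain C where C: "C > 0" "\<forall>\<^sub>F x in F. norm (f x) \<le> C * w x ^ p" using 0(1) by (rule jet_bound)
  obtain C' where C': "C' > 0" "\<forall>\<^sub>F x in F. norm (g x) \<le> C' * w x ^ q" using 0(2) by (rule jet_bound)
  have "\<forall>\<^sub>F x in F. norm (pr (f x) (g x)) \<le> (C * C' * B) * w x ^ (p + q)"
    using C(2) C'(2) w_unit
  proof eventually_elim
    case (elim x)
    have "norm (pr (f x) (g x)) \<le> norm (f x) * norm (g x) * B" by (rule B)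
    also have "\<dots> \<le> (C * w x ^ p) * (C' * w x ^ q) * B"
      using elim B C C' by (intro mult_right_mono mult_mono) auto
    finally show ?case by (simp add: power_add algebra_simps)
  qed
  then show ?case by auto
next
  case (Suc k)
  have "\<forall>\<^sub>F x in F. ((\<lambda>x. pr (f x) (g x)) has_derivative
      (\<lambda>v. pr (f x) (frechet_derivative g (at x) v) + pr (frechet_derivative f (at x) v) (g x))) (at x)"
    using jet_SucD(1)[OF Suc.prems(1)] jet_SucD(1)[OF Suc.prems(2)]
    by eventually_elim (rule bounded_bilinear.FDERIV[OF pr])
  moreover have "\<exists>C. \<forall>\<^sub>F x in F. norm (pr (f x) (g x)) \<le> C * w x ^ (p + q)"
    by (rule jet_bound_raw[of k], rule Suc.IH[OF Suc.prems[THEN jet_Suc_imp]])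
  ultimately show ?case
    by (intro jet_SucI)
      (auto intro!: jet_add Suc.IH jet_SucD(2)[OF Suc.prems(1)] jet_SucD(2)[OF Suc.prems(2)]
        jet_Suc_imp[OF Suc.prems(1)] jet_Suc_imp[OF Suc.prems(2)])
qed

lemma jet_linear:
  assumes "bounded_linear L" "jet k q f"
  shows "jet k q (\<lambda>x. L (f x))"
  using jet_bilinear[OF bounded_bilinear.comp[OF bounded_bilinear_scaleR bounded_linear_ident assms(1)]
      jet_const[of k 1] assms(2)] by simp

lemma jet_sum:
  assumes "\<And>i. i \<in> I \<Longrightarrow> jet k q (f i)"
  shows "jet k q (\<lambda>x. \<Sum>i\<in>I. f i x)"
  using assms by (induction I rule: infinite_finite_induct) (auto intro!: jet_add jet_zero)

text \<open>The inner function may be known only along \<open>F\<close>, the outer one is smooth across the limit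
  point; its derivatives are bounded there by continuity.\<close>
lemma jet_compose:
  fixes G :: "'c::euclidean_space \<Rightarrow> 'b::euclidean_space"
  assumes "open V" "P \<in> V" "(u \<longlongrightarrow> P) F" "Ck_open k V G" "jet k 0 u"
  shows "jet k 0 (\<lambda>x. G (u x))"
  using assms(4,5)
proof (induction k arbitrary: G)
  case 0
  have "isCont G P" using 0 assms(1,2) by (simp add: continuous_on_eq_continuous_at)
  then have "((\<lambda>x. norm (G (u x))) \<longlongrightarrow> norm (G P)) F"
    by (intro tendsto_norm isCont_tendsto_compose[OF _ assms(3)])
  then have "\<forall>\<^sub>F x in F. norm (G (u x)) < norm (G P) + 1"
    by (rule order_tendstoD) simp
  then show ?case by (auto intro!: exI[of _ "norm (G P) + 1"] elim: eventually_mono)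
next
  case (Suc k)
  have "\<forall>\<^sub>F x in F. u x \<in> V" using topological_tendstoD[OF assms(3,1,2)] .
  with jet_SucD(1)[OF Suc.prems(2)]
  have "\<forall>\<^sub>F x in F. ((\<lambda>x. G (u x)) has_derivative
      (\<lambda>v. \<Sum>b\<in>Basis. (frechet_derivative u (at x) v \<bullet> b) *\<^sub>R frechet_derivative G (at (u x)) b)) (at x)"
  proof eventually_elim
    case (elim x)
    note G = Ck_open_has_derivative[OF Suc.prems(1) elim(2)]
    from has_derivative_compose[OF elim(1) G]
    show ?case
      by (simp add: linear_expand_Basis[OF has_derivative_linear[OF G], symmetric] o_def)
  qed
  moreover have "\<exists>C. \<forall>\<^sub>F x in F. norm (G (u x)) \<le> C * w x ^ 0"
    by (rule jet_bound_raw[of k], rule Suc.IH[OF Ck_open_Suc_imp[OF Suc.prems(1)] jet_Suc_imp[OF Suc.prems(2)]])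
  moreover have "jet k 0 (\<lambda>x. \<Sum>b\<in>Basis. (frechet_derivative u (at x) v \<bullet> b) *\<^sub>R frechet_derivative G (at (u x)) b)"
    if "v \<in> D" for v
  proof (rule jet_sum)
    fix b :: 'c assume "b \<in> Basis"
    have "jet k (0 + 0) (\<lambda>x. (frechet_derivative u (at x) v \<bullet> b) *\<^sub>R frechet_derivative G (at (u x)) b)"
      by (intro jet_bilinear[OF bounded_bilinear_scaleR] jet_linear[OF bounded_linear_inner_left]
          jet_SucD(2)[OF Suc.prems(2) that] Suc.IH jet_Suc_imp[OF Suc.prems(2)])
        (use Suc.prems(1) in auto)
    then show "jet k 0 (\<lambda>x. (frechet_derivative u (at x) v \<bullet> b) *\<^sub>R frechet_derivative G (at (u x)) b)" by simp
  qed
  ultimately show ?case by (intro jet_SucI) auto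
qed

lemma jet_w: "jet k 1 w"
proof -
  have "\<forall>\<^sub>F x in F. norm (w x) \<le> 1 * w x ^ 1"
    using w_unit by eventually_elim auto
  then have b: "\<exists>C. \<forall>\<^sub>F x in F. norm (w x) \<le> C * w x ^ 1" by blast
  show ?thesis
  proof (cases k)
    case 0 then show ?thesis using b by simp
  next
    case (Suc j)
    have "jet j 1 (\<lambda>x. frechet_derivative w (at x) v)" if "v \<in> D" for v
      by (rule jet_cong[OF _ jet_zero]) (use w_flat that in \<open>auto elim: eventually_mono\<close>)
    then show ?thesis unfolding Suc using b w_flat
      by (auto elim: eventually_mono)
  qed
qed

lemma jet_tendsto_zero:
  assumes "jet k q f" "q > 0" "(w \<longlongrightarrow> 0) F"
  shows "(f \<longlongrightarrow> 0) F"
proof -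
  obtain C where C: "\<forall>\<^sub>F x in F. norm (f x) \<le> C * w x ^ q" using jet_bound_raw[OF assms(1)] by blast
  have "((\<lambda>x. C * w x ^ q) \<longlongrightarrow> C * 0 ^ q) F" by (intro tendsto_intros assms)
  then show ?thesis using Lim_null_comparison[OF C] assms(2) by (simp add: power_0_left)
qed

subsection \<open>All orders of differentiation at once\<close>

lemma Jet_cong: "\<forall>\<^sub>F x in F. f x = g x \<Longrightarrow> Jet q f \<Longrightarrow> Jet q g"
  unfolding Jet_def by (blast intro: jet_cong)

lemma Jet_bound: "Jet q f \<Longrightarrow> \<exists>C. \<forall>\<^sub>F x in F. norm (f x) \<le> C * w x ^ q"
  unfolding Jet_def using jet_bound_raw by blast

lemma Jet_weaken: "Jet p f \<Longrightarrow> q \<le> p \<Longrightarrow> Jet q f"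
  unfolding Jet_def by (blast intro: jet_weaken)

lemma Jet_const: "Jet 0 (\<lambda>x. c)"
  by (simp add: Jet_def jet_const)

lemma Jet_add: "Jet q f \<Longrightarrow> Jet q g \<Longrightarrow> Jet q (\<lambda>x. f x + g x)"
  by (simp add: Jet_def jet_add)

lemma Jet_linear: "bounded_linear L \<Longrightarrow> Jet q f \<Longrightarrow> Jet q (\<lambda>x. L (f x))"
  by (simp add: Jet_def jet_linear)

lemma Jet_diff: "Jet q f \<Longrightarrow> Jet q g \<Longrightarrow> Jet q (\<lambda>x. f x - g x)"
  using Jet_add[of q f "\<lambda>x. - g x"] Jet_linear[OF bounded_linear_minus[OF bounded_linear_ident], of q g] by simp

lemma Jet_sum: "(\<And>i. i \<in> I \<Longrightarrow> Jet q (f i)) \<Longrightarrow> Jet q (\<lambda>x. \<Sum>i\<in>I. f i x)"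
  by (simp add: Jet_def jet_sum)

lemma Jet_bilinear: "bounded_bilinear pr \<Longrightarrow> Jet p f \<Longrightarrow> Jet q g \<Longrightarrow> Jet (p + q) (\<lambda>x. pr (f x) (g x))"
  by (simp add: Jet_def jet_bilinear)

lemma Jet_matrix_mult:
  fixes f :: "'a \<Rightarrow> real^'d^'c" and g :: "'a \<Rightarrow> real^'e^'d"
  shows "Jet p f \<Longrightarrow> Jet q g \<Longrightarrow> r \<le> p + q \<Longrightarrow> Jet r (\<lambda>x. f x ** g x)"
  by (rule Jet_weaken[OF Jet_bilinear[OF bounded_bilinear_matrix_mult]])

lemma Jet_matrix_vector:
  fixes f :: "'a \<Rightarrow> real^'d^'c" and g :: "'a \<Rightarrow> real^'d"
  shows "Jet p f \<Longrightarrow> Jet q g \<Longrightarrow> r \<le> p + q \<Longrightarrow> Jet r (\<lambda>x. f x *v g x)"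
  by (rule Jet_weaken[OF Jet_bilinear[OF bounded_bilinear_matrix_vector]])

lemma Jet_w_scale: "Jet q f \<Longrightarrow> Jet (Suc q) (\<lambda>x. w x *\<^sub>R f x)"
  using Jet_bilinear[OF bounded_bilinear_scaleR, of 1 w q f] jet_w unfolding Jet_def by auto

lemma Jet_differentiable: "Jet q f \<Longrightarrow> \<forall>\<^sub>F x in F. (f has_derivative frechet_derivative f (at x)) (at x)"
  unfolding Jet_def using jet_SucD(1) by blast

lemma Jet_derivative: "Jet q f \<Longrightarrow> v \<in> D \<Longrightarrow> Jet q (\<lambda>x. frechet_derivative f (at x) v)"
  unfolding Jet_def using jet_SucD(2) by blast

lemma Jet_compose:
  assumes "open V" "P \<in> V" "(u \<longlongrightarrow> P) F" "\<And>k. Ck_open k V G" "Jet 0 u"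
  shows "Jet 0 (\<lambda>x. G (u x))"
  using assms by (auto simp: Jet_def intro: jet_compose)

lemma Jet_Pair: "Jet q f \<Longrightarrow> Jet q g \<Longrightarrow> Jet q (\<lambda>x. (f x, g x))"
  using Jet_add[OF Jet_linear[OF bounded_linear_Pair[OF bounded_linear_ident bounded_linear_zero], of q f]
      Jet_linear[OF bounded_linear_Pair[OF bounded_linear_zero bounded_linear_ident], of q g]] by simp

text \<open>Inversion is smooth near the invertible limit, so bounded derivatives stay bounded.\<close>
lemma Jet_matrix_inv:
  fixes f :: "'a \<Rightarrow> real^'n^'n"
  assumes "Jet 0 f" "(f \<longlongrightarrow> M) F" "invertible M"
  shows "Jet 0 (\<lambda>x. matrix_inv (f x))" "\<forall>\<^sub>F x in F. invertible (f x)"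
proof -
  show "Jet 0 (\<lambda>x. matrix_inv (f x))"
    by (rule Jet_compose[OF open_invertible _ assms(2) Ck_open_matrix_inv assms(1)]) (use assms(3) in auto)
  show "\<forall>\<^sub>F x in F. invertible (f x)"
    using topological_tendstoD[OF assms(2) open_invertible] assms(3) by auto
qed

lemma Jet_tendsto_zero: "Jet q f \<Longrightarrow> q > 0 \<Longrightarrow> (w \<longlongrightarrow> 0) F \<Longrightarrow> (f \<longlongrightarrow> 0) F"
  unfolding Jet_def by (blast intro: jet_tendsto_zero)

text \<open>Differentiation along a field whose coefficients have order \<open>p\<close> raises the order by \<open>p\<close>. For the
  slow flow \<open>p = 1\<close>; this gain is what makes every refinement step effective.\<close>
lemma Jet_directional:
  assumes "Jet q f" "finite B" "B \<subseteq> D"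
    "\<forall>\<^sub>F x in F. u x = (\<Sum>b\<in>B. c b x *\<^sub>R b)" "\<And>b. b \<in> B \<Longrightarrow> Jet p (c b)"
  shows "Jet (p + q) (\<lambda>x. frechet_derivative f (at x) (u x))"
proof (rule Jet_cong)
  show "Jet (p + q) (\<lambda>x. \<Sum>b\<in>B. c b x *\<^sub>R frechet_derivative f (at x) b)"
    by (intro Jet_sum Jet_bilinear[OF bounded_bilinear_scaleR] Jet_derivative assms(1,5)) (use assms(3) in auto)
  show "\<forall>\<^sub>F x in F. (\<Sum>b\<in>B. c b x *\<^sub>R frechet_derivative f (at x) b) = frechet_derivative f (at x) (u x)"
    using Jet_differentiable[OF assms(1)] assms(4)
  proof eventually_elim
    case (elim x)
    note l = has_derivative_linear[OF elim(1)]
    show ?case unfolding elim(2) by (simp add: linear_sum[OF l] linear_scale[OF l])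
  qed
qed

end

text \<open>One-sided limits and limits from the interior of \<open>K\<close> qualify as filters for jets although the
  limit point itself is not interior.\<close>
lemma eventually_at_within_open_nhds:
  fixes P :: "'a::t1_space"
  assumes "open S" "eventually Q (at P within S)"
  shows "eventually (\<lambda>x. eventually Q (nhds x)) (at P within S)"
proof -
  obtain U where U: "open U" "P \<in> U" "\<And>x. x \<in> U \<Longrightarrow> x \<noteq> P \<Longrightarrow> x \<in> S \<Longrightarrow> Q x"
    using assms(2) unfolding eventually_at_topological by auto
  have "open (U \<inter> S - {P})" using U(1) assms(1) by auto
  then have "eventually Q (nhds x)" if "x \<in> U" "x \<noteq> P" "x \<in> S" for x
    unfolding eventually_nhds using U(3) that by (intro exI[of _ "U \<inter> S - {P}"]) auto
  with U(1,2) show ?thesis unfolding eventually_at_topological by blast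
qed

section \<open>Asymptotic expansions from bounded derivatives\<close>

lemma eventually_at_right_0:
  assumes "eventually P (at_right (0::real))"
  obtains e where "e > 0" "\<And>t. 0 < t \<Longrightarrow> t < e \<Longrightarrow> P t"
  using assms unfolding eventually_at_right_field by auto

text \<open>A bounded derivative makes \<open>u\<close> Lipschitz, hence gives it a limit at \<open>0\<close>; the mean value estimate
  then integrates the order of \<open>u'\<close> from \<open>0\<close>.\<close>
lemma bounded_derivative_limit:
  fixes u u' :: "real \<Rightarrow> 'b::euclidean_space"
  assumes "\<forall>\<^sub>F t in at_right 0. (u has_vector_derivative u' t) (at t)"
    and "\<forall>\<^sub>F t in at_right 0. norm (u' t) \<le> C * t ^ n" and "C \<ge> 0"
  obtains c where "(u \<longlongrightarrow> c) (at_right 0)" "\<forall>\<^sub>F t in at_right 0. norm (u t - c) \<le> C * t ^ (n + 1)"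
proof -
  obtain e where e: "e > 0"
    "\<And>t. 0 < t \<Longrightarrow> t < e \<Longrightarrow> (u has_vector_derivative u' t) (at t) \<and> norm (u' t) \<le> C * t ^ n"
    using eventually_at_right_0[OF eventually_conj[OF assms(1,2)]] by metis
  have lip: "norm (u b - u a) \<le> (C * b ^ n) * (b - a)" if "0 < a" "a \<le> b" "b < e" for a b
  proof -
    have "norm (u b - u a) \<le> (C * b ^ n) * norm (b - a)"
    proof (rule differentiable_bound[of "{a..b}"])
      fix t assume t: "t \<in> {a..b}"
      show "(u has_derivative (\<lambda>h. h *\<^sub>R u' t)) (at t within {a..b})"
        using e(2)[of t] t that by (auto simp: has_vector_derivative_def has_derivative_at_withinI)
      have "norm (u' t) \<le> C * b ^ n"
        using e(2)[of t] t that assms(3) mult_left_mono[OF power_mono[of t b n] assms(3)] by auto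
      then show "onorm (\<lambda>h. h *\<^sub>R u' t) \<le> C * b ^ n"
        by (intro onorm_le) (auto simp: mult.commute intro!: mult_left_mono)
    qed (use that in auto)
    then show ?thesis using that by simp
  qed
  have "uniformly_continuous_on {0<..<e} u"
  proof (rule lipschitz_on_uniformly_continuous[of "C * e ^ n"], rule lipschitz_onI)
    show "dist (u s) (u t) \<le> C * e ^ n * dist s t" if "s \<in> {0<..<e}" "t \<in> {0<..<e}" for s t
    proof -
      have m: "C * b ^ n * x \<le> C * e ^ n * x" if "0 < b" "b < e" "x \<ge> 0" for b x
        using that assms(3) by (intro mult_right_mono mult_left_mono power_mono) auto
      show ?thesis
        using lip[of s t] lip[of t s] m[of s "s - t"] m[of t "t - s"] that
        by (cases "s \<le> t") (auto simp: dist_norm norm_minus_commute)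
    qed
  qed (use assms(3) e(1) in auto)
  then obtain c where c: "(u \<longlongrightarrow> c) (at 0 within {0<..<e})"
    by (rule uniformly_continuous_on_extension_at_closure[of _ _ 0]) (use e(1) in auto)
  have "at 0 within {0<..<e} = at_right 0"
    by (rule at_within_nhd[of 0 "{..<e}"]) (use e(1) in auto)
  with c have c: "(u \<longlongrightarrow> c) (at_right 0)" by simp
  have "norm (u t - c) \<le> C * t ^ (n + 1)" if "0 < t" "t < e" for t
  proof -
    have "((\<lambda>a. (C * t ^ n) * (t - a) - norm (u t - u a)) \<longlongrightarrow> (C * t ^ n) * (t - 0) - norm (u t - c)) (at_right 0)"
      by (intro tendsto_intros c)
    moreover have "\<forall>\<^sub>F a in at_right 0. 0 \<le> (C * t ^ n) * (t - a) - norm (u t - u a)"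
      using that lip by (auto simp: eventually_at_right_field intro!: exI[of _ t])
    ultimately have "0 \<le> (C * t ^ n) * (t - 0) - norm (u t - c)"
      by (intro tendsto_lowerbound) auto
    then show ?thesis by (simp add: mult_ac)
  qed
  then have "\<forall>\<^sub>F t in at_right 0. norm (u t - c) \<le> C * t ^ (n + 1)"
    using e(1) by (auto simp: eventually_at_right_field)
  with c that show thesis by blast
qed

lemma jets_at_right: "jets (at_right (0::real)) UNIV (\<lambda>_. 1)"
proof
  show "\<forall>\<^sub>F x in at_right 0. eventually P (nhds x)" if "eventually P (at_right 0)" for P :: "real \<Rightarrow> bool"
    by (rule eventually_at_within_open_nhds[OF _ that]) auto
qed auto

interpretation rjets: jets "at_right (0::real)" UNIV "\<lambda>_. 1"
  by (rule jets_at_right)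

definition der :: "(real \<Rightarrow> 'b::euclidean_space) \<Rightarrow> real \<Rightarrow> 'b" where
  "der u = (\<lambda>t. frechet_derivative u (at t) 1)"

lemma rjets_der:
  assumes "rjets.jet (Suc k) q u"
  shows "\<forall>\<^sub>F t in at_right 0. (u has_vector_derivative der u t) (at t)" "rjets.jet k q (der u)"
proof -
  show "\<forall>\<^sub>F t in at_right 0. (u has_vector_derivative der u t) (at t)"
    using rjets.jet_SucD(1)[OF assms]
  proof eventually_elim
    case (elim t)
    have "frechet_derivative u (at t) = (\<lambda>h. h *\<^sub>R der u t)"
    proof
      show "frechet_derivative u (at t) h = h *\<^sub>R der u t" for h
        using linear_scale[OF has_derivative_linear[OF elim], of h 1] by (simp add: der_def)
    qed
    then show ?case using elim unfolding has_vector_derivative_def by simp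
  qed
  show "rjets.jet k q (der u)" unfolding der_def using rjets.jet_SucD(2)[OF assms] by simp
qed

lemma taylor_sum_shift:
  fixes L :: "nat \<Rightarrow> 'b::real_vector" and t :: real
  shows "(\<Sum>k\<le>Suc N. t ^ k *\<^sub>R ((1 / fact k) *\<^sub>R L k))
    = L 0 + (\<Sum>k\<le>N. (t ^ Suc k / real (Suc k)) *\<^sub>R ((1 / fact k) *\<^sub>R L (Suc k)))"
proof -
  have "t ^ Suc k * (1 / fact (Suc k)) = t ^ Suc k / real (Suc k) * (1 / fact k)" for k
    unfolding fact_Suc
    by (simp only: times_divide_times_eq times_divide_eq_right mult_1_right divide_divide_eq_left)
  then have e: "t ^ Suc k *\<^sub>R ((1 / fact (Suc k)) *\<^sub>R L (Suc k))
      = (t ^ Suc k / real (Suc k)) *\<^sub>R ((1 / fact k) *\<^sub>R L (Suc k))" for k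
    by (simp only: scaleR_scaleR)
  show ?thesis unfolding sum.atMost_Suc_shift e by simp
qed

text \<open>Taylor's formula at an endpoint where the function need not be defined. The induction applies
  the formula to \<open>der u\<close> and integrates, so that the coefficients are the limits of the derivatives.\<close>
lemma taylor_at_right:
  fixes u :: "real \<Rightarrow> 'b::euclidean_space"
  assumes "rjets.jet (Suc N) 0 u"
  shows "\<exists>C\<ge>0. \<forall>\<^sub>F t in at_right 0.
    norm (u t - (\<Sum>k\<le>N. t ^ k *\<^sub>R ((1 / fact k) *\<^sub>R Lim (at_right 0) ((der ^^ k) u)))) \<le> C * t ^ (N + 1)"
  using assms
proof (induction N arbitrary: u)
  case 0
  obtain C where C: "C > 0" "\<forall>\<^sub>F t in at_right 0. norm (der u t) \<le> C * 1 ^ 0"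
    using rjets_der(2)[OF 0] by (rule rjets.jet_bound)
  obtain c where c: "(u \<longlongrightarrow> c) (at_right 0)" "\<forall>\<^sub>F t in at_right 0. norm (u t - c) \<le> C * t ^ (0 + 1)"
    by (rule bounded_derivative_limit[OF rjets_der(1)[OF 0], of C 0]) (use C in auto)
  have "Lim (at_right 0) u = c" using c(1) by (intro tendsto_Lim) auto
  then show ?case using c(2) C(1) by (auto intro!: exI[of _ C])
next
  case (Suc N)
  let ?d = "\<lambda>k. (1 / fact k) *\<^sub>R Lim (at_right 0) ((der ^^ k) (der u))"
  obtain C where C: "C \<ge> 0" "\<forall>\<^sub>F t in at_right 0. norm (der u t - (\<Sum>k\<le>N. t ^ k *\<^sub>R ?d k)) \<le> C * t ^ (N + 1)"
    using Suc.IH[OF rjets_der(2)[OF Suc.prems]] by blast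
  define p where "p = (\<lambda>t::real. \<Sum>k\<le>N. (t ^ Suc k / real (Suc k)) *\<^sub>R ?d k)"
  have p: "(p has_vector_derivative (\<Sum>k\<le>N. t ^ k *\<^sub>R ?d k)) (at t)" for t
    unfolding p_def
  proof (rule has_vector_derivative_sum)
    fix k
    have "((\<lambda>t. t ^ Suc k / real (Suc k)) has_real_derivative (real (Suc k) * t ^ k) / real (Suc k)) (at t)"
      using DERIV_pow[of "Suc k" t] by (intro DERIV_cdivide) simp
    then have "((\<lambda>t. t ^ Suc k / real (Suc k)) has_real_derivative t ^ k) (at t)" by simp
    from has_vector_derivative_scaleR[OF this has_vector_derivative_const[of "?d k"]]
    show "((\<lambda>t. (t ^ Suc k / real (Suc k)) *\<^sub>R ?d k) has_vector_derivative t ^ k *\<^sub>R ?d k) (at t)"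
      by (simp only: scaleR_zero_right add_0_left)
  qed
  have "\<forall>\<^sub>F t in at_right 0. ((\<lambda>t. u t - p t) has_vector_derivative
      der u t - (\<Sum>k\<le>N. t ^ k *\<^sub>R ?d k)) (at t)"
    using rjets_der(1)[OF Suc.prems] by eventually_elim (intro has_vector_derivative_diff p)
  from bounded_derivative_limit[OF this C(2,1)]
  obtain c where c: "((\<lambda>t. u t - p t) \<longlongrightarrow> c) (at_right 0)"
    "\<forall>\<^sub>F t in at_right 0. norm (u t - p t - c) \<le> C * t ^ (N + 1 + 1)" by blast
  have "isCont p 0" by (rule has_vector_derivative_continuous[OF p])
  then have "(p \<longlongrightarrow> p 0) (at_right 0)"
    unfolding isCont_def by (rule tendsto_within_subset) auto
  moreover have "p 0 = 0" by (simp add: p_def)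
  ultimately have "((\<lambda>t. (u t - p t) + p t) \<longlongrightarrow> c + 0) (at_right 0)"
    using c(1) by (intro tendsto_add) auto
  then have L: "Lim (at_right 0) u = c" by (intro tendsto_Lim) auto
  have step: "(der ^^ Suc k) u = (der ^^ k) (der u)" for k by (simp only: funpow_Suc_right o_apply)
  have eq: "(\<Sum>k\<le>Suc N. t ^ k *\<^sub>R ((1 / fact k) *\<^sub>R Lim (at_right 0) ((der ^^ k) u))) = c + p t" for t
    unfolding taylor_sum_shift step p_def by (simp only: L funpow_0)
  have "\<forall>\<^sub>F t in at_right 0. norm (u t - (c + p t)) \<le> C * t ^ (Suc N + 1)"
  proof -
    have "u t - (c + p t) = u t - p t - c" for t by (simp only: algebra_simps)
    then show ?thesis using c(2) by (simp only: add_Suc_right add_Suc Suc_eq_plus1)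
  qed
  then show ?case unfolding eq by (intro exI[of _ C] conjI C(1))
qed

lemma Jet_asymp_expansion:
  fixes u :: "real \<Rightarrow> 'b::euclidean_space"
  assumes "rjets.Jet 0 u" "(u \<longlongrightarrow> l) (at_right 0)"
  obtains c where "asymp_expansion u c" "c 0 = l"
proof
  let ?c = "\<lambda>k. (1 / fact k) *\<^sub>R Lim (at_right 0) ((der ^^ k) u)"
  show "?c 0 = l" using assms(2) by (simp add: tendsto_Lim)
  show "asymp_expansion u ?c" unfolding asymp_expansion_def
  proof
    fix N
    obtain C where C: "\<forall>\<^sub>F t in at_right 0. norm (u t - (\<Sum>k\<le>N. t ^ k *\<^sub>R ?c k)) \<le> C * t ^ (N + 1)"
      using taylor_at_right[of N u] assms(1) unfolding rjets.Jet_def by blast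
    show "(\<lambda>\<epsilon>. norm (u \<epsilon> - (\<Sum>k\<le>N. \<epsilon> ^ k *\<^sub>R ?c k))) \<in> O[at_right 0](\<lambda>\<epsilon>. \<epsilon> ^ (N + 1))"
    proof (rule bigoI[of _ C])
      show "\<forall>\<^sub>F t in at_right 0. norm (norm (u t - (\<Sum>k\<le>N. t ^ k *\<^sub>R ?c k))) \<le> C * norm (t ^ (N + 1))"
        using C eventually_at_right_less[of 0]
      proof eventually_elim
        case (elim t)
        then show ?case by (simp add: abs_mult power_abs)
      qed
    qed
  qed
qed

section \<open>Symmetry of second derivatives\<close>

text \<open>The mean value theorem in direction \<open>v\<close> and then in direction \<open>w\<close> writes the second difference as
  a value of the mixed derivative near \<open>x\<close>. Since the second difference is symmetric in \<open>v\<close> and \<open>w\<close>,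
  uniqueness of limits gives the symmetry of second derivatives.\<close>
lemma second_difference_quotient:
  fixes f :: "'a::euclidean_space \<Rightarrow> real"
  assumes "open U" "x \<in> U" "Ck_open (Suc (Suc 0)) U f"
  shows "((\<lambda>s. (f (x + s *\<^sub>R v + s *\<^sub>R w) - f (x + s *\<^sub>R v) - f (x + s *\<^sub>R w) + f x) / s\<^sup>2)
    \<longlongrightarrow> frechet_derivative (\<lambda>x. frechet_derivative f (at x) v) (at x) w) (at_right 0)"
    (is "(?\<Delta> \<longlongrightarrow> ?L) _")
proof (rule tendstoI)
  fix e :: real assume e: "e > 0"
  let ?Dv = "\<lambda>x. frechet_derivative f (at x) v"
  let ?D2 = "\<lambda>x. frechet_derivative ?Dv (at x) w"
  have Dv: "Ck_open (Suc 0) U ?Dv" and D2: "continuous_on U ?D2" using assms(3) by auto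
  have "isCont ?D2 x" using D2 assms(1,2) by (simp add: continuous_on_eq_continuous_at)
  then have "(?D2 \<longlongrightarrow> ?D2 x) (nhds x)"
    unfolding isCont_def tendsto_at_iff_tendsto_nhds[of ?D2 x] .
  then have "\<forall>\<^sub>F z in nhds x. dist (?D2 z) (?D2 x) < e" using e by (rule tendstoD)
  moreover have "\<forall>\<^sub>F z in nhds x. z \<in> U" using assms(1,2) by (rule eventually_nhds_in_open)
  ultimately have "\<forall>\<^sub>F z in nhds x. dist (?D2 z) (?D2 x) < e \<and> z \<in> U" by (rule eventually_conj)
  then obtain d where d: "d > 0" "\<And>z. dist z x < d \<Longrightarrow> dist (?D2 z) (?D2 x) < e \<and> z \<in> U"
    unfolding eventually_nhds_metric by blast
  have near: "dist (x + a *\<^sub>R v + b *\<^sub>R w) x < d"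
    if "0 \<le> a" "a \<le> s" "0 \<le> b" "b \<le> s" "s * (norm v + norm w) < d" for a b s
  proof -
    have "norm (a *\<^sub>R v + b *\<^sub>R w) \<le> a * norm v + b * norm w"
      using that norm_triangle_ineq[of "a *\<^sub>R v" "b *\<^sub>R w"] by simp
    also have "\<dots> \<le> s * norm v + s * norm w" using that by (intro add_mono mult_right_mono) auto
    finally show ?thesis using that by (simp add: dist_norm algebra_simps)
  qed
  have line: "((\<lambda>a. g (z + a *\<^sub>R u)) has_real_derivative frechet_derivative g (at (z + a *\<^sub>R u)) u) (at a)"
    if "Ck_open (Suc k) U g" "z + a *\<^sub>R u \<in> U" for g :: "'a \<Rightarrow> real" and z u a k
  proof -
    have "((\<lambda>a. z + a *\<^sub>R u) has_derivative (\<lambda>h. h *\<^sub>R u)) (at a)"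
      by (auto intro!: derivative_eq_intros)
    note c = has_derivative_compose[OF this Ck_open_has_derivative[OF that]]
    show ?thesis unfolding has_field_derivative_def
      by (rule has_derivative_eq_rhs[OF c])
        (simp add: linear_scale[OF has_derivative_linear[OF Ck_open_has_derivative[OF that]]] fun_eq_iff mult.commute)
  qed
  have main: "dist (?\<Delta> s) ?L < e" if s: "0 < s" "s * (norm v + norm w) < d" for s
  proof -
    let ?g = "\<lambda>a. f (x + s *\<^sub>R w + a *\<^sub>R v) - f (x + a *\<^sub>R v)"
    have "\<exists>a. 0 < a \<and> a < s \<and> ?g s - ?g 0 = (s - 0) * (?Dv (x + s *\<^sub>R w + a *\<^sub>R v) - ?Dv (x + a *\<^sub>R v))"
    proof (rule MVT2[OF s(1)])
      fix a assume a: "0 \<le> a" "a \<le> s"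
      have "x + s *\<^sub>R w + a *\<^sub>R v \<in> U" "x + a *\<^sub>R v \<in> U"
        using d(2) near[of a s s] near[of a s 0] a s by (auto simp: algebra_simps)
      then show "(?g has_real_derivative ?Dv (x + s *\<^sub>R w + a *\<^sub>R v) - ?Dv (x + a *\<^sub>R v)) (at a)"
        by (intro DERIV_diff line[OF assms(3)]) auto
    qed
    then obtain a where a: "0 < a" "a < s"
      "?g s - ?g 0 = s * (?Dv (x + s *\<^sub>R w + a *\<^sub>R v) - ?Dv (x + a *\<^sub>R v))" by auto
    have "\<exists>b. 0 < b \<and> b < s \<and> ?Dv ((x + a *\<^sub>R v) + s *\<^sub>R w) - ?Dv ((x + a *\<^sub>R v) + 0 *\<^sub>R w)
        = (s - 0) * ?D2 ((x + a *\<^sub>R v) + b *\<^sub>R w)"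
    proof (rule MVT2[OF s(1)])
      fix b assume b: "0 \<le> b" "b \<le> s"
      show "((\<lambda>b. ?Dv ((x + a *\<^sub>R v) + b *\<^sub>R w)) has_real_derivative ?D2 ((x + a *\<^sub>R v) + b *\<^sub>R w)) (at b)"
        by (rule line[OF Dv]) (use d(2) near[of a s b] a b s in auto)
    qed
    then obtain b where b: "0 < b" "b < s"
      "?Dv ((x + a *\<^sub>R v) + s *\<^sub>R w) - ?Dv (x + a *\<^sub>R v) = s * ?D2 ((x + a *\<^sub>R v) + b *\<^sub>R w)" by auto
    have "?\<Delta> s = (?g s - ?g 0) / s\<^sup>2" by (simp add: algebra_simps)
    also have "\<dots> = ?D2 ((x + a *\<^sub>R v) + b *\<^sub>R w)"
      using a(3) b(3) s(1) by (simp add: power2_eq_square algebra_simps)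
    finally show ?thesis using d(2) near[of a s b] a b s by auto
  qed
  have "0 < d / (norm v + norm w + 1)" using d(1) by (simp add: add_nonneg_pos)
  moreover have "s * (norm v + norm w) < d" if "0 < s" "s < d / (norm v + norm w + 1)" for s
  proof -
    have "0 < norm v + norm w + 1" by (simp add: add_nonneg_pos)
    then have "s * (norm v + norm w + 1) < d" using that by (simp add: pos_less_divide_eq)
    then show ?thesis using that(1) by (simp add: algebra_simps)
  qed
  ultimately show "\<forall>\<^sub>F s in at_right 0. dist (?\<Delta> s) ?L < e"
    using main unfolding eventually_at_right_field by blast
qed

lemma second_derivative_symmetric:
  fixes f :: "'a::euclidean_space \<Rightarrow> 'b::euclidean_space"
  assumes "open U" "x \<in> U" "Ck_open (Suc (Suc 0)) U f"
  shows "frechet_derivative (\<lambda>x. frechet_derivative f (at x) v) (at x) w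
       = frechet_derivative (\<lambda>x. frechet_derivative f (at x) w) (at x) v"
proof (rule euclidean_eqI)
  fix b :: 'b assume "b \<in> Basis"
  let ?p = "\<lambda>x. f x \<bullet> b"
  note bl = bounded_linear_inner_left[of b]
  have p: "Ck_open (Suc (Suc 0)) U ?p" by (rule Ck_open_linear_compose[OF bl assms(1,3)])
  have D1: "frechet_derivative ?p (at z) u = frechet_derivative f (at z) u \<bullet> b" if "z \<in> U" for z u
    using frechet_derivative_at[OF bounded_linear.has_derivative[OF bl Ck_open_has_derivative[OF assms(3) that]]] by metis
  have D2: "frechet_derivative (\<lambda>z. frechet_derivative ?p (at z) u) (at x) u'
      = frechet_derivative (\<lambda>z. frechet_derivative f (at z) u) (at x) u' \<bullet> b" for u u'
  proof -
    have "Ck_open (Suc 0) U (\<lambda>z. frechet_derivative f (at z) u)" using assms(3) by auto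
    note d = bounded_linear.has_derivative[OF bl Ck_open_has_derivative[OF this assms(2)]]
    have "((\<lambda>z. frechet_derivative ?p (at z) u) has_derivative
        (\<lambda>u'. frechet_derivative (\<lambda>z. frechet_derivative f (at z) u) (at x) u' \<bullet> b)) (at x)"
      by (rule has_derivative_transform_within_open[OF d assms(1,2)]) (simp add: D1)
    from frechet_derivative_at[OF this] show ?thesis by metis
  qed
  have "frechet_derivative (\<lambda>z. frechet_derivative ?p (at z) v) (at x) w
      = frechet_derivative (\<lambda>z. frechet_derivative ?p (at z) w) (at x) v"
    by (rule tendsto_unique[OF _ second_difference_quotient[OF assms(1,2) p, of v w]])
      (use second_difference_quotient[OF assms(1,2) p, of w v] in \<open>simp_all add: algebra_simps\<close>)
  then show "frechet_derivative (\<lambda>x. frechet_derivative f (at x) v) (at x) w \<bullet> b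
       = frechet_derivative (\<lambda>x. frechet_derivative f (at x) w) (at x) v \<bullet> b"
    by (simp add: D2)
qed

section \<open>Local existence of solutions\<close>

lemma C1_lipschitz_on_cball:
  fixes f :: "'a::euclidean_space \<Rightarrow> 'b::euclidean_space"
  assumes "Ck_open (Suc 0) U f" "cball x0 r \<subseteq> U"
  obtains L where "L > 0" "\<And>x y. x \<in> cball x0 r \<Longrightarrow> y \<in> cball x0 r \<Longrightarrow> norm (f x - f y) \<le> L * norm (x - y)"
proof -
  let ?N = "\<lambda>x. \<Sum>b\<in>Basis. norm (frechet_derivative f (at x) b)"
  have "continuous_on (cball x0 r) ?N"
    using assms by (intro continuous_intros) (auto intro: continuous_on_subset)
  then have "compact (?N ` cball x0 r)" by (intro compact_continuous_image) auto
  then obtain B where "\<forall>y\<in>?N ` cball x0 r. norm y \<le> B"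
    using compact_imp_bounded bounded_iff by blast
  then have B: "\<And>x. x \<in> cball x0 r \<Longrightarrow> norm (?N x) \<le> B" by blast
  define L where "L = max B 1"
  show thesis
  proof (rule that[of L])
    show "norm (f x - f y) \<le> L * norm (x - y)" if "x \<in> cball x0 r" "y \<in> cball x0 r" for x y
    proof (rule differentiable_bound[of "cball x0 r" _ "\<lambda>z. frechet_derivative f (at z)"])
      fix z assume z: "z \<in> cball x0 r"
      have d: "(f has_derivative frechet_derivative f (at z)) (at z)"
        by (rule Ck_open_has_derivative[OF assms(1)]) (use z assms(2) in auto)
      then show "(f has_derivative frechet_derivative f (at z)) (at z within cball x0 r)"
        by (rule has_derivative_at_withinI)
      show "onorm (frechet_derivative f (at z)) \<le> L"
      proof (rule onorm_le)
        fix v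
        have "norm (frechet_derivative f (at z) v) = norm (\<Sum>b\<in>Basis. (v \<bullet> b) *\<^sub>R frechet_derivative f (at z) b)"
          using linear_expand_Basis[OF has_derivative_linear[OF d]] by metis
        also have "\<dots> \<le> (\<Sum>b\<in>Basis. norm v * norm (frechet_derivative f (at z) b))"
          by (intro order_trans[OF norm_sum] sum_mono) (auto simp: Basis_le_norm mult_right_mono)
        also have "\<dots> = norm v * ?N z" by (simp add: sum_distrib_left)
        also have "\<dots> \<le> L * norm v"
          using B[OF z] by (auto simp: L_def mult.commute intro!: mult_left_mono)
        finally show "norm (frechet_derivative f (at z) v) \<le> L * norm v" .
      qed
    qed (use that in auto)
  qed (simp add: L_def)
qed

text \<open>Picard iteration. Composing \<open>f\<close> with the projection onto the unit ball around \<open>x0\<close> makes it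
  bounded and globally Lipschitz, so Banach's fixed point theorem applies on the whole space of bounded
  continuous functions; on a short interval the fixed point stays in the ball and solves the original
  equation. Times are clamped to \<open>[0, T]\<close> to have functions on the whole line.\<close>
lemma local_solution:
  fixes f :: "'a::euclidean_space \<Rightarrow> 'a"
  assumes "Ck_open (Suc 0) UNIV f"
  obtains T x where "T > 0" "x 0 = x0" "solution_on f {0..T} x"
proof -
  let ?B = "cball x0 1"
  obtain L where L: "L > 0" "\<And>x y. x \<in> ?B \<Longrightarrow> y \<in> ?B \<Longrightarrow> norm (f x - f y) \<le> L * norm (x - y)"
    using C1_lipschitz_on_cball[OF assms, of x0 1] by blast
  have fc: "continuous_on UNIV f" using Ck_open_continuous_on[OF assms] .
  then have "compact (f ` ?B)" by (intro compact_continuous_image continuous_on_subset[OF fc]) auto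
  then obtain M where "M > 0" "\<forall>y\<in>f ` ?B. norm y \<le> M"
    using compact_imp_bounded bounded_pos by blast
  then have M: "M > 0" "\<And>x. x \<in> ?B \<Longrightarrow> norm (f x) \<le> M" by blast+
  define c where "c = closest_point ?B"
  have cin: "c x \<in> ?B" for x unfolding c_def by (rule closest_point_in_set) auto
  have clip: "norm (c x - c y) \<le> norm (x - y)" for x y
    unfolding c_def using closest_point_lipschitz[of ?B x y] by (auto simp: dist_norm)
  have ccont: "continuous_on UNIV c"
    unfolding c_def by (rule continuous_on_closest_point) auto
  define F where "F = (\<lambda>x. f (c x))"
  have Flip: "norm (F x - F y) \<le> L * norm (x - y)" for x y
    using L(2)[OF cin cin, of x y] mult_left_mono[OF clip[of x y] less_imp_le[OF L(1)]] by (simp add: F_def)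
  have FM: "norm (F x) \<le> M" for x unfolding F_def by (rule M(2)[OF cin])
  have Fcont: "continuous_on S (\<lambda>t. F (g t))" if "continuous_on S g" for S and g :: "real \<Rightarrow> 'a"
    unfolding F_def
    by (intro continuous_on_compose2[OF fc] continuous_on_compose2[OF ccont] that) auto
  define T where "T = min (1 / M) (1 / (2 * L))"
  have T: "T > 0" "T * M \<le> 1" "T * L \<le> 1 / 2"
  proof -
    show "T > 0" using M L by (simp add: T_def)
    have "T * M \<le> (1 / M) * M" unfolding T_def using M by (intro mult_right_mono) auto
    then show "T * M \<le> 1" using M by simp
    have "T * L \<le> (1 / (2 * L)) * L" unfolding T_def using L by (intro mult_right_mono) auto
    then show "T * L \<le> 1 / 2" using L by simp
  qed
  define k where "k = (\<lambda>t::real. max 0 (min T t))"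
  have k: "k t \<in> {0..T}" for t using T by (auto simp: k_def)
  have kcont: "continuous_on UNIV k" unfolding k_def by (intro continuous_intros)
  define \<Phi> where "\<Phi> = (\<lambda>g :: real \<Rightarrow> 'a. \<lambda>t. x0 + integral {0..k t} (\<lambda>s. F (g s)))"
  have int: "(\<lambda>s. F (g s)) integrable_on {0..b}" if "continuous_on UNIV g" for g and b :: real
    by (intro integrable_continuous_real Fcont continuous_on_subset[OF that]) auto
  have bc: "\<Phi> g \<in> bcontfun" if g: "continuous_on UNIV g" for g
  proof (rule bcontfun_normI)
    have "continuous_on {0..T} (\<lambda>u. integral {0..u} (\<lambda>s. F (g s)))"
      by (rule indefinite_integral_continuous_1[OF int[OF g]])
    then show "continuous_on UNIV (\<Phi> g)" unfolding \<Phi>_def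
      by (intro continuous_on_add continuous_on_const continuous_on_compose2[OF _ kcont]) (use k in auto)
    fix t
    have "norm (integral {0..k t} (\<lambda>s. F (g s))) \<le> M * (k t - 0)"
      by (rule integral_bound) (use k[of t] FM Fcont continuous_on_subset[OF g] in auto)
    also have "\<dots> \<le> M * T" using k[of t] M by (intro mult_left_mono) auto
    finally show "norm (\<Phi> g t) \<le> norm x0 + M * T"
      unfolding \<Phi>_def by (intro order_trans[OF norm_triangle_ineq] add_left_mono)
  qed
  have cont_b: "continuous_on UNIV (apply_bcontfun \<phi>)" for \<phi> :: "real \<Rightarrow>\<^sub>C 'a"
    by (rule continuous_on_apply_bcontfun)
  have ap: "apply_bcontfun (Bcontfun (\<Phi> (apply_bcontfun \<phi>))) = \<Phi> (apply_bcontfun \<phi>)" for \<phi>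
    by (rule Bcontfun_inverse[OF bc[OF cont_b]])
  have "\<exists>!\<phi>. Bcontfun (\<Phi> (apply_bcontfun \<phi>)) = \<phi>"
  proof (rule banach_fix_type[of "1/2"]; (intro allI)?)
    fix \<phi> \<theta> :: "real \<Rightarrow>\<^sub>C 'a"
    show "dist (Bcontfun (\<Phi> (apply_bcontfun \<phi>))) (Bcontfun (\<Phi> (apply_bcontfun \<theta>))) \<le> 1/2 * dist \<phi> \<theta>"
    proof (rule dist_bound, subst (1 2) ap)
      fix t
      have "norm (integral {0..k t} (\<lambda>s. F (\<phi> s) - F (\<theta> s))) \<le> (L * dist \<phi> \<theta>) * (k t - 0)"
      proof (rule integral_bound)
        fix s
        have "norm (F (\<phi> s) - F (\<theta> s)) \<le> L * norm (\<phi> s - \<theta> s)" by (rule Flip)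
        also have "\<dots> \<le> L * dist \<phi> \<theta>"
          using dist_bounded[of \<phi> s \<theta>] L(1) by (intro mult_left_mono) (auto simp: dist_norm)
        finally show "norm (F (\<phi> s) - F (\<theta> s)) \<le> L * dist \<phi> \<theta>" .
      next
        show "continuous_on {0..k t} (\<lambda>s. F (\<phi> s) - F (\<theta> s))"
          by (intro continuous_on_diff Fcont continuous_on_subset[OF cont_b]) auto
      qed (use k[of t] in auto)
      also have "\<dots> \<le> (L * dist \<phi> \<theta>) * T" using k[of t] L by (intro mult_left_mono) auto
      also have "\<dots> = (T * L) * dist \<phi> \<theta>" by simp
      also have "\<dots> \<le> 1/2 * dist \<phi> \<theta>" using T(3) by (intro mult_right_mono) auto
      finally show "dist (\<Phi> (apply_bcontfun \<phi>) t) (\<Phi> (apply_bcontfun \<theta>) t) \<le> 1/2 * dist \<phi> \<theta>"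
        unfolding \<Phi>_def dist_norm by (simp add: integral_diff[OF int[OF cont_b] int[OF cont_b]])
    qed
  qed auto
  then obtain \<phi> where "Bcontfun (\<Phi> (apply_bcontfun \<phi>)) = \<phi>" by blast
  then have fixed: "apply_bcontfun \<phi> t = \<Phi> (apply_bcontfun \<phi>) t" for t using ap[of \<phi>] by metis
  have eq: "\<phi> t = x0 + integral {0..t} (\<lambda>s. F (\<phi> s))" if "t \<in> {0..T}" for t
    using fixed[of t] that by (simp add: \<Phi>_def k_def)
  have inB: "\<phi> t \<in> ?B" if t: "t \<in> {0..T}" for t
  proof -
    have "norm (integral {0..t} (\<lambda>s. F (\<phi> s))) \<le> M * (t - 0)"
      by (rule integral_bound) (use t FM Fcont continuous_on_subset[OF cont_b] in auto)
    also have "\<dots> \<le> T * M" using t M by (simp add: mult.commute mult_right_mono)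
    also have "\<dots> \<le> 1" by (rule T)
    finally show ?thesis unfolding eq[OF t] by (simp add: dist_norm)
  qed
  show thesis
  proof (rule that[of T "apply_bcontfun \<phi>"])
    show "\<phi> 0 = x0" using eq[of 0] T by simp
    show "solution_on f {0..T} \<phi>" unfolding solution_on_def
    proof
      fix t assume t: "t \<in> {0..T}"
      have "((\<lambda>u. integral {0..u} (\<lambda>s. F (\<phi> s))) has_vector_derivative F (\<phi> t)) (at t within {0..T})"
        by (rule integral_has_vector_derivative[OF Fcont[OF continuous_on_subset[OF cont_b]] t]) simp
      then have "((\<lambda>u. x0 + integral {0..u} (\<lambda>s. F (\<phi> s))) has_vector_derivative 0 + F (\<phi> t)) (at t within {0..T})"
        by (intro has_vector_derivative_add has_vector_derivative_const)
      then have "(\<phi> has_vector_derivative 0 + F (\<phi> t)) (at t within {0..T})"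
        by (rule has_vector_derivative_transform[OF t, rotated]) (simp add: eq)
      moreover have "c (\<phi> t) = \<phi> t" unfolding c_def by (rule closest_point_self[OF inB[OF t]])
      ultimately show "(\<phi> has_vector_derivative f (\<phi> t)) (at t within {0..T})"
        by (simp add: F_def)
    qed
  qed (rule T)
qed

section \<open>Smooth implicit functions\<close>

text \<open>Written this way, a matrix-valued function inherits regularity from the values of the linear
  map on the basis vectors.\<close>
lemma matrix_sum_columns:
  fixes f :: "real^'n \<Rightarrow> real^'m"
  shows "matrix f = (\<Sum>j\<in>UNIV. (\<chi> i k. if k = j then f (axis j 1) $ i else 0))"
  by (simp add: matrix_def vec_eq_iff sum_component)

lemma bounded_linear_column_matrix: "bounded_linear (\<lambda>c :: real^'m. \<chi> i (k::'n::finite). if k = j then c $ i else 0)"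
  unfolding linear_conv_bounded_linear[symmetric]
  by (auto intro!: linearI simp: vec_eq_iff)

lemma Ck_open_matrix:
  fixes f :: "'a::euclidean_space \<Rightarrow> real^'n \<Rightarrow> real^'m"
  assumes "open U" "\<And>v. Ck_open k U (\<lambda>x. f x v)"
  shows "Ck_open k U (\<lambda>x. matrix (f x))"
  unfolding matrix_sum_columns
  by (intro Ck_open_sum Ck_open_linear_compose[OF bounded_linear_column_matrix] assms)

lemma Ck_open_derivative_apply:
  fixes \<Phi> :: "'a::euclidean_space \<Rightarrow> 'b::euclidean_space"
  assumes "open U" "Ck_open (Suc k) U \<Phi>" "Ck_open k U u"
  shows "Ck_open k U (\<lambda>x. frechet_derivative \<Phi> (at x) (u x))"
proof (rule Ck_open_cong[OF assms(1)])
  show "Ck_open k U (\<lambda>x. \<Sum>b\<in>Basis. (u x \<bullet> b) *\<^sub>R frechet_derivative \<Phi> (at x) b)"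
    using assms(2)
    by (intro Ck_open_sum[OF assms(1)] Ck_open_bilinear[OF bounded_bilinear_scaleR assms(1)]
      Ck_open_linear_compose[OF bounded_linear_inner_left assms(1,3)]) auto
  show "(\<Sum>b\<in>Basis. (u x \<bullet> b) *\<^sub>R frechet_derivative \<Phi> (at x) b) = frechet_derivative \<Phi> (at x) (u x)"
    if "x \<in> U" for x
    using linear_expand_Basis[OF has_derivative_linear[OF Ck_open_has_derivative[OF assms(2) that]], of "u x"] by simp
qed

text \<open>\<open>G (a, c)\<close> is the solution \<open>z\<close> of \<open>\<Phi> (a, z) = c\<close>. The inverse function theorem for
  \<open>(a, z) \<mapsto> (a, \<Phi> (a, z))\<close> provides a differentiable \<open>G\<close>; differentiating the equation expresses its
  derivative through \<open>G\<close> itself, which bootstraps to all orders. Having \<open>c\<close> as a variable turns a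
  residual \<open>\<Phi> (a, z)\<close> into a bound on the distance of \<open>z\<close> from the exact solution.\<close>
lemma smooth_implicit_function:
  fixes \<Phi> :: "'a::euclidean_space \<times> (real^'n) \<Rightarrow> real^'n"
  assumes "open U" "\<And>k. Ck_open k U \<Phi>" "(a0, z0) \<in> U"
    and inj: "\<And>v. frechet_derivative \<Phi> (at (a0, z0)) (0, v) = 0 \<Longrightarrow> v = 0"
  obtains V G where "open V" "(a0, \<Phi> (a0, z0)) \<in> V" "\<And>k. Ck_open k V G"
    "\<forall>\<^sub>F p in nhds (a0, z0). (fst p, \<Phi> p) \<in> V \<and> G (fst p, \<Phi> p) = snd p"
proof -
  let ?D = "\<lambda>p. frechet_derivative \<Phi> (at p)"
  define H where "H = (\<lambda>p. (fst p, \<Phi> p))"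
  have Phid: "(\<Phi> has_derivative ?D p) (at p)" if "p \<in> U" for p
    using Ck_open_has_derivative[OF assms(2)[of "Suc 0"] that] .
  have Hd: "(H has_derivative (\<lambda>v. (fst v, ?D p v))) (at p)" if "p \<in> U" for p
    unfolding H_def by (intro has_derivative_Pair has_derivative_fst has_derivative_ident Phid that)
  have bl: "bounded_linear (\<lambda>v. (fst v, ?D p v))" if "p \<in> U" for p
    using Hd[OF that] by (rule has_derivative_bounded_linear)
  \<comment> \<open>The derivative of \<open>H\<close> is packed as a bounded linear function, the form which the inverse
     function theorem expects.\<close>
  define f' where "f' = (\<lambda>p. Blinfun (\<lambda>v. (fst v, ?D p v)))"
  have f': "blinfun_apply (f' p) = (\<lambda>v. (fst v, ?D p v))" if "p \<in> U" for p
    unfolding f'_def by (rule bounded_linear_Blinfun_apply[OF bl[OF that]])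
  have Hd': "(H has_derivative blinfun_apply (f' p)) (at p)" if "p \<in> U" for p
    using Hd[OF that] f'[OF that] by simp
  have contf': "continuous_on U f'"
  proof (rule continuous_on_blinfun_componentwise)
    fix i :: "'a \<times> (real^'n)" assume "i \<in> Basis"
    have "continuous_on U (\<lambda>x. ?D x i)" using assms(2)[of "Suc 0"] by (cases i) auto
    then have "continuous_on U (\<lambda>x. (fst i, ?D x i))" by (intro continuous_intros)
    then show "continuous_on U (\<lambda>x. blinfun_apply (f' x) i)"
      by (rule continuous_on_eq) (simp add: f')
  qed
  let ?p0 = "(a0, z0)"
  define S where "S = (\<lambda>v. (fst v, ?D ?p0 v))"
  have lin0: "linear S" unfolding S_def using bl[OF assms(3)] by (rule bounded_linear.linear)
  have "inj S"
  proof (rule linear_injective_0[OF lin0, THEN iffD2], intro allI impI)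
    fix v assume "S v = 0"
    then have v: "fst v = 0" "?D ?p0 v = 0" by (auto simp: S_def prod_eq_iff zero_prod_def)
    then have "?D ?p0 (0, snd v) = 0" by (metis prod.collapse)
    then show "v = 0" using inj v by (auto simp: prod_eq_iff)
  qed
  then obtain S' where S': "linear S'" "\<And>x. S' (S x) = x"
    using linear_injective_isomorphism[OF lin0] by blast
  have "blinfun_apply (Blinfun S') = S'"
    using S'(1) by (intro bounded_linear_Blinfun_apply) (simp add: linear_conv_bounded_linear)
  then have "Blinfun S' o\<^sub>L f' ?p0 = id_blinfun"
    using S'(2) f'[OF assms(3)] by (intro blinfun_eqI) (simp add: S_def)
  from inverse_function_theorem[OF assms(1) Hd' contf' assms(3) this]
  obtain U' V g g' where inv: "open U'" "U' \<subseteq> U" "?p0 \<in> U'" "open V" "H ?p0 \<in> V"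
    "homeomorphism U' V H g" "\<And>y. y \<in> V \<Longrightarrow> (g has_derivative g' y) (at y)"
    "\<And>y. y \<in> V \<Longrightarrow> bij (blinfun_apply (f' (g y)))"
    using f' by (metis (no_types, lifting))
  have gU: "g y \<in> U'" "H (g y) = y" if "y \<in> V" for y
    using inv(6) that unfolding homeomorphism_def by auto
  define G where "G = (\<lambda>y. snd (g y))"
  have gG: "g y = (fst y, G y)" if "y \<in> V" for y
    using gU(2)[OF that] by (auto simp: H_def G_def prod_eq_iff)
  define M where "M = (\<lambda>p. matrix (\<lambda>v. ?D p (0, v)))"
  have Mv: "M p *v v = ?D p (0, v)" if "p \<in> U" for p v
  proof -
    have "linear (\<lambda>v. ?D p (0, v))"
      using linear_compose[OF bounded_linear.linear has_derivative_linear[OF Phid[OF that]], of "\<lambda>v. (0, v)"]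
        bounded_linear_Pair[OF bounded_linear_zero bounded_linear_ident]
      by (simp add: o_def)
    then show ?thesis unfolding M_def by (simp add: matrix_works)
  qed
  have Minv: "invertible (M (g y))" if "y \<in> V" for y
  proof -
    have gy: "g y \<in> U" using gU(1)[OF that] inv(2) by auto
    have "v = 0" if "M (g y) *v v = 0" for v
    proof -
      have "blinfun_apply (f' (g y)) (0, v) = blinfun_apply (f' (g y)) 0"
        using that Mv[OF gy] unfolding f'[OF gy] 
        by (simp add: linear_0[OF has_derivative_linear[OF Phid[OF gy]]])
      then show ?thesis using inv(8)[OF \<open>y \<in> V\<close>] by (auto simp: bij_def inj_def zero_prod_def)
    qed
    then show ?thesis
      using matrix_left_invertible_ker[of "M (g y)"] invertible_left_inverse by auto
  qed
  have Gd: "(G has_derivative (\<lambda>v. matrix_inv (M (g y)) *v (snd v - ?D (g y) (fst v, 0)))) (at y)"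
    if y: "y \<in> V" for y
  proof -
    have gy: "g y \<in> U" using gU(1)[OF that] inv(2) by auto
    have G': "(G has_derivative (\<lambda>v. snd (g' y v))) (at y)"
      unfolding G_def by (rule has_derivative_snd[OF inv(7)[OF y]])
    have "((\<lambda>y. \<Phi> (fst y, G y)) has_derivative (\<lambda>v. ?D (g y) (fst v, snd (g' y v)))) (at y)"
      using has_derivative_compose[OF has_derivative_Pair[OF has_derivative_fst[OF has_derivative_ident] G']]
        Phid[OF gy] unfolding gG[OF y] by blast
    moreover have "\<Phi> (fst y', G y') = snd y'" if "y' \<in> V" for y'
      using arg_cong[OF gU(2)[OF that], of snd] gG[OF that] by (simp add: H_def)
    ultimately have s1: "(snd has_derivative (\<lambda>v. ?D (g y) (fst v, snd (g' y v)))) (at y)"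
      using has_derivative_transform_within_open[OF _ inv(4) y] by blast
    have s2: "(snd has_derivative snd) (at y)"
      by (intro bounded_linear_imp_has_derivative bounded_linear_snd)
    have e: "?D (g y) (fst v, snd (g' y v)) = snd v" for v
      using fun_cong[OF has_derivative_unique[OF s1 s2], of v] .
    have Mg: "M (g y) *v snd (g' y v) = snd v - ?D (g y) (fst v, 0)" for v
    proof -
      have "?D (g y) (fst v, snd (g' y v)) = ?D (g y) (fst v, 0) + ?D (g y) (0, snd (g' y v))"
        using linear_add[OF has_derivative_linear[OF Phid[OF gy]], of "(fst v, 0)" "(0, snd (g' y v))"] by simp
      then show ?thesis using e[of v] by (simp add: Mv[OF gy])
    qed
    have "snd (g' y v) = matrix_inv (M (g y)) *v (snd v - ?D (g y) (fst v, 0))" for v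
      unfolding Mg[symmetric] by (simp add: matrix_vector_mul_assoc matrix_inv_mult(1)[OF Minv[OF y]])
    then show ?thesis using G' by simp
  qed
  have Gk: "Ck_open k V G" for k
  proof (induction k)
    case 0
    show ?case using Gd by (auto intro!: continuous_at_imp_continuous_on has_derivative_continuous)
  next
    case (Suc k)
    have gk: "Ck_open k V g"
      by (rule Ck_open_cong[OF inv(4) _ Ck_open_Pair[OF inv(4) Ck_open_bounded_linear[OF bounded_linear_fst inv(4)] Suc]])
        (simp add: gG)
    have gV: "g ` V \<subseteq> U" using gU(1) inv(2) by auto
    have Dk: "Ck_open k U (\<lambda>p. ?D p v)" for v using assms(2)[of "Suc k"] by (cases v) auto
    have "Ck_open k U M" unfolding M_def by (intro Ck_open_matrix assms(1) Dk)
    then have "Ck_open k V (\<lambda>y. M (g y))" by (rule Ck_open_compose[OF inv(4) _ gk gV])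
    then have Mi: "Ck_open k V (\<lambda>y. matrix_inv (M (g y)))"
      by (rule Ck_open_compose[OF inv(4) Ck_open_matrix_inv]) (use Minv in auto)
    have "Ck_open k V (\<lambda>y. matrix_inv (M (g y)) *v (snd v + - ?D (g y) (fst v, 0)))" for v
      by (intro Ck_open_bilinear[OF bounded_bilinear_matrix_vector inv(4) Mi] Ck_open_add inv(4) Ck_open_const
          Ck_open_linear_compose[OF bounded_linear_minus[OF bounded_linear_ident] inv(4)]
          Ck_open_compose[OF inv(4) Dk gk gV])
    then show ?case by (intro Ck_open_SucI[OF inv(4) Gd]) auto
  qed
  show thesis
  proof (rule that[OF inv(4) _ Gk])
    show "(a0, \<Phi> (a0, z0)) \<in> V" using inv(5) by (simp add: H_def)
    show "\<forall>\<^sub>F p in nhds (a0, z0). (fst p, \<Phi> p) \<in> V \<and> G (fst p, \<Phi> p) = snd p"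
      unfolding eventually_nhds
      using inv(1,3,6) by (intro exI[of _ U']) (auto simp: homeomorphism_def H_def G_def)
  qed
qed

section \<open>Block matrices as products with coordinate injections\<close>

text \<open>Blocks are cut out and put in place by multiplication with coordinate injections and their
  transposes. Block computations then are computations in the ring-like algebra of rectangular matrices
  and need no case distinction on indices.\<close>
definition injL :: "real^'a^('a + 'b::finite)" where
  "injL = (\<chi> i j. case i of Inl a \<Rightarrow> if a = j then 1 else 0 | Inr b \<Rightarrow> 0)"

definition injR :: "real^'b^('a::finite + 'b)" where
  "injR = (\<chi> i j. case i of Inl a \<Rightarrow> 0 | Inr b \<Rightarrow> if b = j then 1 else 0)"

abbreviation prL :: "real^('a::finite + 'b::finite)^'a" where "prL \<equiv> transpose injL"
abbreviation prR :: "real^('a::finite + 'b::finite)^'b" where "prR \<equiv> transpose injR"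

lemma sum_UNIV_sum:
  fixes f :: "'a::finite + 'b::finite \<Rightarrow> 'c::comm_monoid_add"
  shows "(\<Sum>i\<in>UNIV. f i) = (\<Sum>a\<in>UNIV. f (Inl a)) + (\<Sum>b\<in>UNIV. f (Inr b))"
  by (simp flip: UNIV_Plus_UNIV add: sum.Plus)

lemmas block_defs = injL_def injR_def transpose_def vec_eq_iff matrix_matrix_mult_def matrix_vector_mult_def
  sum_UNIV_sum mat_def if_distrib[where f = "\<lambda>x. x * _"] if_distrib[where f = "\<lambda>x. _ * x"]

lemma pr_inj [simp]:
  "prL ** (injL :: real^'a^('a + 'b)) = mat 1" "prR ** (injR :: real^'b::finite^('a::finite + 'b)) = mat 1"
  "prL ** (injR :: real^'b^('a + 'b)) = 0" "prR ** (injL :: real^'a^('a + 'b)) = 0"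
  by (simp_all add: block_defs cong: if_cong)

lemma pr_inj_assoc [simp]:
  "prL ** ((injL :: real^'a^('a + 'b)) ** X) = X" "prR ** ((injR :: real^'b::finite^('a::finite + 'b)) ** Y) = Y"
  "prL ** ((injR :: real^'b^('a + 'b)) ** Y) = 0" "prR ** ((injL :: real^'a^('a + 'b)) ** X) = 0"
  unfolding matrix_mul_assoc by simp_all

lemma inj_pr: "injL ** prL + injR ** prR = (mat 1 :: real^('a::finite + 'b::finite)^('a + 'b))"
proof -
  have "(injL ** prL + injR ** prR) $ i $ j = (mat 1 :: real^('a + 'b)^('a + 'b)) $ i $ j" for i j
    by (cases i; cases j) (simp_all add: block_defs cong: if_cong)
  then show ?thesis by (simp add: vec_eq_iff)
qed

lemma join_inj: "join y z = injL *v y + injR *v z"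
proof -
  have "join y z $ i = (injL *v y + injR *v z) $ i" for i
    by (cases i) (simp_all add: join_def block_defs cong: if_cong)
  then show ?thesis by (simp add: vec_eq_iff)
qed

lemma slow_pr: "slow x = prL *v x"
  by (simp add: slow_def block_defs cong: if_cong)

lemma fast_pr: "fast x = prR *v x"
  by (simp add: fast_def block_defs cong: if_cong)

lemma slow_join [simp]: "slow (join y z) = y"
  by (simp add: slow_def join_def vec_eq_iff)

lemma fast_join [simp]: "fast (join y z) = z"
  by (simp add: fast_def join_def vec_eq_iff)

lemma join_slow_fast [simp]: "join (slow x) (fast x) = x"
proof -
  have "join (slow x) (fast x) $ i = x $ i" for i
    by (cases i) (simp_all add: slow_def fast_def join_def)
  then show ?thesis by (simp add: vec_eq_iff)
qed

lemma block_pr: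
  "block11 M = prL ** M ** injL" "block12 M = prL ** M ** injR" "block21 M = prR ** M ** injL"
  by (simp_all add: block11_def block12_def block21_def block_defs cong: if_cong)

lemma left_cols_inj: "left_cols M = M ** injL"
  by (simp add: left_cols_def block_defs cong: if_cong)

lemma upper_rows_pr: "upper_rows M = prL ** M"
  by (simp add: upper_rows_def block_defs cong: if_cong)

lemma block_mat_inj:
  "block_mat P Q R S = injL ** P ** prL + injL ** Q ** prR + injR ** R ** prL + injR ** S ** prR"
proof -
  have "block_mat P Q R S $ i $ j =
      (injL ** P ** prL + injL ** Q ** prR + injR ** R ** prL + injR ** S ** prR) $ i $ j" for i j
    by (cases i; cases j) (simp_all add: block_mat_def block_defs cong: if_cong)
  then show ?thesis by (simp add: vec_eq_iff)
qed

lemma components_zero: fixes v :: "real^('a::finite + 'b::finite)"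
  assumes "prL *v v = 0" "prR *v v = 0" shows "v = 0"
proof -
  have "v = (injL ** prL + injR ** prR) *v v" by (simp add: inj_pr)
  also have "\<dots> = injL *v (prL *v v) + injR *v (prR *v v)"
    by (simp only: matrix_vector_mult_add_rdistrib matrix_vector_mul_assoc[symmetric])
  finally show ?thesis using assms by simp
qed

section \<open>The algebra of one refinement step\<close>

interpretation mm: bounded_bilinear "matrix_matrix_mult :: real^'a^'b \<Rightarrow> real^'c^'a \<Rightarrow> real^'c^'b"
  by (rule bounded_bilinear_matrix_mult)

lemmas mat_ring = mm.add_left mm.add_right mm.diff_left mm.diff_right mm.minus_left mm.minus_right
  matrix_mul_assoc[symmetric]

lemma csp_U_inj: "csp_U L = injL ** (matrix_inv (block11 L) ** block12 L) ** prR"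
  by (simp add: csp_U_def block_mat_inj)

lemma csp_L_inj: "csp_L L = injR ** (block21 L ** matrix_inv (block11 L)) ** prL"
  by (simp add: csp_L_def block_mat_inj)

lemma csp_U_nilpotent: "csp_U L ** csp_U L = 0"
  by (simp add: csp_U_inj matrix_mul_assoc[symmetric])

lemma csp_L_nilpotent: "csp_L L ** csp_L L = 0"
  by (simp add: csp_L_inj matrix_mul_assoc[symmetric])

lemma csp_factors_inverse:
  "((mat 1 - csp_U L) ** (mat 1 + csp_L L)) ** ((mat 1 - csp_L L) ** (mat 1 + csp_U L)) = mat 1"
  "((mat 1 - csp_L L) ** (mat 1 + csp_U L)) ** ((mat 1 - csp_U L) ** (mat 1 + csp_L L)) = mat 1"
proof -
  have u: "(mat 1 - csp_U L) ** (mat 1 + csp_U L) = mat 1" "(mat 1 + csp_U L) ** (mat 1 - csp_U L) = mat 1"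
    by (simp_all add: mm.add_left mm.add_right mm.diff_left mm.diff_right csp_U_nilpotent)
  have l: "(mat 1 - csp_L L) ** (mat 1 + csp_L L) = mat 1" "(mat 1 + csp_L L) ** (mat 1 - csp_L L) = mat 1"
    by (simp_all add: mm.add_left mm.add_right mm.diff_left mm.diff_right csp_L_nilpotent)
  show "((mat 1 - csp_U L) ** (mat 1 + csp_L L)) ** ((mat 1 - csp_L L) ** (mat 1 + csp_U L)) = mat 1"
    by (metis u(1) l(2) matrix_mul_assoc matrix_mul_lid)
  show "((mat 1 - csp_L L) ** (mat 1 + csp_U L)) ** ((mat 1 - csp_U L) ** (mat 1 + csp_L L)) = mat 1"
    by (metis u(2) l(1) matrix_mul_assoc matrix_mul_lid)
qed

lemma csp_step_inverse:
  assumes "A ** B = mat 1" "B ** A = mat 1"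
  shows "(A ** (mat 1 - csp_U L) ** (mat 1 + csp_L L)) ** ((mat 1 - csp_L L) ** (mat 1 + csp_U L) ** B) = mat 1"
    "((mat 1 - csp_L L) ** (mat 1 + csp_U L) ** B) ** (A ** (mat 1 - csp_U L) ** (mat 1 + csp_L L)) = mat 1"
proof -
  let ?X = "(mat 1 - csp_U L) ** (mat 1 + csp_L L)" and ?Y = "(mat 1 - csp_L L) ** (mat 1 + csp_U L)"
  have "(A ** ?X) ** (?Y ** B) = A ** (?X ** ?Y) ** B" "(?Y ** B) ** (A ** ?X) = ?Y ** (B ** A) ** ?X"
    by (simp_all only: matrix_mul_assoc)
  then have "(A ** ?X) ** (?Y ** B) = mat 1" "(?Y ** B) ** (A ** ?X) = mat 1"
    using assms csp_factors_inverse[of L] by simp_all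
  then show "(A ** (mat 1 - csp_U L) ** (mat 1 + csp_L L)) ** ((mat 1 - csp_L L) ** (mat 1 + csp_U L) ** B) = mat 1"
    "((mat 1 - csp_L L) ** (mat 1 + csp_U L) ** B) ** (A ** (mat 1 - csp_U L) ** (mat 1 + csp_L L)) = mat 1"
    by (simp_all only: matrix_mul_assoc)
qed

lemma csp_step_upper:
  "prL ** ((mat 1 - csp_L L) ** (mat 1 + csp_U L) ** B)
    = prL ** B + (matrix_inv (block11 L) ** block12 L) ** (prR ** B)"
  by (simp add: csp_U_inj csp_L_inj mat_ring)

lemma csp_step_lower:
  "prR ** ((mat 1 - csp_L L) ** (mat 1 + csp_U L) ** B)
    = prR ** B - (block21 L ** matrix_inv (block11 L)) **
        (prL ** ((mat 1 - csp_L L) ** (mat 1 + csp_U L) ** B))"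
  by (simp add: csp_U_inj csp_L_inj mat_ring)

lemma matrix_split_product:
  "M ** Z = (M ** injL) ** (prL ** Z) + (M ** injR) ** (prR ** Z)"
proof -
  have "M ** Z = M ** (injL ** prL + injR ** prR) ** Z" by (simp add: inj_pr)
  then show ?thesis by (simp only: mat_ring)
qed

text \<open>The equation in the hypothesis is invariance of a bundle in the coordinates of a frame
  (\<open>frame_coordinates\<close>); its two block rows determine the off-diagonal blocks of \<open>L\<close> up to the residuals.\<close>
lemma csp_invariance_blocks:
  assumes "Z ** K = L ** Z - dZ"
  shows "(prL ** Z) ** K = block11 L ** (prL ** Z) + block12 L ** (prR ** Z) - prL ** dZ"
    and "(prR ** Z) ** K = block21 L ** (prL ** Z) + (prR ** L ** injR) ** (prR ** Z) - prR ** dZ"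
proof -
  have "(prL ** Z) ** K = (prL ** L) ** Z - prL ** dZ" "(prR ** Z) ** K = (prR ** L) ** Z - prR ** dZ"
    using assms by (simp_all add: matrix_mul_assoc[symmetric] mm.diff_right)
  then show "(prL ** Z) ** K = block11 L ** (prL ** Z) + block12 L ** (prR ** Z) - prL ** dZ"
    "(prR ** Z) ** K = block21 L ** (prL ** Z) + (prR ** L ** injR) ** (prR ** Z) - prR ** dZ"
    using matrix_split_product[of "prL ** L" Z] matrix_split_product[of "prR ** L" Z]
    by (simp_all add: block_pr)
qed

text \<open>The left-hand side is the upper residual of the refined frame, see \<open>csp_step_upper\<close>. With
  \<open>V ** L12\<close> as upper right block the term \<open>L11 ** R\<close> cancels \<open>R\<close>, and in what remains \<open>K\<close> and \<open>dR\<close>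
  carry a factor \<open>\<epsilon>\<close>.\<close>
lemma upper_residual_step:
  fixes V :: "real^'n^'n"
  assumes "R ** K = L11 ** R + L12 ** S - dR" "V ** L11 = mat 1"
  shows "R + (V ** L12) ** S = V ** (R ** K + dR)"
proof -
  have "V ** (R ** K + dR) = V ** (L11 ** R + L12 ** S)" using assms(1) by simp
  also have "\<dots> = (V ** L11) ** R + (V ** L12) ** S" by (simp only: mat_ring)
  finally show ?thesis using assms(2) by simp
qed

text \<open>The left-hand side is the lower residual of the refined frame, see \<open>csp_step_lower\<close>. Compared
  with \<open>Q\<close> every term on the right gains a factor \<open>\<epsilon>\<close>: \<open>L22\<close> and the derivatives \<open>dP\<close>, \<open>dQ\<close> carry one,
  and \<open>L21\<close>, which the second equation makes as small as \<open>Q\<close>, is multiplied by \<open>dP\<close> or \<open>Q\<close>.\<close>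
lemma lower_residual_step:
  fixes V :: "real^'n^'n" and N :: "real^'n^'n"
  assumes P: "P ** K = L11 ** P + L12 ** Q - dP" and Q: "Q ** K = L21 ** P + L22 ** Q - dQ"
    and V: "V ** L11 = mat 1" and N: "K ** N = mat 1"
  shows "Q - (L21 ** V) ** (P + (V ** L12) ** Q) =
    (L22 ** Q - dQ) ** N + L21 ** (V ** (dP - L12 ** Q) ** N - V ** (V ** L12) ** Q)"
proof -
  have "L11 ** P = P ** K + (dP - L12 ** Q)" using P by (simp add: algebra_simps)
  then have "V ** (L11 ** P) ** N = V ** (P ** K + (dP - L12 ** Q)) ** N" by simp
  moreover have "V ** (L11 ** P) ** N = (V ** L11) ** P ** N" by (simp only: matrix_mul_assoc)
  moreover have "V ** (P ** K + (dP - L12 ** Q)) ** N = V ** P ** (K ** N) + V ** (dP - L12 ** Q) ** N"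
    by (simp only: mm.add_left mm.add_right matrix_mul_assoc)
  ultimately have 1: "V ** P = P ** N - V ** (dP - L12 ** Q) ** N"
    using V N by (simp add: algebra_simps)
  have "L21 ** P = Q ** K - (L22 ** Q - dQ)" using Q by (simp add: algebra_simps)
  then have "L21 ** P ** N = Q ** (K ** N) - (L22 ** Q - dQ) ** N"
    by (simp only: mm.diff_left matrix_mul_assoc)
  then have 2: "L21 ** (P ** N) = Q - (L22 ** Q - dQ) ** N"
    using N by (simp add: matrix_mul_assoc)
  have "(L21 ** V) ** (P + (V ** L12) ** Q) = L21 ** (V ** P) + L21 ** (V ** (V ** L12) ** Q)"
    by (simp only: mat_ring)
  also have "L21 ** (V ** P) = Q - (L22 ** Q - dQ) ** N - L21 ** (V ** (dP - L12 ** Q) ** N)"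
    unfolding 1 by (simp only: mm.diff_right[of L21 "P ** N"] 2)
  finally show ?thesis by (simp add: mm.diff_right[of L21 "V ** (dP - L12 ** Q) ** N"])
qed

section \<open>Refinement along the slow manifold\<close>

context jets
begin

lemma Jet_mult0: "Jet 0 f \<Longrightarrow> Jet 0 g \<Longrightarrow> Jet 0 (\<lambda>x. f x ** g x)"
  for f :: "'a \<Rightarrow> real^'d^'c" and g :: "'a \<Rightarrow> real^'e^'d"
  by (rule Jet_matrix_mult) auto

lemma Jet_mult_l: "Jet q f \<Longrightarrow> Jet 0 g \<Longrightarrow> Jet q (\<lambda>x. f x ** g x)"
  for f :: "'a \<Rightarrow> real^'d^'c" and g :: "'a \<Rightarrow> real^'e^'d"
  by (rule Jet_matrix_mult) auto

lemma Jet_mult_r: "Jet 0 f \<Longrightarrow> Jet q g \<Longrightarrow> Jet q (\<lambda>x. f x ** g x)"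
  for f :: "'a \<Rightarrow> real^'d^'c" and g :: "'a \<Rightarrow> real^'e^'d"
  by (rule Jet_matrix_mult) auto

lemma Jet_mult_1r: "Jet q f \<Longrightarrow> Jet 1 g \<Longrightarrow> Jet (Suc q) (\<lambda>x. f x ** g x)"
  for f :: "'a \<Rightarrow> real^'d^'c" and g :: "'a \<Rightarrow> real^'e^'d"
  by (rule Jet_matrix_mult) auto

lemma Jet_mult_1l: "Jet 1 f \<Longrightarrow> Jet q g \<Longrightarrow> Jet (Suc q) (\<lambda>x. f x ** g x)"
  for f :: "'a \<Rightarrow> real^'d^'c" and g :: "'a \<Rightarrow> real^'e^'d"
  by (rule Jet_matrix_mult) auto

end

lemma tendsto_matrix_mult:
  fixes f :: "'a \<Rightarrow> real^'d^'c" and g :: "'a \<Rightarrow> real^'e^'d"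
  shows "(f \<longlongrightarrow> A) F \<Longrightarrow> (g \<longlongrightarrow> B) F \<Longrightarrow> ((\<lambda>x. f x ** g x) \<longlongrightarrow> A ** B) F"
  by (rule mm.tendsto)

text \<open>The slow manifold is represented by its points \<open>s = (y, \<epsilon>)\<close>; \<open>w s *\<^sub>R (\<Sum>b\<in>Bs. cf b s *\<^sub>R b)\<close> is
  the velocity of \<open>s\<close> under the flow, where \<open>w\<close> is \<open>\<epsilon>\<close>. The Jacobian of the field at the point is
  \<open>w J1\<close> in the slow and \<open>J2\<close> in the fast rows. The last two assumptions are the invariance
  equations of the fiber slopes \<open>\<tau>\<close> and of the slope \<open>H\<close> of the manifold.\<close>
locale slow_fast_frames = jets F D w
  for F :: "'a::euclidean_space filter" and D :: "'a set" and w :: "'a \<Rightarrow> real" +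
  fixes Bs :: "'a set" and cf :: "'a \<Rightarrow> 'a \<Rightarrow> real"
    and J1 :: "'a \<Rightarrow> real^('m::finite + 'n::finite)^'m" and J2 :: "'a \<Rightarrow> real^('m + 'n)^'n"
    and \<tau> :: "'a \<Rightarrow> real^'n^'m" and H :: "'a \<Rightarrow> real^'m^'n" and \<nu>0 :: "real^'n^'n"
  assumes nontrivial: "F \<noteq> bot" and w_zero: "(w \<longlongrightarrow> 0) F"
    and Bs: "finite Bs" "Bs \<subseteq> D" "\<And>b. b \<in> Bs \<Longrightarrow> Jet 0 (cf b)"
    and J1: "Jet 0 J1" and J2: "Jet 0 J2" and tau: "Jet 0 \<tau>" and H: "Jet 0 H"
    and tau_zero: "(\<tau> \<longlongrightarrow> 0) F"
    and nu_limit: "((\<lambda>s. J2 s ** injR) \<longlongrightarrow> \<nu>0) F" and nu_inv: "invertible \<nu>0"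
    and fiber_eq: "\<forall>\<^sub>F s in F. \<tau> s ** (J2 s ** (injL ** \<tau> s + injR))
        = w s *\<^sub>R (J1 s ** (injL ** \<tau> s + injR))
          - frechet_derivative \<tau> (at s) (w s *\<^sub>R (\<Sum>b\<in>Bs. cf b s *\<^sub>R b))"
    and slow_eq: "\<forall>\<^sub>F s in F. J2 s ** (injL + injR ** H s)
          - frechet_derivative H (at s) (w s *\<^sub>R (\<Sum>b\<in>Bs. cf b s *\<^sub>R b))
        = w s *\<^sub>R (H s ** (J1 s ** (injL + injR ** H s)))"
begin

definition flow :: "'a \<Rightarrow> 'a" where "flow s = w s *\<^sub>R (\<Sum>b\<in>Bs. cf b s *\<^sub>R b)"

definition dd :: "('a \<Rightarrow> 'b::euclidean_space) \<Rightarrow> 'a \<Rightarrow> 'b" where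
  "dd f s = frechet_derivative f (at s) (flow s)"

definition J :: "'a \<Rightarrow> real^('m + 'n)^('m + 'n)" where
  "J s = w s *\<^sub>R (injL ** J1 s) + injR ** J2 s"

definition E :: "'a \<Rightarrow> real^'n^('m + 'n)" where "E s = injL ** \<tau> s + injR"
definition T :: "'a \<Rightarrow> real^'m^('m + 'n)" where "T s = injL + injR ** H s"
definition \<nu> :: "'a \<Rightarrow> real^'n^'n" where "\<nu> s = J2 s ** E s"
definition \<kappa> :: "'a \<Rightarrow> real^'m^'m" where "\<kappa> s = w s *\<^sub>R (J1 s ** T s)"

lemma Jet_dd:
  assumes "Jet q f"
  shows "Jet (Suc q) (dd f)"
proof -
  have "Jet (1 + q) (\<lambda>s. frechet_derivative f (at s) (flow s))"
  proof (rule Jet_directional[OF assms Bs(1,2), where c = "\<lambda>b s. w s *\<^sub>R cf b s"])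
    show "\<forall>\<^sub>F s in F. flow s = (\<Sum>b\<in>Bs. (w s *\<^sub>R cf b s) *\<^sub>R b)"
      by (simp add: flow_def scaleR_sum_right)
    show "Jet 1 (\<lambda>s. w s *\<^sub>R cf b s)" if "b \<in> Bs" for b
      using Jet_w_scale[OF Bs(3)[OF that]] by simp
  qed
  then show ?thesis unfolding dd_def by simp
qed

lemma dd_mult:
  fixes f :: "'a \<Rightarrow> real^'d^'c" and g :: "'a \<Rightarrow> real^'e^'d"
  assumes "Jet p f" "Jet q g"
  shows "\<forall>\<^sub>F s in F. dd (\<lambda>s. f s ** g s) s = f s ** dd g s + dd f s ** g s"
  using Jet_differentiable[OF assms(1)] Jet_differentiable[OF assms(2)]
proof eventually_elim
  case (elim s)
  from frechet_derivative_at[OF mm.FDERIV[OF elim]] show ?case by (simp add: dd_def fun_eq_iff)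
qed

lemma dd_affine:
  fixes f :: "'a \<Rightarrow> real^'d^'c"
  assumes "Jet q f"
  shows "\<forall>\<^sub>F s in F. dd (\<lambda>s. X ** f s + Y) s = X ** dd f s"
  using Jet_differentiable[OF assms]
proof eventually_elim
  case (elim s)
  have "((\<lambda>s. X ** f s + Y) has_derivative (\<lambda>v. X ** frechet_derivative f (at s) v)) (at s)"
    by (intro has_derivative_add_const bounded_linear.has_derivative[OF mm.bounded_linear_right] elim)
  from frechet_derivative_at[OF this] show ?case by (simp add: dd_def fun_eq_iff)
qed

lemma Jet_E: "Jet 0 E" and Jet_T: "Jet 0 T"
  unfolding E_def T_def by (intro Jet_add Jet_mult0 Jet_const tau H)+

lemma Jet_nu: "Jet 0 \<nu>"
  unfolding \<nu>_def by (intro Jet_mult0 J2 Jet_E)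

lemma Jet_kappa: "Jet 1 \<kappa>"
  using Jet_w_scale[OF Jet_mult0[OF J1 Jet_T]] by (simp add: \<kappa>_def[abs_def])

lemma Jet_J: "Jet 0 J"
  unfolding J_def
  by (intro Jet_add Jet_mult0 Jet_const J2 Jet_weaken[OF Jet_w_scale[of 0]] J1) auto

lemma E_limit: "(E \<longlongrightarrow> injR) F"
proof -
  have "((\<lambda>s. injL ** \<tau> s + injR) \<longlongrightarrow> injL ** 0 + (injR :: real^'n^('m + 'n))) F"
    by (intro tendsto_add tendsto_matrix_mult tendsto_const tau_zero)
  then show ?thesis by (simp add: E_def[abs_def])
qed

text \<open>\<open>\<nu>\<close> describes how the linearised flow acts on the fiber directions. As \<open>\<tau>\<close> tends to \<open>0\<close>, its limit
  is the derivative of the fast field in the fast variable.\<close>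
lemma nu_inverse:
  "Jet 0 (\<lambda>s. matrix_inv (\<nu> s))" "\<forall>\<^sub>F s in F. invertible (\<nu> s)" "(\<nu> \<longlongrightarrow> \<nu>0) F"
proof -
  have "((\<lambda>s. J2 s ** injL ** \<tau> s) \<longlongrightarrow> 0) F"
  proof -
    obtain C where C: "\<forall>\<^sub>F s in F. norm (J2 s ** (injL :: real^'m^('m + 'n))) \<le> C"
      using Jet_bound[OF Jet_mult0[OF J2 Jet_const]] by auto
    show ?thesis
      using mm.Bfun_prod_Zfun[of "\<lambda>s. J2 s ** injL" F \<tau>] C tau_zero
      by (auto simp: tendsto_Zfun_iff BfunI)
  qed
  from tendsto_add[OF this nu_limit] show l: "(\<nu> \<longlongrightarrow> \<nu>0) F"
    by (simp add: \<nu>_def[abs_def] E_def mm.add_right matrix_mul_assoc)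
  show "Jet 0 (\<lambda>s. matrix_inv (\<nu> s))" "\<forall>\<^sub>F s in F. invertible (\<nu> s)"
    by (rule Jet_matrix_inv[OF Jet_nu l nu_inv])+
qed

text \<open>The invariance equation itself shows that the fibers are \<open>O(\<epsilon>)\<close>-close to vertical with all
  derivatives: after multiplication with \<open>\<nu>\<close>, both remaining terms carry a factor \<open>\<epsilon>\<close>.\<close>
lemma Jet_tau: "Jet 1 \<tau>"
proof (rule Jet_cong)
  show "Jet 1 (\<lambda>s. (w s *\<^sub>R (J1 s ** E s) - dd \<tau> s) ** matrix_inv (\<nu> s))"
  proof (intro Jet_mult_l Jet_diff nu_inverse)
    show "Jet 1 (\<lambda>s. w s *\<^sub>R (J1 s ** E s))" using Jet_w_scale[OF Jet_mult0[OF J1 Jet_E]] by simp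
    show "Jet 1 (dd \<tau>)" using Jet_dd[OF tau] by simp
  qed
  show "\<forall>\<^sub>F s in F. (w s *\<^sub>R (J1 s ** E s) - dd \<tau> s) ** matrix_inv (\<nu> s) = \<tau> s"
    using fiber_eq nu_inverse(2)
  proof eventually_elim
    case (elim s)
    have "(w s *\<^sub>R (J1 s ** E s) - dd \<tau> s) = \<tau> s ** \<nu> s"
      using elim(1) by (simp add: E_def \<nu>_def dd_def flow_def)
    then have "(w s *\<^sub>R (J1 s ** E s) - dd \<tau> s) ** matrix_inv (\<nu> s) = \<tau> s ** (\<nu> s ** matrix_inv (\<nu> s))"
      by (simp add: matrix_mul_assoc)
    then show ?case by (simp add: matrix_inv_mult[OF elim(2)])
  qed
qed

lemma E_invariant: "\<forall>\<^sub>F s in F. J s ** E s - dd E s = E s ** \<nu> s"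
  using fiber_eq dd_affine[OF tau, of injL injR]
proof eventually_elim
  case (elim s)
  have "dd E s = injL ** dd \<tau> s" using elim(2) by (simp add: E_def[abs_def])
  moreover have "w s *\<^sub>R (J1 s ** E s) - dd \<tau> s = \<tau> s ** \<nu> s"
    using elim(1) by (simp add: E_def \<nu>_def dd_def flow_def)
  then have "w s *\<^sub>R (J1 s ** E s) = \<tau> s ** \<nu> s + dd \<tau> s" by (simp add: algebra_simps)
  moreover have "J s ** E s = injL ** (w s *\<^sub>R (J1 s ** E s)) + injR ** \<nu> s"
    by (simp add: J_def \<nu>_def mm.add_left mm.scaleR_left mm.scaleR_right matrix_mul_assoc)
  moreover have "E s ** \<nu> s = injL ** (\<tau> s ** \<nu> s) + injR ** \<nu> s"
    by (simp add: E_def mm.add_left matrix_mul_assoc)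
  ultimately show ?case by (simp add: mm.add_right)
qed

lemma T_invariant: "\<forall>\<^sub>F s in F. J s ** T s - dd T s = T s ** \<kappa> s"
  using slow_eq dd_affine[OF H, of injR injL]
proof eventually_elim
  case (elim s)
  have "dd T s = injR ** dd H s" using elim(2) by (simp add: T_def[abs_def] add.commute)
  moreover have "J2 s ** T s - dd H s = H s ** \<kappa> s"
    using elim(1) by (simp add: T_def \<kappa>_def dd_def flow_def mm.scaleR_right)
  then have "J2 s ** T s = H s ** \<kappa> s + dd H s" by (simp add: algebra_simps)
  moreover have "J s ** T s = injL ** \<kappa> s + injR ** (J2 s ** T s)"
    by (simp add: J_def \<kappa>_def mm.add_left mm.scaleR_left mm.scaleR_right matrix_mul_assoc)
  moreover have "T s ** \<kappa> s = injL ** \<kappa> s + injR ** (H s ** \<kappa> s)"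
    by (simp add: T_def mm.add_left matrix_mul_assoc)
  ultimately show ?case by (simp add: mm.add_right)
qed

text \<open>Substituting \<open>W = A (B W)\<close> and the product rule turns invariance of the bundle spanned by \<open>W\<close>
  into the same equation with \<open>\<Lambda>\<close> in place of \<open>J\<close>.\<close>
lemma frame_coordinates:
  fixes A :: "'a \<Rightarrow> real^('n + 'm)^('m + 'n)" and B :: "'a \<Rightarrow> real^('m + 'n)^('n + 'm)"
    and W :: "'a \<Rightarrow> real^'r^('m + 'n)"
  assumes A: "Jet 0 A" and B: "Jet 0 B" and W: "Jet 0 W"
    and inv: "\<forall>\<^sub>F s in F. A s ** B s = mat 1 \<and> B s ** A s = mat 1"
    and W_inv: "\<forall>\<^sub>F s in F. J s ** W s - dd W s = W s ** K s"
  shows "\<forall>\<^sub>F s in F. (B s ** W s) ** K s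
    = (B s ** J s ** A s - B s ** dd A s) ** (B s ** W s) - dd (\<lambda>s. B s ** W s) s"
proof -
  have "\<forall>\<^sub>F s in F. A s ** (B s ** W s) = W s"
    using inv by eventually_elim (simp add: matrix_mul_assoc)
  moreover have "\<forall>\<^sub>F s in F. (\<lambda>s. A s ** (B s ** W s)) differentiable (at s)"
    using Jet_differentiable[OF Jet_mult0[OF A Jet_mult0[OF B W]]]
    by (auto simp: differentiable_def elim: eventually_mono)
  ultimately have "\<forall>\<^sub>F s in F. dd W s = dd (\<lambda>s. A s ** (B s ** W s)) s"
    using eventually_frechet_cong by (fastforce simp: dd_def elim: eventually_mono)
  with dd_mult[OF A Jet_mult0[OF B W]] inv W_inv show ?thesis
  proof eventually_elim
    case (elim s)
    let ?Z = "B s ** W s"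
    have W: "W s = A s ** ?Z" using elim(2) by (simp add: matrix_mul_assoc)
    have "?Z ** K s = B s ** (J s ** W s - dd W s)"
      unfolding elim(3) by (simp add: matrix_mul_assoc)
    also have "\<dots> = B s ** (J s ** (A s ** ?Z)) - B s ** (A s ** dd (\<lambda>s. B s ** W s) s + dd A s ** ?Z)"
      using elim(1,4) W by (simp add: mm.diff_right)
    also have "\<dots> = (B s ** J s ** A s - B s ** dd A s) ** ?Z - (B s ** A s) ** dd (\<lambda>s. B s ** W s) s"
      by (simp add: mat_ring algebra_simps)
    finally show ?case using elim(2) by simp
  qed
qed

text \<open>Both residuals gain one order. The invertibility statements are limits: in the limit
  \<open>\<Lambda>\<^sup>1\<^sup>1 P = P \<nu>\<close> with invertible \<open>P = B\<^sup>1 E\<close>, so \<open>\<Lambda>\<^sup>1\<^sup>1\<close> is similar to \<open>\<nu>\<close>. This allows the next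
  frame to be formed near the limit point.\<close>
lemma refinement_step:
  fixes A :: "'a \<Rightarrow> real^('n + 'm)^('m + 'n)" and B :: "'a \<Rightarrow> real^('m + 'n)^('n + 'm)"
    and \<Lambda> :: "'a \<Rightarrow> real^('n + 'm)^('n + 'm)"
  assumes A: "Jet 0 A" and B: "Jet 0 B"
    and inv: "\<forall>\<^sub>F s in F. A s ** B s = mat 1 \<and> B s ** A s = mat 1"
    and limits: "(A \<longlongrightarrow> A') F" "(B \<longlongrightarrow> B') F" "(\<Lambda> \<longlongrightarrow> \<Lambda>') F" "A' ** B' = mat 1"
    and Lam: "\<forall>\<^sub>F s in F. \<Lambda> s = B s ** J s ** A s - B s ** dd A s"
    and Q: "Jet (Suc q) (\<lambda>s. prR ** B s ** E s)" and R: "Jet q (\<lambda>s. prL ** B s ** T s)"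
  shows "invertible (prL ** B' ** injR :: real^'n^'n)"
    and "invertible (block11 \<Lambda>')"
    and "Jet (Suc (Suc q)) (\<lambda>s. prR ** ((mat 1 - csp_L (\<Lambda> s)) ** (mat 1 + csp_U (\<Lambda> s)) ** B s) ** E s)"
    and "Jet (Suc q) (\<lambda>s. prL ** ((mat 1 - csp_L (\<Lambda> s)) ** (mat 1 + csp_U (\<Lambda> s)) ** B s) ** T s)"
proof -
  define P where "P = (\<lambda>s. prL ** B s ** E s)"
  define Q where "Q = (\<lambda>s. prR ** B s ** E s)"
  define R where "R = (\<lambda>s. prL ** B s ** T s)"
  define S where "S = (\<lambda>s. prR ** B s ** T s)"
  have JQ: "Jet (Suc q) Q" and JR: "Jet q R" using assms(9,10) by (simp_all add: Q_def R_def)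
  have JQ1: "Jet 1 Q" by (rule Jet_weaken[OF JQ]) simp
  have JP: "Jet 0 P" unfolding P_def by (intro Jet_mult0 Jet_const B Jet_E)
  have JL: "Jet 0 \<Lambda>"
    by (rule Jet_cong[of "\<lambda>s. B s ** J s ** A s - B s ** dd A s"])
      (use Lam in \<open>auto simp: eq_commute intro!: Jet_diff Jet_mult0 A B Jet_J Jet_weaken[OF Jet_dd[OF A]]\<close>)
  have J11: "Jet 0 (\<lambda>s. block11 (\<Lambda> s))" and J12: "Jet 0 (\<lambda>s. block12 (\<Lambda> s))"
    unfolding block_pr by (intro Jet_mult0 Jet_const JL)+
  have E_blocks: "\<forall>\<^sub>F s in F. P s ** \<nu> s = block11 (\<Lambda> s) ** P s + block12 (\<Lambda> s) ** Q s - dd P s \<and>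
      Q s ** \<nu> s = block21 (\<Lambda> s) ** P s + (prR ** \<Lambda> s ** injR) ** Q s - dd Q s"
    using frame_coordinates[OF A B Jet_E inv E_invariant] Lam
      dd_affine[OF Jet_mult0[OF B Jet_E], of prL 0] dd_affine[OF Jet_mult0[OF B Jet_E], of prR 0]
  proof eventually_elim
    case (elim s)
    from csp_invariance_blocks[OF elim(1)[folded elim(2)]] elim(3,4)
    show ?case by (simp add: P_def Q_def matrix_mul_assoc)
  qed
  have T_blocks: "\<forall>\<^sub>F s in F. R s ** \<kappa> s = block11 (\<Lambda> s) ** R s + block12 (\<Lambda> s) ** S s - dd R s"
    using frame_coordinates[OF A B Jet_T inv T_invariant] Lam dd_affine[OF Jet_mult0[OF B Jet_T], of prL 0]
  proof eventually_elim
    case (elim s)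
    from csp_invariance_blocks(1)[OF elim(1)[folded elim(2)]] elim(3)
    show ?case by (simp add: R_def S_def matrix_mul_assoc)
  qed
  \<comment> \<open>In the limit \<open>E\<close> is \<open>injR\<close> and the lower residual vanishes, so the limit of \<open>B\<close> maps
     the fast directions injectively into its upper rows.\<close>
  have Pl: "(P \<longlongrightarrow> prL ** B' ** injR) F" unfolding P_def
    by (intro tendsto_matrix_mult tendsto_const limits E_limit)
  have "(Q \<longlongrightarrow> prR ** B' ** injR) F" unfolding Q_def
    by (intro tendsto_matrix_mult tendsto_const limits E_limit)
  moreover have Q0: "(Q \<longlongrightarrow> 0) F" by (rule Jet_tendsto_zero[OF JQ1 _ w_zero]) simp
  ultimately have BR: "prR ** B' ** injR = (0 :: real^'n^'m)" using tendsto_unique[OF nontrivial] by metis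
  show Pinv: "invertible (prL ** B' ** injR :: real^'n^'n)"
  proof -
    have "v = 0" if "(prL ** B' ** injR) *v v = 0" for v :: "real^'n"
    proof -
      have "prL *v (B' *v (injR *v v)) = 0" "prR *v (B' *v (injR *v v)) = 0"
        using that arg_cong[OF BR, of "\<lambda>M. M *v v"] by (simp_all add: matrix_vector_mul_assoc matrix_mul_assoc)
      then have "B' *v (injR *v v) = 0" by (rule components_zero)
      then have "(prR ** A') *v (B' *v (injR *v v)) = 0" by simp
      then have "(prR ** (A' ** B') ** injR) *v v = 0" by (simp add: matrix_vector_mul_assoc matrix_mul_assoc)
      then show ?thesis using limits(4) by simp
    qed
    then show ?thesis
      using matrix_left_invertible_ker invertible_left_inverse by blast
  qed
  have L11l: "((\<lambda>s. block11 (\<Lambda> s)) \<longlongrightarrow> block11 \<Lambda>') F" and L12l: "((\<lambda>s. block12 (\<Lambda> s)) \<longlongrightarrow> block12 \<Lambda>') F"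
    unfolding block_pr by (intro tendsto_matrix_mult tendsto_const limits)+
  have dP: "Jet 1 (dd P)" using Jet_dd[OF JP] by simp
  show inv11: "invertible (block11 \<Lambda>')"
  proof -
    have "((\<lambda>s. block11 (\<Lambda> s) ** P s) \<longlongrightarrow> block11 \<Lambda>' ** (prL ** B' ** injR)) F"
      by (intro tendsto_matrix_mult L11l Pl)
    moreover have l: "((\<lambda>s. P s ** \<nu> s + dd P s - block12 (\<Lambda> s) ** Q s)
        \<longlongrightarrow> (prL ** B' ** injR) ** \<nu>0 + 0 - block12 \<Lambda>' ** 0) F"
      by (intro tendsto_add tendsto_diff tendsto_matrix_mult Pl nu_inverse L12l Q0
          Jet_tendsto_zero[OF dP _ w_zero]) simp
    have "\<forall>\<^sub>F s in F. P s ** \<nu> s + dd P s - block12 (\<Lambda> s) ** Q s = block11 (\<Lambda> s) ** P s"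
      using E_blocks by eventually_elim (simp add: algebra_simps)
    from Lim_transform_eventually[OF l this]
    have "((\<lambda>s. block11 (\<Lambda> s) ** P s) \<longlongrightarrow> (prL ** B' ** injR) ** \<nu>0) F" by simp
    ultimately have "block11 \<Lambda>' ** (prL ** B' ** injR) = (prL ** B' ** injR) ** \<nu>0"
      using tendsto_unique[OF nontrivial] by blast
    then have "block11 \<Lambda>' ** (prL ** B' ** injR) ** matrix_inv (prL ** B' ** injR)
        = (prL ** B' ** injR) ** \<nu>0 ** matrix_inv (prL ** B' ** injR)" by simp
    then have "block11 \<Lambda>' = (prL ** B' ** injR) ** \<nu>0 ** matrix_inv (prL ** B' ** injR)"
      by (simp add: matrix_mul_assoc[symmetric] matrix_inv_mult[OF Pinv, unfolded matrix_mul_assoc[symmetric]])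
    moreover have "invertible (matrix_inv (prL ** B' ** injR) :: real^'n^'n)"
      using matrix_inv_mult[OF Pinv] unfolding invertible_def by blast
    ultimately show ?thesis using invertible_mult Pinv nu_inv by metis
  qed
  define V where "V = (\<lambda>s. matrix_inv (block11 (\<Lambda> s)))"
  have JV: "Jet 0 V" and V: "\<forall>\<^sub>F s in F. invertible (block11 (\<Lambda> s))"
    unfolding V_def by (rule Jet_matrix_inv[OF J11 L11l inv11])+
  have JPi: "Jet 0 (\<lambda>s. matrix_inv (P s))" and Pi: "\<forall>\<^sub>F s in F. invertible (P s)"
    by (rule Jet_matrix_inv[OF JP Pl Pinv])+
  have "Jet (Suc q) (\<lambda>s. V s ** (R s ** \<kappa> s + dd R s))"
    by (intro Jet_mult_r[OF JV] Jet_add Jet_mult_1r JR Jet_kappa Jet_dd)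
  then show "Jet (Suc q) (\<lambda>s. prL ** ((mat 1 - csp_L (\<Lambda> s)) ** (mat 1 + csp_U (\<Lambda> s)) ** B s) ** T s)"
  proof (rule Jet_cong[rotated])
    show "\<forall>\<^sub>F s in F. V s ** (R s ** \<kappa> s + dd R s) =
        prL ** ((mat 1 - csp_L (\<Lambda> s)) ** (mat 1 + csp_U (\<Lambda> s)) ** B s) ** T s"
      using T_blocks V
    proof eventually_elim
      case (elim s)
      have "R s + (V s ** block12 (\<Lambda> s)) ** S s = V s ** (R s ** \<kappa> s + dd R s)"
        by (rule upper_residual_step[OF elim(1)]) (simp add: V_def matrix_inv_mult elim(2))
      then show ?case unfolding csp_step_upper
        by (simp add: mm.add_left R_def S_def V_def matrix_mul_assoc)
    qed
  qed
  \<comment> \<open>The block \<open>\<Lambda>\<^sup>2\<^sup>2\<close> is small because \<open>J\<close> is \<open>O(\<epsilon>)\<close> plus something with values in the fast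
     directions, and on those \<open>prR ** B\<close> is small by the hypothesis on \<open>E\<close>.\<close>
  have JL22: "Jet 1 (\<lambda>s. prR ** \<Lambda> s ** injR)"
  proof (rule Jet_cong)
    let ?f = "\<lambda>s. (w s *\<^sub>R (prR ** B s ** injL ** J1 s) + (Q s - prR ** B s ** injL ** \<tau> s) ** J2 s) ** A s ** injR
        - prR ** B s ** dd A s ** injR"
    have 1: "Jet 1 (\<lambda>s. w s *\<^sub>R (prR ** B s ** injL ** J1 s))"
      using Jet_w_scale[of 0 "\<lambda>s. prR ** B s ** injL ** J1 s"] by (simp add: Jet_mult0 Jet_const B J1)
    have 2: "Jet 1 (dd A)" using Jet_dd[OF A] by simp
    show "Jet 1 ?f"
      by (intro Jet_diff Jet_add Jet_mult_l[OF _ Jet_const] Jet_mult_l[OF _ A] Jet_mult_l[OF _ J2] 1 JQ1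
          Jet_mult_r[OF _ Jet_tau] Jet_mult_r[OF _ 2] Jet_mult0 B Jet_const)
    show "\<forall>\<^sub>F s in F. ?f s = prR ** \<Lambda> s ** injR"
      using Lam
    proof eventually_elim
      case (elim s)
      have "prR ** B s ** injR = Q s - prR ** B s ** injL ** \<tau> s"
        by (simp add: Q_def E_def mm.add_right matrix_mul_assoc)
      then have "prR ** B s ** J s = w s *\<^sub>R (prR ** B s ** injL ** J1 s) + (Q s - prR ** B s ** injL ** \<tau> s) ** J2 s"
        by (simp add: J_def mm.add_right mm.scaleR_right matrix_mul_assoc)
      then show ?case unfolding elim
        by (simp add: mm.diff_left mm.diff_right matrix_mul_assoc)
    qed
  qed
  have JL21: "Jet (Suc q) (\<lambda>s. block21 (\<Lambda> s))"
  proof (rule Jet_cong)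
    show "Jet (Suc q) (\<lambda>s. (Q s ** \<nu> s - (prR ** \<Lambda> s ** injR) ** Q s + dd Q s) ** matrix_inv (P s))"
      by (intro Jet_mult_l[OF _ JPi] Jet_add Jet_diff Jet_mult_l[OF JQ Jet_nu] Jet_mult_r[OF _ JQ]
          Jet_weaken[OF JL22] Jet_weaken[OF Jet_dd[OF JQ]]) auto
    show "\<forall>\<^sub>F s in F. (Q s ** \<nu> s - (prR ** \<Lambda> s ** injR) ** Q s + dd Q s) ** matrix_inv (P s) = block21 (\<Lambda> s)"
      using E_blocks Pi
    proof eventually_elim
      case (elim s)
      have "Q s ** \<nu> s - (prR ** \<Lambda> s ** injR) ** Q s + dd Q s = block21 (\<Lambda> s) ** P s"
        using elim(1) by (simp add: algebra_simps)
      then have "(Q s ** \<nu> s - (prR ** \<Lambda> s ** injR) ** Q s + dd Q s) ** matrix_inv (P s)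
          = block21 (\<Lambda> s) ** (P s ** matrix_inv (P s))" by (simp add: matrix_mul_assoc)
      then show ?case by (simp add: matrix_inv_mult[OF elim(2)])
    qed
  qed
  define N where "N = (\<lambda>s. matrix_inv (\<nu> s))"
  have JN: "Jet 0 N" unfolding N_def by (rule nu_inverse)
  have "Jet (Suc (Suc q)) (\<lambda>s. ((prR ** \<Lambda> s ** injR) ** Q s - dd Q s) ** N s
      + block21 (\<Lambda> s) ** (V s ** (dd P s - block12 (\<Lambda> s) ** Q s) ** N s - V s ** (V s ** block12 (\<Lambda> s)) ** Q s))"
    by (intro Jet_add Jet_mult_l[OF _ JN] Jet_diff Jet_mult_1l[OF JL22 JQ] Jet_dd[OF JQ] Jet_mult_1r[OF JL21]
        Jet_mult_r[OF _ JQ1] Jet_mult_r[OF JV] Jet_mult0 JV J12 dP)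
  then show "Jet (Suc (Suc q)) (\<lambda>s. prR ** ((mat 1 - csp_L (\<Lambda> s)) ** (mat 1 + csp_U (\<Lambda> s)) ** B s) ** E s)"
  proof (rule Jet_cong[rotated])
    show "\<forall>\<^sub>F s in F. ((prR ** \<Lambda> s ** injR) ** Q s - dd Q s) ** N s
      + block21 (\<Lambda> s) ** (V s ** (dd P s - block12 (\<Lambda> s) ** Q s) ** N s - V s ** (V s ** block12 (\<Lambda> s)) ** Q s)
      = prR ** ((mat 1 - csp_L (\<Lambda> s)) ** (mat 1 + csp_U (\<Lambda> s)) ** B s) ** E s"
      using E_blocks V nu_inverse(2)
    proof eventually_elim
      case (elim s)
      have "Q s - (block21 (\<Lambda> s) ** V s) ** (P s + (V s ** block12 (\<Lambda> s)) ** Q s) =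
        ((prR ** \<Lambda> s ** injR) ** Q s - dd Q s) ** N s
        + block21 (\<Lambda> s) ** (V s ** (dd P s - block12 (\<Lambda> s) ** Q s) ** N s - V s ** (V s ** block12 (\<Lambda> s)) ** Q s)"
        by (rule lower_residual_step) (use elim in \<open>auto simp: V_def N_def matrix_inv_mult\<close>)
      then show ?case unfolding csp_step_lower csp_step_upper
        by (simp add: mm.add_left mm.add_right mm.diff_left P_def Q_def V_def matrix_mul_assoc)
    qed
  qed
qed

end

section \<open>Functions that are smooth up to a corner\<close>

text \<open>Functions of \<open>(y, \<epsilon>)\<close> are studied near \<open>(y0, 0)\<close>, a corner of \<open>K \<times> [0, \<infinity>)\<close> if \<open>y0\<close> is a
  boundary point of \<open>K\<close>. Limits are taken within the open set \<open>S\<close>, where derivatives make sense.\<close>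
locale corner =
  fixes K :: "'a::euclidean_space set" and y0 :: 'a
  assumes y0: "y0 \<in> K" and K: "closure (interior K) = K"
begin

definition S :: "('a \<times> real) set" where "S = interior K \<times> {0<..}"
definition F :: "('a \<times> real) filter" where "F = at (y0, 0) within S"
abbreviation D :: "('a \<times> real) set" where "D \<equiv> UNIV \<times> {0}"

lemma open_S: "open S" unfolding S_def by (intro open_Times) auto

lemma eventually_F_nhds: "eventually P (nhds (y0, 0)) \<Longrightarrow> eventually P F"
  unfolding F_def by (simp add: eventually_at_filter eventually_mono)

lemma eventually_F_S: "\<forall>\<^sub>F s in F. s \<in> S"
  unfolding F_def by (simp add: eventually_at_filter)

lemma eventually_F_uniform:
  assumes "\<forall>\<^sub>F \<epsilon> in at_right 0. \<forall>y\<in>K. P y \<epsilon>"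
  shows "\<forall>\<^sub>F s in F. P (fst s) (snd s)"
proof -
  obtain e where e: "e > 0" "\<And>t. 0 < t \<Longrightarrow> t < e \<Longrightarrow> \<forall>y\<in>K. P y t"
    using eventually_at_right_0[OF assms] by metis
  have "\<forall>\<^sub>F s in nhds (y0, 0::real). s \<in> UNIV \<times> {..<e}"
    by (rule eventually_nhds_in_open) (use e in \<open>auto intro: open_Times\<close>)
  from eventually_F_nhds[OF this] eventually_F_S show ?thesis
  proof eventually_elim
    case (elim s)
    then show ?case using e(2)[of "snd s"] interior_subset[of K] by (auto simp: S_def)
  qed
qed

lemma jets_F: "jets F D snd"
proof
  show "\<forall>\<^sub>F x in F. eventually P (nhds x)" if "eventually P F" for P
    using that unfolding F_def by (rule eventually_at_within_open_nhds[OF open_S])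
  have "\<forall>\<^sub>F s in nhds (y0, 0::real). s \<in> UNIV \<times> {..<1}"
    by (rule eventually_nhds_in_open) (auto intro: open_Times)
  from eventually_F_nhds[OF this] eventually_F_S show "\<forall>\<^sub>F s in F. 0 \<le> snd s \<and> snd s \<le> 1"
    by eventually_elim (auto simp: S_def)
  have "frechet_derivative snd (at s) = snd" for s :: "'a \<times> real"
    by (rule frechet_derivative_at[symmetric]) (intro bounded_linear_imp_has_derivative bounded_linear_snd)
  then show "\<forall>\<^sub>F s in F. snd differentiable (at s) \<and> (\<forall>v\<in>D. frechet_derivative snd (at s) v = 0)"
    by (auto simp: bounded_linear_imp_differentiable bounded_linear_snd)
qed

sublocale jets F D snd by (rule jets_F)

lemma F_nontrivial: "F \<noteq> bot"
proof -
  have "(y0, 0) \<in> closure S"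
    unfolding S_def closure_Times K using y0 by simp
  moreover have "(y0, 0) \<notin> S" by (simp add: S_def)
  ultimately show ?thesis unfolding F_def trivial_limit_within closure_def by auto
qed

lemma tendsto_F_ident: "((\<lambda>s. s) \<longlongrightarrow> (y0, 0)) F"
  unfolding F_def by (rule tendsto_ident_at)

lemma snd_F: "(snd \<longlongrightarrow> 0) F" and fst_F: "(fst \<longlongrightarrow> y0) F"
  using tendsto_snd[OF tendsto_F_ident] tendsto_fst[OF tendsto_F_ident] by simp_all

lemma Jet_ident: "Jet 0 (\<lambda>s. s)"
proof -
  have "jet k 0 (\<lambda>s. s)" for k
  proof -
    have "((\<lambda>s. norm s) \<longlongrightarrow> norm (y0, 0::real)) F" by (intro tendsto_norm tendsto_F_ident)
    then have "\<forall>\<^sub>F s in F. norm s < norm (y0, 0::real) + 1" by (rule order_tendstoD) simp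
    then have "\<forall>\<^sub>F s in F. norm s \<le> (norm (y0, 0::real) + 1) * snd s ^ 0" by eventually_elim simp
    then have b: "\<exists>C. \<forall>\<^sub>F s in F. norm s \<le> C * snd s ^ 0" by blast
    show ?thesis
    proof (cases k)
      case 0 then show ?thesis using b by simp
    next
      case (Suc j)
      show ?thesis unfolding Suc
        by (rule jet_SucI[where f' = "\<lambda>s v. v"]) (use b in \<open>auto intro: jet_const\<close>)
    qed
  qed
  then show ?thesis by (simp add: Jet_def)
qed

text \<open>The neighbourhood and the extension may depend on \<open>k\<close>: the regularity of the slow manifold and of
  the fibers is only given on parameter intervals that shrink as \<open>k\<close> grows.\<close>
definition corner_smooth :: "('a \<times> real \<Rightarrow> 'b::euclidean_space) \<Rightarrow> bool" where
  "corner_smooth f \<longleftrightarrow> (\<forall>k. \<exists>U f'. open U \<and> (y0, 0) \<in> U \<and> Ck_open k U f' \<and>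
     (\<forall>s\<in>U \<inter> K \<times> {0..}. f' s = f s))"

lemma S_subset: "S \<subseteq> K \<times> {0..}"
  using interior_subset[of K] by (auto simp: S_def)

lemma corner_smoothE:
  assumes "corner_smooth f"
  obtains U f' where "open U" "(y0, 0) \<in> U" "Ck_open k U f'" "\<And>s. s \<in> U \<Longrightarrow> s \<in> K \<times> {0..} \<Longrightarrow> f' s = f s"
  using assms[unfolded corner_smooth_def, rule_format, of k] by auto

lemma corner_smooth_Jet:
  assumes "corner_smooth f"
  shows "Jet 0 f"
proof -
  have "jet k 0 f" for k
  proof -
    obtain U f' where U: "open U" "(y0, 0) \<in> U" "Ck_open k U f'" "\<And>s. s \<in> U \<Longrightarrow> s \<in> K \<times> {0..} \<Longrightarrow> f' s = f s"
      using corner_smoothE[OF assms, of k] by metis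
    have "jet k 0 f'"
      using jet_compose[OF U(1,2) tendsto_F_ident U(3)] Jet_ident by (simp add: Jet_def)
    moreover have "\<forall>\<^sub>F s in F. f' s = f s"
      using eventually_F_nhds[OF eventually_nhds_in_open[OF U(1,2)]] eventually_F_S
      by eventually_elim (use U(4) S_subset in auto)
    ultimately show ?thesis using jet_cong by blast
  qed
  then show ?thesis by (simp add: Jet_def)
qed

lemma corner_smooth_continuous:
  assumes "corner_smooth f"
  obtains U where "open U" "(y0, 0) \<in> U" "continuous_on (U \<inter> K \<times> {0..}) f"
proof -
  obtain U f' where U: "open U" "(y0, 0) \<in> U" "Ck_open 0 U f'" "\<And>s. s \<in> U \<Longrightarrow> s \<in> K \<times> {0..} \<Longrightarrow> f' s = f s"
    using corner_smoothE[OF assms, of 0] by metis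
  have "continuous_on (U \<inter> K \<times> {0..}) f'" using U(3) by (auto intro: continuous_on_subset)
  then have "continuous_on (U \<inter> K \<times> {0..}) f" by (rule continuous_on_eq) (use U(4) in auto)
  with U show thesis using that by blast
qed

lemma corner_smooth_tendsto_within:
  assumes "corner_smooth f"
  shows "(f \<longlongrightarrow> f (y0, 0)) (at (y0, 0) within K \<times> {0..})"
proof -
  obtain U where U: "open U" "(y0, 0) \<in> U" "continuous_on (U \<inter> K \<times> {0..}) f"
    using corner_smooth_continuous[OF assms] .
  then have "(f \<longlongrightarrow> f (y0, 0)) (at (y0, 0) within U \<inter> K \<times> {0..})"
    using y0 by (simp add: continuous_on_def)
  moreover have "at (y0, 0) within U \<inter> K \<times> {0..} = at (y0, 0) within K \<times> {0..}"
    by (rule at_within_nhd[OF U(2,1)]) auto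
  ultimately show ?thesis by simp
qed

lemma corner_smooth_tendsto:
  assumes "corner_smooth f"
  shows "(f \<longlongrightarrow> f (y0, 0)) F"
  unfolding F_def by (rule tendsto_within_subset[OF corner_smooth_tendsto_within[OF assms] S_subset])

lemma corner_smooth_Ck:
  assumes "corner_smooth f"
  shows "\<forall>\<^sub>F s in F. \<exists>V. open V \<and> s \<in> V \<and> V \<subseteq> S \<and> Ck_open k V f"
proof -
  obtain U f' where U: "open U" "(y0, 0) \<in> U" "Ck_open k U f'" "\<And>s. s \<in> U \<Longrightarrow> s \<in> K \<times> {0..} \<Longrightarrow> f' s = f s"
    using corner_smoothE[OF assms, of k] by metis
  have o: "open (U \<inter> S)" using U(1) open_S by auto
  have "Ck_open k (U \<inter> S) f"
    by (rule Ck_open_cong[OF o _ Ck_open_subset[OF U(3)]]) (use U(4) S_subset in auto)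
  then show ?thesis
    using eventually_F_nhds[OF eventually_nhds_in_open[OF U(1,2)]] eventually_F_S o
    by (smt (verit, ccfv_threshold) Int_iff eventually_elim2 inf_le2)
qed

lemma boundary_line_tendsto: "((\<lambda>\<epsilon>::real. (y0, \<epsilon>)) \<longlongrightarrow> (y0, 0)) (at_right 0)"
  by (intro tendsto_Pair tendsto_const tendsto_ident_at)

lemma eventually_boundary_line:
  fixes U :: "('a \<times> real) set"
  assumes "open U" "(y0, 0) \<in> U"
  shows "\<forall>\<^sub>F \<epsilon> in at_right 0. (y0, \<epsilon>) \<in> U \<and> (y0, \<epsilon>) \<in> K \<times> {0..}"
  using topological_tendstoD[OF boundary_line_tendsto assms] eventually_at_right_less[of "0::real"]
  by eventually_elim (use y0 in auto)

lemma corner_smooth_line_tendsto: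
  assumes "corner_smooth f"
  shows "((\<lambda>\<epsilon>. f (y0, \<epsilon>)) \<longlongrightarrow> f (y0, 0)) (at_right 0)"
proof (rule filterlim_compose[OF corner_smooth_tendsto_within[OF assms]])
  show "filterlim (\<lambda>\<epsilon>::real. (y0, \<epsilon>)) (at (y0, 0) within K \<times> {0..}) (at_right 0)"
    unfolding filterlim_at using boundary_line_tendsto eventually_at_right_less[of "0::real"] y0
    by (auto elim!: eventually_mono)
qed

lemma rjets_ident: "rjets.Jet 0 (\<lambda>\<epsilon>. \<epsilon>)"
proof -
  have "\<forall>\<^sub>F \<epsilon> in at_right (0::real). \<epsilon> < 1" by (rule order_tendstoD[OF tendsto_ident_at]) simp
  with eventually_at_right_less[of "0::real"] have "\<forall>\<^sub>F \<epsilon> in at_right (0::real). norm \<epsilon> \<le> 1 * 1 ^ 0"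
    by eventually_elim auto
  then have b: "\<exists>C. \<forall>\<^sub>F \<epsilon> in at_right (0::real). norm \<epsilon> \<le> C * 1 ^ 0" by blast
  have "rjets.jet k 0 (\<lambda>\<epsilon>. \<epsilon>)" for k
  proof (cases k)
    case 0 then show ?thesis using b by simp
  next
    case (Suc j)
    show ?thesis unfolding Suc
      by (rule rjets.jet_SucI[where f' = "\<lambda>s v. v"]) (use b in \<open>auto intro: rjets.jet_const\<close>)
  qed
  then show ?thesis by (simp add: rjets.Jet_def)
qed

lemma corner_smooth_line_Jet:
  assumes "corner_smooth f"
  shows "rjets.Jet 0 (\<lambda>\<epsilon>. f (y0, \<epsilon>))"
proof -
  have "rjets.jet k 0 (\<lambda>\<epsilon>. f (y0, \<epsilon>))" for k
  proof -
    obtain U f' where U: "open U" "(y0, 0) \<in> U" "Ck_open k U f'" "\<And>s. s \<in> U \<Longrightarrow> s \<in> K \<times> {0..} \<Longrightarrow> f' s = f s"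
      using corner_smoothE[OF assms, of k] by metis
    have "rjets.jet k 0 (\<lambda>\<epsilon>. (y0, \<epsilon>))"
      using rjets.Jet_Pair[OF rjets.Jet_const[of y0] rjets_ident] unfolding rjets.Jet_def by blast
    from rjets.jet_compose[OF U(1,2) boundary_line_tendsto U(3) this]
    have "rjets.jet k 0 (\<lambda>\<epsilon>. f' (y0, \<epsilon>))" .
    moreover have "\<forall>\<^sub>F \<epsilon> in at_right 0. f' (y0, \<epsilon>) = f (y0, \<epsilon>)"
      using eventually_boundary_line[OF U(1,2)] by eventually_elim (use U(4) in auto)
    ultimately show ?thesis by (rule rjets.jet_cong[rotated])
  qed
  then show ?thesis by (simp add: rjets.Jet_def)
qed

text \<open>Order estimates hold in \<open>S\<close>. A point \<open>(y0, \<epsilon>)\<close> with \<open>\<epsilon> > 0\<close> is a limit of points of \<open>S\<close> with almost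
  the same \<open>\<epsilon>\<close>, so the estimate with the same constant passes to it.\<close>
lemma bound_on_boundary_line:
  fixes f :: "'a \<times> real \<Rightarrow> 'b::euclidean_space"
  assumes U: "open U" "(y0, 0) \<in> U" "continuous_on (U \<inter> K \<times> {0..}) f"
    and bound: "\<forall>\<^sub>F s in F. norm (f s) \<le> C * snd s ^ q"
  shows "\<forall>\<^sub>F \<epsilon> in at_right 0. norm (f (y0, \<epsilon>)) \<le> C * \<epsilon> ^ q"
proof -
  obtain V where V: "open V" "(y0, 0) \<in> V" "\<And>s. s \<in> V \<Longrightarrow> s \<in> S \<Longrightarrow> norm (f s) \<le> C * snd s ^ q"
  proof -
    obtain V where "open V" "(y0, 0) \<in> V" "\<forall>s\<in>V. s \<noteq> (y0, 0) \<longrightarrow> s \<in> S \<longrightarrow> norm (f s) \<le> C * snd s ^ q"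
      using bound unfolding F_def eventually_at_topological by metis
    then show thesis by (intro that[of V]) (auto simp: S_def)
  qed
  have "open (U \<inter> V)" "(y0, 0) \<in> U \<inter> V" using U(1,2) V(1,2) by auto
  from eventually_boundary_line[OF this] eventually_at_right_less[of "0::real"] show ?thesis
  proof eventually_elim
    case (elim \<epsilon>)
    let ?A = "U \<inter> V \<inter> K \<times> {0..}"
    have "(f \<longlongrightarrow> f (y0, \<epsilon>)) (at (y0, \<epsilon>) within U \<inter> K \<times> {0..})"
      using U(3) elim unfolding continuous_on_def by auto
    then have l: "(f \<longlongrightarrow> f (y0, \<epsilon>)) (at (y0, \<epsilon>) within U \<inter> V \<inter> S)"
      by (rule tendsto_within_subset) (use S_subset in auto)
    show ?case
    proof (cases "(y0, \<epsilon>) \<in> S")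
      case True then show ?thesis using V(3)[of "(y0, \<epsilon>)"] elim by auto
    next
      case False
      have "(y0, \<epsilon>) \<in> closure S" unfolding S_def closure_Times K using y0 elim by simp
      then have "(y0, \<epsilon>) \<in> closure (U \<inter> V \<inter> S)"
        using elim open_Int_closure_subset[of "U \<inter> V" S] U(1) V(1) by blast
      with False have "at (y0, \<epsilon>) within U \<inter> V \<inter> S \<noteq> bot"
        unfolding trivial_limit_within closure_def by auto
      moreover have "((\<lambda>s. C * snd s ^ q - norm (f s)) \<longlongrightarrow> C * snd (y0, \<epsilon>) ^ q - norm (f (y0, \<epsilon>))) (at (y0, \<epsilon>) within U \<inter> V \<inter> S)"
        by (intro tendsto_intros l)
      moreover have "\<forall>\<^sub>F s in at (y0, \<epsilon>) within U \<inter> V \<inter> S. 0 \<le> C * snd s ^ q - norm (f s)"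
        using V(3) by (auto simp: eventually_at_filter)
      ultimately have "0 \<le> C * snd (y0, \<epsilon>) ^ q - norm (f (y0, \<epsilon>))"
        by (intro tendsto_lowerbound[of "\<lambda>s. C * snd s ^ q - norm (f s)"]) auto
      then show ?thesis by simp
    qed
  qed
qed

end

section \<open>Smoothness of the CSP frames\<close>

lemma has_derivative_partial:
  fixes f :: "'a::euclidean_space \<times> real \<Rightarrow> 'b::euclidean_space"
  assumes "(f has_derivative f') (at (x, \<epsilon>))"
  shows "((\<lambda>x. f (x, \<epsilon>)) has_derivative (\<lambda>v. f' (v, 0))) (at x)"
proof -
  have "((\<lambda>x. (x, \<epsilon>)) has_derivative (\<lambda>v. (v, 0))) (at x)"
    by (intro has_derivative_Pair has_derivative_ident has_derivative_const)
  from has_derivative_compose[OF this assms] show ?thesis .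
qed

lemma matrix_apply:
  fixes f :: "real^'n \<Rightarrow> real^'m"
  assumes "linear f"
  shows "matrix f *v x = f x"
  using assms by (simp add: matrix_works)

text \<open>The field is used through an extension to an open set of triples \<open>(y, z, \<epsilon>)\<close>, which makes it
  smooth across \<open>\<epsilon> = 0\<close>.\<close>
locale smooth_field =
  fixes G1 :: "(real^'m) \<times> (real^'n) \<times> real \<Rightarrow> real^'m"
    and G2 :: "(real^'m) \<times> (real^'n) \<times> real \<Rightarrow> real^'n"
    and W :: "((real^'m) \<times> (real^'n) \<times> real) set"
  assumes open_W: "open W" and G1_Ck: "\<And>k. Ck_open k W G1" and G2_Ck: "\<And>k. Ck_open k W G2"
begin

abbreviation g :: "real \<Rightarrow> real^('m + 'n) \<Rightarrow> real^('m + 'n)" where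
  "g \<equiv> fs_field (\<lambda>y z \<epsilon>. G1 (y, z, \<epsilon>)) (\<lambda>y z \<epsilon>. G2 (y, z, \<epsilon>))"

text \<open>The reordering of a state with parameter into the arguments of \<open>G1\<close> and \<open>G2\<close>.\<close>
definition cc :: "(real^('m + 'n)) \<times> real \<Rightarrow> (real^'m) \<times> (real^'n) \<times> real" where
  "cc p = (slow (fst p), fast (fst p), snd p)"

definition WX :: "((real^('m + 'n)) \<times> real) set" where "WX = cc -` W"

definition J1 :: "(real^('m + 'n)) \<times> real \<Rightarrow> real^('m + 'n)^'m" where
  "J1 p = matrix (\<lambda>v. frechet_derivative G1 (at (cc p)) (slow v, fast v, 0))"

definition J2 :: "(real^('m + 'n)) \<times> real \<Rightarrow> real^('m + 'n)^'n" where
  "J2 p = matrix (\<lambda>v. frechet_derivative G2 (at (cc p)) (slow v, fast v, 0))"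

lemma bounded_linear_slow: "bounded_linear (slow :: real^('m + 'n) \<Rightarrow> real^'m)"
  and bounded_linear_fast: "bounded_linear (fast :: real^('m + 'n) \<Rightarrow> real^'n)"
  unfolding slow_pr[abs_def] fast_pr[abs_def] by (rule matrix_vector_mul_bounded_linear)+

lemma bounded_linear_cc: "bounded_linear cc"
  unfolding cc_def
  by (intro bounded_linear_Pair bounded_linear_compose[OF bounded_linear_slow bounded_linear_fst]
      bounded_linear_compose[OF bounded_linear_fast bounded_linear_fst] bounded_linear_snd)

lemma open_WX: "open WX"
  unfolding WX_def by (intro open_vimage open_W linear_continuous_on bounded_linear_cc)

lemma Ck_cc:
  assumes "Ck_open k W f"
  shows "Ck_open k WX (\<lambda>p. f (cc p))"
  by (rule Ck_open_compose[OF open_WX assms Ck_open_bounded_linear[OF bounded_linear_cc open_WX]])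
    (auto simp: WX_def)

lemma g_eq: "g \<epsilon> x = injL *v (\<epsilon> *\<^sub>R G1 (cc (x, \<epsilon>))) + injR *v G2 (cc (x, \<epsilon>))"
  by (simp add: fs_field_def join_inj cc_def)

lemma Ck_field: "Ck_open k WX (\<lambda>p. g (snd p) (fst p))"
  unfolding g_eq prod.collapse
  by (intro Ck_open_add open_WX Ck_open_linear_compose[OF matrix_vector_mul_bounded_linear open_WX]
      Ck_open_bilinear[OF bounded_bilinear_scaleR open_WX] Ck_open_bounded_linear bounded_linear_snd
      Ck_cc G1_Ck G2_Ck)

lemma J_has_derivative:
  assumes "(x, \<epsilon>) \<in> WX"
  shows "((\<lambda>x. G1 (cc (x, \<epsilon>))) has_derivative (\<lambda>v. J1 (x, \<epsilon>) *v v)) (at x)"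
    and "((\<lambda>x. G2 (cc (x, \<epsilon>))) has_derivative (\<lambda>v. J2 (x, \<epsilon>) *v v)) (at x)"
proof -
  have "cc (x, \<epsilon>) \<in> W" using assms by (simp add: WX_def)
  note d = Ck_open_has_derivative[OF G1_Ck[of "Suc 0"] this] Ck_open_has_derivative[OF G2_Ck[of "Suc 0"] this]
  have c: "((\<lambda>x. cc (x, \<epsilon>)) has_derivative (\<lambda>v. (slow v, fast v, 0))) (at x)"
    unfolding cc_def fst_conv snd_conv
    by (intro has_derivative_Pair has_derivative_const bounded_linear_imp_has_derivative
        bounded_linear_slow bounded_linear_fast)
  note e1 = has_derivative_compose[OF c d(1)] and e2 = has_derivative_compose[OF c d(2)]
  show "((\<lambda>x. G1 (cc (x, \<epsilon>))) has_derivative (\<lambda>v. J1 (x, \<epsilon>) *v v)) (at x)"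
    unfolding J1_def matrix_apply[OF has_derivative_linear[OF e1]] by (rule e1)
  show "((\<lambda>x. G2 (cc (x, \<epsilon>))) has_derivative (\<lambda>v. J2 (x, \<epsilon>) *v v)) (at x)"
    unfolding J2_def matrix_apply[OF has_derivative_linear[OF e2]] by (rule e2)
qed

lemma g_has_derivative:
  assumes "(x, \<epsilon>) \<in> WX"
  shows "(g \<epsilon> has_derivative (\<lambda>v. (\<epsilon> *\<^sub>R (injL ** J1 (x, \<epsilon>)) + injR ** J2 (x, \<epsilon>)) *v v)) (at x)"
proof -
  have "(g \<epsilon> has_derivative (\<lambda>v. injL *v (\<epsilon> *\<^sub>R (J1 (x, \<epsilon>) *v v)) + injR *v (J2 (x, \<epsilon>) *v v))) (at x)"
    unfolding g_eq[abs_def]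
    by (intro has_derivative_add bounded_linear.has_derivative[OF matrix_vector_mul_bounded_linear]
        has_derivative_scaleR_right J_has_derivative assms)
  then show ?thesis
    by (rule has_derivative_eq_rhs)
      (simp add: fun_eq_iff matrix_vector_mult_add_rdistrib matrix_vector_mul_assoc
        matrix_vector_mult_scaleR scaleR_matrix_vector_assoc[symmetric])
qed

lemma jacobian_g:
  assumes "(x, \<epsilon>) \<in> WX"
  shows "jacobian (g \<epsilon>) (at x) = \<epsilon> *\<^sub>R (injL ** J1 (x, \<epsilon>)) + injR ** J2 (x, \<epsilon>)"
  unfolding jacobian_def frechet_derivative_at[OF g_has_derivative[OF assms], symmetric]
  by (rule matrix_of_matrix_vector_mul)

lemma Ck_J1: "Ck_open k WX J1" and Ck_J2: "Ck_open k WX J2"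
proof -
  have d1: "Ck_open k W (\<lambda>p. frechet_derivative G1 (at p) v)"
    and d2: "Ck_open k W (\<lambda>p. frechet_derivative G2 (at p) v)" for v
    using G1_Ck[of "Suc k"] G2_Ck[of "Suc k"] by (cases v; simp)+
  show "Ck_open k WX J1" unfolding J1_def[abs_def] by (intro Ck_open_matrix open_WX Ck_cc[OF d1])
  show "Ck_open k WX J2" unfolding J2_def[abs_def] by (intro Ck_open_matrix open_WX Ck_cc[OF d2])
qed

text \<open>The derivative of \<open>A\<close> in the state is the derivative in \<open>(x, \<epsilon>)\<close> in directions \<open>(v, 0)\<close>, so joint
  smoothness passes to \<open>\<Lambda>\<close>.\<close>
lemma Ck_Lambda:
  fixes A :: "real \<Rightarrow> real^('m + 'n) \<Rightarrow> real^('n + 'm)^('m + 'n)"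
    and B :: "real \<Rightarrow> real^('m + 'n) \<Rightarrow> real^('m + 'n)^('n + 'm)"
  assumes "open U" "U \<subseteq> WX" "\<And>k. Ck_open k U (\<lambda>p. A (snd p) (fst p))" "\<And>k. Ck_open k U (\<lambda>p. B (snd p) (fst p))"
  shows "Ck_open k U (\<lambda>p. csp_Lambda (g (snd p)) (A (snd p)) (B (snd p)) (fst p))"
proof -
  let ?A = "\<lambda>p. A (snd p) (fst p)" and ?B = "\<lambda>p. B (snd p) (fst p)"
  let ?J = "\<lambda>p. snd p *\<^sub>R (injL ** J1 p) + injR ** J2 p"
  let ?dA = "\<lambda>p. frechet_derivative ?A (at p) (g (snd p) (fst p), 0)"
  have eq: "?B p ** ?J p ** ?A p + - (?B p ** ?dA p) = csp_Lambda (g (snd p)) (A (snd p)) (B (snd p)) (fst p)"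
    if p: "p \<in> U" for p
  proof -
    obtain x \<epsilon> where [simp]: "p = (x, \<epsilon>)" by (cases p)
    have "(?A has_derivative frechet_derivative ?A (at (x, \<epsilon>))) (at (x, \<epsilon>))"
      using Ck_open_has_derivative[OF assms(3)[of "Suc 0"] p] by simp
    from frechet_derivative_at[OF has_derivative_partial[OF this]]
    have "frechet_derivative (A \<epsilon>) (at x) (g \<epsilon> x) = ?dA (x, \<epsilon>)" by (simp add: fun_eq_iff)
    then show ?thesis using jacobian_g[of x \<epsilon>] p assms(2) by (auto simp: csp_Lambda_def)
  qed
  have W: "Ck_open k U f" if "Ck_open k WX f" for f :: "(real^('m + 'n)) \<times> real \<Rightarrow> 'c::euclidean_space"
    using Ck_open_subset[OF that assms(2)] .
  have J: "Ck_open k U ?J"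
    by (intro Ck_open_add assms(1) Ck_open_bilinear[OF bounded_bilinear_scaleR assms(1)]
        Ck_open_bounded_linear bounded_linear_snd Ck_open_bilinear[OF bounded_bilinear_matrix_mult assms(1)]
        Ck_open_const W Ck_J1 Ck_J2)
  have dA: "Ck_open k U ?dA"
    by (intro Ck_open_derivative_apply assms(1,3) Ck_open_Pair Ck_open_const W Ck_field)
  have "Ck_open k U (\<lambda>p. ?B p ** ?J p ** ?A p + - (?B p ** ?dA p))"
    by (intro Ck_open_add assms(1) Ck_open_bilinear[OF bounded_bilinear_matrix_mult assms(1)] J dA assms(3,4)
        Ck_open_linear_compose[OF bounded_linear_minus[OF bounded_linear_ident] assms(1)])
  then show ?thesis by (rule Ck_open_cong[OF assms(1), rotated]) (rule eq)
qed

abbreviation \<Lambda> :: "real^('n + 'm)^('m + 'n) \<Rightarrow> nat \<Rightarrow> (real^('m + 'n)) \<times> real \<Rightarrow> real^('n + 'm)^('n + 'm)" where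
  "\<Lambda> A0 q p \<equiv> csp_Lambda (g (snd p)) (csp_A g A0 q (snd p)) (csp_B g A0 q (snd p)) (fst p)"

definition csp_smooth :: "real^('n + 'm)^('m + 'n) \<Rightarrow> nat \<Rightarrow> ((real^('m + 'n)) \<times> real) set \<Rightarrow> bool" where
  "csp_smooth A0 q U \<longleftrightarrow> open U \<and> U \<subseteq> WX \<and> (\<forall>k. Ck_open k U (\<lambda>p. csp_A g A0 q (snd p) (fst p)))
     \<and> (\<forall>k. Ck_open k U (\<lambda>p. csp_B g A0 q (snd p) (fst p)))"

lemma csp_smooth_0: "csp_smooth A0 0 WX"
  by (simp add: csp_smooth_def open_WX)

lemma csp_smooth_Lambda: "csp_smooth A0 q U \<Longrightarrow> Ck_open k U (\<Lambda> A0 q)"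
  unfolding csp_smooth_def by (intro Ck_Lambda) auto

text \<open>Where \<open>\<Lambda>\<^sup>1\<^sup>1\<close> is singular \<open>matrix_inv\<close> has no useful value, so each refinement may shrink the
  domain; the open set of invertible matrices keeps it a neighbourhood of \<open>p0\<close>.\<close>
lemma csp_smooth_Suc:
  assumes "csp_smooth A0 q U" "p0 \<in> U" "invertible (block11 (\<Lambda> A0 q p0))"
  obtains V where "csp_smooth A0 (Suc q) V" "p0 \<in> V"
proof -
  have U: "open U" "U \<subseteq> WX" using assms(1) by (auto simp: csp_smooth_def)
  let ?M = "\<lambda>p. block11 (\<Lambda> A0 q p)"
  have bl: "Ck_open k X (\<lambda>p. Y ** f p ** Z)" if "open X" "Ck_open k X f"
    for k X and Y :: "real^'b^'a" and f :: "(real^('m + 'n)) \<times> real \<Rightarrow> real^'c^'b" and Z :: "real^'d^'c"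
    by (intro Ck_open_bilinear[OF bounded_bilinear_matrix_mult that(1)] Ck_open_const that)
  have L: "Ck_open k U (\<Lambda> A0 q)" for k by (rule csp_smooth_Lambda[OF assms(1)])
  have M: "Ck_open k U ?M" for k unfolding block_pr by (rule bl[OF U(1) L])
  define V where "V = U \<inter> ?M -` {M. invertible M}"
  have oV: "open V" unfolding V_def
    by (rule continuous_open_preimage[OF Ck_open_continuous_on[OF M] U(1) open_invertible])
  have VU: "V \<subseteq> U" by (auto simp: V_def)
  have LV: "Ck_open k V (\<Lambda> A0 q)" for k by (rule Ck_open_subset[OF L VU])
  have inv: "Ck_open k V (\<lambda>p. matrix_inv (?M p))" for k
    by (rule Ck_open_compose[OF oV Ck_open_matrix_inv Ck_open_subset[OF M VU]]) (auto simp: V_def)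
  have mul: "Ck_open k V (\<lambda>p. f p ** h p)" if "Ck_open k V f" "Ck_open k V h"
    for k and f :: "(real^('m + 'n)) \<times> real \<Rightarrow> real^'b^'a" and h :: "(real^('m + 'n)) \<times> real \<Rightarrow> real^'c^'b"
    by (rule Ck_open_bilinear[OF bounded_bilinear_matrix_mult oV that])
  have 1: "Ck_open k V (\<lambda>p. csp_U (\<Lambda> A0 q p))" for k
    unfolding csp_U_inj by (intro bl oV mul inv) (simp add: block_pr bl oV LV)
  have 2: "Ck_open k V (\<lambda>p. csp_L (\<Lambda> A0 q p))" for k
    unfolding csp_L_inj by (intro bl oV mul inv) (simp add: block_pr bl oV LV)
  have neg: "Ck_open k V (\<lambda>p. X - f p)" if "Ck_open k V f" for k X and f :: "(real^('m + 'n)) \<times> real \<Rightarrow> 'c::euclidean_space"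
    using Ck_open_add[OF oV Ck_open_const Ck_open_linear_compose[OF bounded_linear_minus[OF bounded_linear_ident] oV that], of X] by simp
  have AB: "Ck_open k V (\<lambda>p. csp_A g A0 q (snd p) (fst p))" "Ck_open k V (\<lambda>p. csp_B g A0 q (snd p) (fst p))" for k
    by (rule Ck_open_subset[OF _ VU]; use assms(1) in \<open>simp add: csp_smooth_def\<close>)+
  have "csp_smooth A0 (Suc q) V"
    unfolding csp_smooth_def csp_A.simps csp_B.simps Let_def
    by (intro conjI allI oV mul AB neg 1 2 Ck_open_add Ck_open_const) (use VU U in auto)
  moreover have "p0 \<in> V" using assms(2,3) by (simp add: V_def)
  ultimately show thesis using that by blast
qed

lemma csp_inverse:
  assumes "A0 ** matrix_inv A0 = mat 1" "matrix_inv A0 ** A0 = mat 1"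
  shows "csp_A g A0 q \<epsilon> x ** csp_B g A0 q \<epsilon> x = mat 1 \<and> csp_B g A0 q \<epsilon> x ** csp_A g A0 q \<epsilon> x = mat 1"
proof (induction q)
  case 0
  then show ?case using assms by simp
next
  case (Suc q)
  then show ?case unfolding csp_A.simps csp_B.simps Let_def by (auto intro!: csp_step_inverse)
qed

end

text \<open>The zero block of \<open>A0\<close> makes its first columns vertical. Hence the lower rows of the inverse annihilate
  the fast directions, which is the start of the induction on the lower residual.\<close>
lemma invertible_csp_start:
  fixes A12 :: "real^'m^'m" and A21 :: "real^'n^'n" and A22 :: "real^'m^'n"
  assumes "invertible A12" "invertible A21" and A0: "A0 = block_mat 0 A12 A21 A22"
  shows "A0 ** matrix_inv A0 = mat 1" "matrix_inv A0 ** A0 = mat 1"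
    and "prR ** matrix_inv A0 ** injR = (0 :: real^'n^'m)"
proof -
  let ?a = "matrix_inv A12" and ?b = "matrix_inv A21"
  let ?B = "block_mat (- (?b ** A22 ** ?a)) ?b ?a 0 :: real^('m + 'n)^('n + 'm)"
  note i = matrix_inv_mult[OF assms(1)] matrix_inv_mult[OF assms(2)]
  have i': "?a ** (A12 ** X) = X" "A12 ** (?a ** X) = X" "?b ** (A21 ** Y) = Y" "A21 ** (?b ** Y) = Y" for X Y
    unfolding matrix_mul_assoc i by simp_all
  have "A0 ** ?B = mat 1"
    unfolding A0 block_mat_inj inj_pr[symmetric] by (simp add: mat_ring i i')
  moreover have "?B ** A0 = mat 1"
    unfolding A0 block_mat_inj inj_pr[symmetric] by (simp add: mat_ring i i')
  ultimately have inv: "invertible A0" unfolding invertible_def by blast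
  note m = matrix_inv_mult[OF inv]
  show "A0 ** matrix_inv A0 = mat 1" "matrix_inv A0 ** A0 = mat 1" by (rule m)+
  have "injR ** A21 = A0 ** injL" by (simp add: A0 block_mat_inj mat_ring)
  then have "matrix_inv A0 ** (injR ** A21) = injL" by (simp add: matrix_mul_assoc m)
  then have "prR ** (matrix_inv A0 ** (injR ** A21)) ** ?b = (0 :: real^'n^'m)" by simp
  then show "prR ** matrix_inv A0 ** injR = (0 :: real^'n^'m)"
    by (simp add: matrix_mul_assoc[symmetric] i)
qed

context corner
begin

lemma corner_smooth_compose:
  assumes u: "corner_smooth u" and "open V" "u (y0, 0) \<in> V" "\<And>k. Ck_open k V G"
  shows "corner_smooth (\<lambda>s. G (u s))"
  unfolding corner_smooth_def
proof
  fix k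
  obtain U f' where U: "open U" "(y0, 0) \<in> U" "Ck_open k U f'" "\<And>s. s \<in> U \<Longrightarrow> s \<in> K \<times> {0..} \<Longrightarrow> f' s = u s"
    using corner_smoothE[OF u, of k] by metis
  have o: "open (U \<inter> f' -` V)"
    by (rule continuous_open_preimage[OF Ck_open_continuous_on[OF U(3)] U(1) assms(2)])
  have "Ck_open k (U \<inter> f' -` V) (\<lambda>s. G (f' s))"
    by (rule Ck_open_compose[OF o assms(4) Ck_open_subset[OF U(3)]]) auto
  then show "\<exists>U f'. open U \<and> (y0, 0) \<in> U \<and> Ck_open k U f' \<and> (\<forall>s\<in>U \<inter> K \<times> {0..}. f' s = G (u s))"
    using o U assms(3) y0 by (intro exI[of _ "U \<inter> f' -` V"] exI[of _ "\<lambda>s. G (f' s)"]) auto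
qed

lemma corner_smooth_linear:
  assumes "corner_smooth u" "bounded_linear L"
  shows "corner_smooth (\<lambda>s. L (u s))"
  by (rule corner_smooth_compose[OF assms(1) open_UNIV]) (auto intro: Ck_open_bounded_linear assms(2))

lemma corner_smooth_ident: "corner_smooth (\<lambda>s. s)"
  unfolding corner_smooth_def
  by (intro allI exI[of _ UNIV] exI[of _ "\<lambda>s. s"]) (auto intro: Ck_open_bounded_linear bounded_linear_ident)

lemma corner_smooth_Pair:
  assumes "corner_smooth u" "corner_smooth v"
  shows "corner_smooth (\<lambda>s. (u s, v s))"
  unfolding corner_smooth_def
proof
  fix k
  obtain U f' where U: "open U" "(y0, 0) \<in> U" "Ck_open k U f'" "\<And>s. s \<in> U \<Longrightarrow> s \<in> K \<times> {0..} \<Longrightarrow> f' s = u s"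
    using corner_smoothE[OF assms(1), of k] by metis
  obtain V g' where V: "open V" "(y0, 0) \<in> V" "Ck_open k V g'" "\<And>s. s \<in> V \<Longrightarrow> s \<in> K \<times> {0..} \<Longrightarrow> g' s = v s"
    using corner_smoothE[OF assms(2), of k] by metis
  have o: "open (U \<inter> V)" using U V by auto
  have "Ck_open k (U \<inter> V) (\<lambda>s. (f' s, g' s))"
    by (rule Ck_open_Pair[OF o Ck_open_subset[OF U(3)] Ck_open_subset[OF V(3)]]) auto
  then show "\<exists>U f'. open U \<and> (y0, 0) \<in> U \<and> Ck_open k U f' \<and> (\<forall>s\<in>U \<inter> K \<times> {0..}. f' s = (u s, v s))"
    using o U V by (intro exI[of _ "U \<inter> V"] exI[of _ "\<lambda>s. (f' s, g' s)"]) auto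
qed

lemma corner_smooth_fst: "corner_smooth fst" and corner_smooth_snd: "corner_smooth snd"
  using corner_smooth_linear[OF corner_smooth_ident bounded_linear_fst]
    corner_smooth_linear[OF corner_smooth_ident bounded_linear_snd] by simp_all

end

lemma has_derivative_matrix_apply:
  fixes M :: "'a::real_normed_vector \<Rightarrow> real^'n^'m"
  assumes "(M has_derivative M') (at s)"
  shows "((\<lambda>s. M s *v w) has_derivative (\<lambda>a. M' a *v w)) (at s)"
  by (rule bounded_linear.has_derivative[OF bounded_bilinear.bounded_linear_left[OF bounded_bilinear_matrix_vector] assms])

lemma has_derivative_derivative_apply:
  fixes f :: "'a::euclidean_space \<Rightarrow> 'b::euclidean_space" and P :: "'c::euclidean_space \<Rightarrow> 'a"
  assumes U: "open U" "Ck_open (Suc (Suc 0)) U f" "P z \<in> U"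
    and P: "(P has_derivative P') (at z)" and c: "(c has_derivative c') (at z)"
  shows "((\<lambda>z. frechet_derivative f (at (P z)) (c z)) has_derivative
    (\<lambda>v. frechet_derivative (\<lambda>x. frechet_derivative f (at x) (c z)) (at (P z)) (P' v)
       + frechet_derivative f (at (P z)) (c' v))) (at z)"
proof -
  let ?D = "\<lambda>x. frechet_derivative f (at x)"
  have lin: "linear (?D x)" if "x \<in> U" for x
    using has_derivative_linear[OF Ck_open_has_derivative[OF U(2) that]] .
  have Db: "((\<lambda>x. ?D x b) has_derivative frechet_derivative (\<lambda>x. ?D x b) (at (P z))) (at (P z))" for b
    by (rule Ck_open_has_derivative[of 0 U]) (use U in auto)
  have comp: "((\<lambda>z. ?D (P z) b) has_derivative (\<lambda>v. frechet_derivative (\<lambda>x. ?D x b) (at (P z)) (P' v))) (at z)" for b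
    using has_derivative_compose[OF P Db] .
  have inner: "((\<lambda>z. c z \<bullet> b) has_derivative (\<lambda>v. c' v \<bullet> b)) (at z)" for b
    by (rule bounded_linear.has_derivative[OF bounded_linear_inner_left c])
  have s: "((\<lambda>z. \<Sum>b\<in>Basis. (c z \<bullet> b) *\<^sub>R ?D (P z) b) has_derivative
      (\<lambda>v. \<Sum>b\<in>Basis. (c z \<bullet> b) *\<^sub>R frechet_derivative (\<lambda>x. ?D x b) (at (P z)) (P' v) + (c' v \<bullet> b) *\<^sub>R ?D (P z) b)) (at z)"
    by (intro has_derivative_sum has_derivative_scaleR inner comp)
  have ev: "\<forall>\<^sub>F z in nhds z. P z \<in> U"
    using has_derivative_continuous[OF P] U(1,3)
    by (simp add: continuous_at_open eventually_nhds)
  have Dc: "frechet_derivative (\<lambda>x. ?D x (c z)) (at (P z)) v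
      = (\<Sum>b\<in>Basis. (c z \<bullet> b) *\<^sub>R frechet_derivative (\<lambda>x. ?D x b) (at (P z)) v)" for v
  proof -
    have "((\<lambda>x. \<Sum>b\<in>Basis. (c z \<bullet> b) *\<^sub>R ?D x b) has_derivative
        (\<lambda>v. \<Sum>b\<in>Basis. (c z \<bullet> b) *\<^sub>R frechet_derivative (\<lambda>x. ?D x b) (at (P z)) v)) (at (P z))"
      by (intro has_derivative_sum has_derivative_scaleR_right Db)
    then have "((\<lambda>x. ?D x (c z)) has_derivative
        (\<lambda>v. \<Sum>b\<in>Basis. (c z \<bullet> b) *\<^sub>R frechet_derivative (\<lambda>x. ?D x b) (at (P z)) v)) (at (P z))"
      by (rule has_derivative_transform_within_open[OF _ U(1,3)]) (rule linear_expand_Basis[OF lin, symmetric])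
    from frechet_derivative_at[OF this] show ?thesis by (simp add: fun_eq_iff)
  qed
  obtain V where V: "open V" "z \<in> V" "\<And>x. x \<in> V \<Longrightarrow> P x \<in> U"
    using ev unfolding eventually_nhds by auto
  have "((\<lambda>z. ?D (P z) (c z)) has_derivative
      (\<lambda>v. \<Sum>b\<in>Basis. (c z \<bullet> b) *\<^sub>R frechet_derivative (\<lambda>x. ?D x b) (at (P z)) (P' v) + (c' v \<bullet> b) *\<^sub>R ?D (P z) b)) (at z)"
    by (rule has_derivative_transform_within_open[OF s V(1,2)])
      (rule linear_expand_Basis[OF lin[OF V(3)], symmetric])
  then show ?thesis
    by (rule has_derivative_eq_rhs)
      (simp add: Dc sum.distrib linear_expand_Basis[OF lin[OF U(3)], symmetric])
qed

lemma has_vector_derivative_chain_within: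
  assumes "(u has_vector_derivative u') (at t within X)" "(f has_derivative f') (at (u t))"
  shows "((\<lambda>t. f (u t)) has_vector_derivative f' u') (at t within X)"
proof -
  have "((\<lambda>t. f (u t)) has_derivative (\<lambda>h. f' (h *\<^sub>R u'))) (at t within X)"
    using has_derivative_compose[OF assms(1)[unfolded has_vector_derivative_def] assms(2)] .
  moreover have "f' (h *\<^sub>R u') = h *\<^sub>R f' u'" for h
    by (rule linear_scale[OF has_derivative_linear[OF assms(2)]])
  ultimately show ?thesis by (simp add: has_vector_derivative_def)
qed

lemma solution_on_subset: "solution_on f I x \<Longrightarrow> I' \<subseteq> I \<Longrightarrow> solution_on f I' x"
  unfolding solution_on_def using has_vector_derivative_within_subset by blast

text \<open>The linear map \<open>L\<close> is a coordinate projection in the applications.\<close>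
lemma solution_stays:
  fixes f :: "'a::euclidean_space \<Rightarrow> 'a"
  assumes "solution_on f {0..T} x" "T > 0" "open O'" "L (x 0) \<in> O'" "bounded_linear L"
  obtains T' where "0 < T'" "T' \<le> T" "\<And>t. t \<in> {0..T'} \<Longrightarrow> L (x t) \<in> O'"
proof -
  have c: "continuous_on {0..T} (\<lambda>t. L (x t))"
    using assms(1) unfolding solution_on_def
    by (intro bounded_linear.continuous_on[OF assms(5)])
      (auto simp: continuous_on_eq_continuous_within intro: has_vector_derivative_continuous)
  then have "((\<lambda>t. L (x t)) \<longlongrightarrow> L (x 0)) (at 0 within {0..T})"
    using assms(2) unfolding continuous_on_def by auto
  then have "\<forall>\<^sub>F t in at_right 0. L (x t) \<in> O'"
    using topological_tendstoD[OF _ assms(3,4)] at_within_Icc_at_right[OF assms(2)] by metis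
  then obtain e where e: "e > 0" "\<And>t. 0 < t \<Longrightarrow> t < e \<Longrightarrow> L (x t) \<in> O'"
    by (rule eventually_at_right_0) blast
  show thesis
    by (rule that[of "min T (e / 2)"]) (use e assms(2,4) in \<open>auto simp: less_eq_real_def\<close>)
qed

section \<open>Infinitesimal invariance of slow manifold and fast fibers\<close>

text \<open>The data of Fenichel's theorem near a base point \<open>y0\<close>: the slow manifold \<open>h\<close>, and the fibers as
  graphs of \<open>z \<mapsto> Y y z \<epsilon>\<close> over \<open>N \<epsilon> y\<close>. In the last assumption \<open>J2 p ** injR\<close> is \<open>D\<^sub>z g\<^sub>2\<close>.\<close>
locale fenichel = smooth_field G1 G2 W + corner K y0
  for G1 :: "(real^'m) \<times> (real^'n) \<times> real \<Rightarrow> real^'m"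
    and G2 :: "(real^'m) \<times> (real^'n) \<times> real \<Rightarrow> real^'n"
    and W and K :: "(real^'m) set" and y0 +
  fixes \<epsilon>0 :: real and h0 :: "real^'m \<Rightarrow> real^'n" and h :: "real \<Rightarrow> real^'m \<Rightarrow> real^'n"
    and Y :: "real^'m \<Rightarrow> real^'n \<Rightarrow> real \<Rightarrow> real^'m" and N :: "real \<Rightarrow> real^'m \<Rightarrow> (real^'n) set"
    and \<delta> \<Delta> :: real and Fib :: "real \<Rightarrow> real^('m + 'n) \<Rightarrow> (real^('m + 'n)) set"
  assumes e0: "\<epsilon>0 > 0" and W_sup: "UNIV \<times> UNIV \<times> {0..<\<epsilon>0} \<subseteq> W"
    and h0_cont: "continuous_on K h0"
    and h_zero: "\<And>y. y \<in> K \<Longrightarrow> h 0 y = h0 y"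
    and h_Ck: "\<And>r. \<exists>e>0. Ck_on r (K \<times> {0..<e}) (\<lambda>(y, \<epsilon>). h \<epsilon> y)"
    and slow_inv: "\<forall>\<^sub>F \<epsilon> in at_right 0. locally_invariant_graph (g \<epsilon>) K (h \<epsilon>)"
    and delta: "\<delta> > 0"
    and Y_Ck: "\<And>r. \<exists>e>0. Ck_on r {(y, z, \<epsilon>). y \<in> K \<and> z \<in> cball (h0 y) \<Delta> \<and> \<epsilon> \<in> {0..<e}} (\<lambda>(y, z, \<epsilon>). Y y z \<epsilon>)"
    and Y_zero: "\<And>y z. y \<in> K \<Longrightarrow> z \<in> cball (h0 y) \<Delta> \<Longrightarrow> Y y z 0 = y"
    and fibers: "\<forall>\<^sub>F \<epsilon> in at_right 0. \<forall>y\<in>K.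
           open (N \<epsilon> y) \<and> ball (h0 y) \<delta> \<subseteq> N \<epsilon> y \<and> N \<epsilon> y \<subseteq> cball (h0 y) \<Delta> \<and>
           Y y (h \<epsilon> y) \<epsilon> = y \<and>
           Fib \<epsilon> (join y (h \<epsilon> y)) = (\<lambda>z. join (Y y z \<epsilon>) z) ` N \<epsilon> y"
    and fib_inv: "\<forall>\<^sub>F \<epsilon> in at_right 0. \<forall>T\<ge>0. \<forall>x p.
           solution_on (g \<epsilon>) {0..T} x \<and> solution_on (g \<epsilon>) {0..T} p \<and>
           (\<forall>t\<in>{0..T}. p t \<in> graph_over K (h \<epsilon>)) \<and> x 0 \<in> Fib \<epsilon> (p 0)
           \<longrightarrow> (\<forall>t\<in>{0..T}. x t \<in> Fib \<epsilon> (p t))"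
    and hyperbolic: "invertible (J2 (join y0 (h0 y0), 0) ** injR)"
begin

text \<open>A pair \<open>s = (y, \<epsilon>)\<close> stands for the point of the slow manifold over \<open>y\<close>. As an argument of the
  components of the field this point is \<open>tt s\<close>, as a state with parameter it is \<open>pp s\<close>.\<close>
definition hh :: "(real^'m) \<times> real \<Rightarrow> real^'n" where "hh s = h (snd s) (fst s)"
definition tt :: "(real^'m) \<times> real \<Rightarrow> (real^'m) \<times> (real^'n) \<times> real" where "tt s = (fst s, hh s, snd s)"
definition pp :: "(real^'m) \<times> real \<Rightarrow> (real^('m + 'n)) \<times> real" where "pp s = (join (fst s) (hh s), snd s)"
definition YY :: "(real^'m) \<times> (real^'n) \<times> real \<Rightarrow> real^'m" where "YY t = Y (fst t) (fst (snd t)) (snd (snd t))"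
text \<open>This is the slope of the fiber at its base point. The derivative is taken in \<open>z\<close> alone, since it
  is also needed over boundary points of \<open>K\<close>.\<close>
definition \<tau> :: "(real^'m) \<times> real \<Rightarrow> real^'n^'m" where
  "\<tau> s = jacobian (\<lambda>z. Y (fst s) z (snd s)) (at (hh s))"
definition HH :: "(real^'m) \<times> real \<Rightarrow> real^'m^'n" where
  "HH s = matrix (\<lambda>v. frechet_derivative hh (at s) (v, 0))"

lemma cc_pp: "cc (pp s) = tt s" by (simp add: cc_def pp_def tt_def)

lemma pp_in_WX: "s \<in> UNIV \<times> {0..<\<epsilon>0} \<Longrightarrow> pp s \<in> WX"
  using W_sup by (auto simp: WX_def cc_pp tt_def)

lemma hh_smooth: "corner_smooth hh"
  unfolding corner_smooth_def
proof
  fix k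
  obtain e U f' where e: "e > 0" "open U" "K \<times> {0..<e} \<subseteq> U" "Ck_open k U f'" "\<forall>s\<in>K \<times> {0..<e}. f' s = (\<lambda>(y, \<epsilon>). h \<epsilon> y) s"
    using h_Ck[of k] unfolding Ck_on_def by metis
  have o: "open (U \<inter> UNIV \<times> {..<e})" using e(2) by (intro open_Int open_Times) auto
  show "\<exists>U f'. open U \<and> (y0, 0) \<in> U \<and> Ck_open k U f' \<and> (\<forall>s\<in>U \<inter> K \<times> {0..}. f' s = hh s)"
    using o e y0 by (intro exI[of _ "U \<inter> UNIV \<times> {..<e}"] exI[of _ f'])
      (auto simp: hh_def intro: Ck_open_subset)
qed

lemma tt_smooth: "corner_smooth tt"
  unfolding tt_def[abs_def]
  by (intro corner_smooth_Pair corner_smooth_fst corner_smooth_snd hh_smooth)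

lemma join_bounded_linear: "bounded_linear (\<lambda>t :: (real^'m) \<times> (real^'n) \<times> real. (join (fst t) (fst (snd t)), snd (snd t)))"
  unfolding join_inj
  by (intro bounded_linear_Pair bounded_linear_add
      bounded_linear_compose[OF matrix_vector_mul_bounded_linear] bounded_linear_fst
      bounded_linear_compose[OF bounded_linear_fst bounded_linear_snd]
      bounded_linear_compose[OF bounded_linear_snd bounded_linear_snd])

lemma pp_smooth: "corner_smooth pp"
  using corner_smooth_linear[OF tt_smooth join_bounded_linear] by (simp add: pp_def[abs_def] tt_def)

lemma hh_corner: "hh (y0, 0) = h0 y0" using h_zero y0 by (simp add: hh_def)

lemma delta_le: "\<delta> \<le> \<Delta>"
proof -
  obtain \<epsilon> where "ball (h0 y0) \<delta> \<subseteq> N \<epsilon> y0" "N \<epsilon> y0 \<subseteq> cball (h0 y0) \<Delta>"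
    using eventually_happens[OF fibers] y0 by auto
  then have "ball (h0 y0) \<delta> \<subseteq> cball (h0 y0) \<Delta>" by simp
  then show ?thesis using delta by (auto simp: ball_subset_cball_iff)
qed

lemma hh_near: "\<exists>V. open V \<and> (y0, 0) \<in> V \<and> (\<forall>s\<in>V \<inter> K \<times> {0..}. hh s \<in> ball (h0 (fst s)) \<delta>)"
proof -
  obtain U where U: "open U" "(y0, 0) \<in> U" "continuous_on (U \<inter> K \<times> {0..}) hh"
    using corner_smooth_continuous[OF hh_smooth] .
  have c: "continuous_on (U \<inter> K \<times> {0..}) (\<lambda>s. dist (h0 (fst s)) (hh s))"
    by (intro continuous_on_dist U(3) continuous_on_compose2[OF h0_cont] continuous_on_fst continuous_on_id) auto
  obtain B where B: "open B" "B \<inter> (U \<inter> K \<times> {0..}) = (\<lambda>s. dist (h0 (fst s)) (hh s)) -` {..<\<delta>} \<inter> (U \<inter> K \<times> {0..})"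
    using c[unfolded continuous_on_open_invariant, rule_format, OF open_lessThan[of \<delta>]] by blast
  have iff: "s \<in> B \<longleftrightarrow> hh s \<in> ball (h0 (fst s)) \<delta>" if "s \<in> U \<inter> K \<times> {0..}" for s
    using that eqset_imp_iff[OF B(2), of s] by simp
  have "(y0, 0) \<in> B" using iff[of "(y0, 0)"] U(2) y0 delta by (simp add: hh_corner)
  moreover have "\<forall>s\<in>(B \<inter> U) \<inter> K \<times> {0..}. hh s \<in> ball (h0 (fst s)) \<delta>" using iff by blast
  ultimately show ?thesis
    using B(1) U(1,2) by (intro exI[of _ "B \<inter> U"] conjI) auto
qed

lemma Y_derivative:
  obtains U M e where "open U" "\<And>p. p \<in> K \<times> UNIV \<times> {0..<e} \<Longrightarrow> fst (snd p) \<in> cball (h0 (fst p)) \<Delta> \<Longrightarrow> p \<in> U"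
    "e > 0" "Ck_open k U M"
    "\<And>y z \<epsilon>. y \<in> K \<Longrightarrow> \<epsilon> \<in> {0..<e} \<Longrightarrow> z \<in> ball (h0 y) \<Delta> \<Longrightarrow> ((\<lambda>z. Y y z \<epsilon>) has_derivative (\<lambda>v. M (y, z, \<epsilon>) *v v)) (at z)"
proof -
  obtain e where e0: "e > 0" "Ck_on (Suc k) {(y, z, \<epsilon>). y \<in> K \<and> z \<in> cball (h0 y) \<Delta> \<and> \<epsilon> \<in> {0..<e}} (\<lambda>(y, z, \<epsilon>). Y y z \<epsilon>)"
    using Y_Ck by blast
  obtain U f' where e: "open U"
    "{(y, z, \<epsilon>). y \<in> K \<and> z \<in> cball (h0 y) \<Delta> \<and> \<epsilon> \<in> {0..<e}} \<subseteq> U" "Ck_open (Suc k) U f'"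
    "\<forall>s\<in>{(y, z, \<epsilon>). y \<in> K \<and> z \<in> cball (h0 y) \<Delta> \<and> \<epsilon> \<in> {0..<e}}. f' s = (\<lambda>(y, z, \<epsilon>). Y y z \<epsilon>) s"
    using e0(2) unfolding Ck_on_def by blast
  note e = e0(1) e
  define M where "M = (\<lambda>p. matrix (\<lambda>v. frechet_derivative f' (at p) (0, v, 0)))"
  have "Ck_open k U (\<lambda>p. frechet_derivative f' (at p) v)" for v using e(4) by (cases v) auto
  then have Mk: "Ck_open k U M" unfolding M_def by (intro Ck_open_matrix e(2))
  have d: "((\<lambda>z. Y y z \<epsilon>) has_derivative (\<lambda>v. M (y, z, \<epsilon>) *v v)) (at z)"
    if "y \<in> K" "\<epsilon> \<in> {0..<e}" "z \<in> ball (h0 y) \<Delta>" for y z \<epsilon>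
  proof -
    have "(y, z, \<epsilon>) \<in> U" using e(3) that by auto
    note f' = Ck_open_has_derivative[OF e(4) this]
    have "((\<lambda>z. (y, z, \<epsilon>)) has_derivative (\<lambda>v. (0, v, 0))) (at z)"
      by (intro has_derivative_Pair has_derivative_const has_derivative_ident)
    note c = has_derivative_compose[OF this f']
    then have "((\<lambda>z. Y y z \<epsilon>) has_derivative (\<lambda>v. frechet_derivative f' (at (y, z, \<epsilon>)) (0, v, 0))) (at z)"
      by (rule has_derivative_transform_within_open[OF _ open_ball that(3)]) (use that e(5) in auto)
    then show ?thesis unfolding M_def by (simp add: matrix_apply[OF has_derivative_linear[OF c]])
  qed
  show thesis by (rule that[OF e(2) _ e(1) Mk d]) (use e(3) in auto)
qed

lemma jacobian_unique:
  fixes f :: "real^'b \<Rightarrow> real^'a"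
  assumes "(f has_derivative (\<lambda>v. M *v v)) (at z)"
  shows "jacobian f (at z) = M"
  unfolding jacobian_def frechet_derivative_at[OF assms, symmetric] by (rule matrix_of_matrix_vector_mul)

lemma tau_smooth: "corner_smooth \<tau>"
  unfolding corner_smooth_def
proof
  fix k
  obtain U M e where U: "open U" "\<And>p. p \<in> K \<times> UNIV \<times> {0..<e} \<Longrightarrow> fst (snd p) \<in> cball (h0 (fst p)) \<Delta> \<Longrightarrow> p \<in> U"
    "e > 0" "Ck_open k U M"
    "\<And>y z \<epsilon>. y \<in> K \<Longrightarrow> \<epsilon> \<in> {0..<e} \<Longrightarrow> z \<in> ball (h0 y) \<Delta> \<Longrightarrow> ((\<lambda>z. Y y z \<epsilon>) has_derivative (\<lambda>v. M (y, z, \<epsilon>) *v v)) (at z)"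
    by (rule Y_derivative[of k]) blast
  obtain V f' where V: "open V" "(y0, 0) \<in> V" "Ck_open k V f'" "\<And>s. s \<in> V \<Longrightarrow> s \<in> K \<times> {0..} \<Longrightarrow> f' s = tt s"
    using corner_smoothE[OF tt_smooth, of k] by metis
  obtain B where B: "open B" "(y0, 0) \<in> B" "\<forall>s\<in>B \<inter> K \<times> {0..}. hh s \<in> ball (h0 (fst s)) \<delta>"
    using hh_near by blast
  let ?X = "(V \<inter> f' -` U) \<inter> B \<inter> UNIV \<times> {..<e}"
  have o: "open ?X"
    using B(1) by (intro open_Int continuous_open_preimage[OF Ck_open_continuous_on[OF V(3)] V(1) U(1)] open_Times) auto
  have in0: "(y0, 0) \<in> ?X"
  proof -
    have "tt (y0, 0) \<in> U" using U(2)[of "tt (y0, 0)"] U(3) y0 delta delta_le by (auto simp: tt_def hh_corner)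
    then show ?thesis using V B U(3) y0 by auto
  qed
  have "Ck_open k ?X (\<lambda>s. M (f' s))"
    by (rule Ck_open_compose[OF o U(4) Ck_open_subset[OF V(3)]]) auto
  moreover have "M (f' s) = \<tau> s" if "s \<in> ?X" "s \<in> K \<times> {0..}" for s
  proof -
    have "f' s = tt s" "hh s \<in> ball (h0 (fst s)) \<delta>" using that V(4) B(3) by auto
    moreover then have "((\<lambda>z. Y (fst s) z (snd s)) has_derivative (\<lambda>v. M (fst s, hh s, snd s) *v v)) (at (hh s))"
      using that delta_le by (intro U(5)) auto
    from jacobian_unique[OF this] have "\<tau> s = M (tt s)" by (simp add: \<tau>_def tt_def)
    ultimately show ?thesis by simp
  qed
  ultimately show "\<exists>U f'. open U \<and> (y0, 0) \<in> U \<and> Ck_open k U f' \<and> (\<forall>s\<in>U \<inter> K \<times> {0..}. f' s = \<tau> s)"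
    using o in0 by (intro exI[of _ ?X] exI[of _ "\<lambda>s. M (f' s)"]) auto
qed

text \<open>The unperturbed fibers are vertical.\<close>
lemma tau_corner: "\<tau> (y0, 0) = 0"
proof -
  have in_ball: "h0 y0 \<in> ball (h0 y0) \<Delta>" using delta delta_le by auto
  have "((\<lambda>z. y0) has_derivative (\<lambda>v. (0 :: real^'n^'m) *v v)) (at (h0 y0))" by simp
  then have "((\<lambda>z. Y y0 z 0) has_derivative (\<lambda>v. (0 :: real^'n^'m) *v v)) (at (h0 y0))"
    by (rule has_derivative_transform_within_open[OF _ open_ball in_ball]) (use Y_zero y0 in auto)
  from jacobian_unique[OF this] show ?thesis by (simp add: \<tau>_def hh_corner)
qed

lemma Ck_g:
  assumes "0 < \<epsilon>" "\<epsilon> < \<epsilon>0"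
  shows "Ck_open k UNIV (g \<epsilon>)"
proof -
  have "Ck_open k UNIV (\<lambda>x. (x, \<epsilon>))"
    by (intro Ck_open_Pair open_UNIV Ck_open_bounded_linear bounded_linear_ident Ck_open_const)
  moreover have "range (\<lambda>x. (x, \<epsilon>)) \<subseteq> WX"
    using assms by (auto simp: WX_def cc_def intro!: subsetD[OF W_sup])
  ultimately show ?thesis using Ck_open_compose[OF open_UNIV Ck_field] by fastforce
qed

end

context fenichel
begin

text \<open>These are the bases of the two invariant bundles. They reappear as \<open>E\<close> and \<open>T\<close> of the frame locale,
  whose hypotheses are the invariance equations proved in this section.\<close>
definition EE :: "(real^'m) \<times> real \<Rightarrow> real^'n^('m + 'n)" where "EE s = injL ** \<tau> s + injR"
definition TT :: "(real^'m) \<times> real \<Rightarrow> real^'m^('m + 'n)" where "TT s = injL + injR ** HH s"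

lemma eventually_small: "\<forall>\<^sub>F s in F. 0 < snd s \<and> snd s < e" if "e > 0"
proof -
  have "\<forall>\<^sub>F s in nhds (y0, 0::real). s \<in> UNIV \<times> {..<e}"
    by (rule eventually_nhds_in_open) (use that in \<open>auto intro: open_Times\<close>)
  from eventually_F_nhds[OF this] eventually_F_S show ?thesis
    by eventually_elim (auto simp: S_def)
qed

lemma eventually_F_parameter:
  assumes "\<forall>\<^sub>F \<epsilon> in at_right 0. P \<epsilon>"
  shows "\<forall>\<^sub>F s in F. P (snd s)"
  by (rule eventually_F_uniform[of "\<lambda>_. P"]) (use assms in simp)

lemma hh_derivative:
  "\<forall>\<^sub>F s in F. (hh has_derivative frechet_derivative hh (at s)) (at s)
     \<and> (\<forall>v. HH s *v v = frechet_derivative hh (at s) (v, 0))"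
  using Jet_differentiable[OF corner_smooth_Jet[OF hh_smooth]]
proof eventually_elim
  case (elim s)
  have "linear (\<lambda>v. frechet_derivative hh (at s) (v, 0))"
    using linear_compose[OF bounded_linear.linear has_derivative_linear[OF elim], of "\<lambda>v. (v, 0)"]
      bounded_linear_Pair[OF bounded_linear_ident bounded_linear_zero] by (simp add: o_def)
  then show ?case using elim by (simp add: HH_def matrix_apply)
qed

lemma hh_partial:
  assumes "(hh has_derivative frechet_derivative hh (at (y, \<epsilon>))) (at (y, \<epsilon>))"
    "\<forall>v. HH (y, \<epsilon>) *v v = frechet_derivative hh (at (y, \<epsilon>)) (v, 0)"
  shows "((\<lambda>y. join y (hh (y, \<epsilon>))) has_derivative (\<lambda>v. TT (y, \<epsilon>) *v v)) (at y)"
proof -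
  have "((\<lambda>y. hh (y, \<epsilon>)) has_derivative (\<lambda>v. HH (y, \<epsilon>) *v v)) (at y)"
    using has_derivative_partial[OF assms(1)] assms(2) by simp
  then have "((\<lambda>y. injL *v y + injR *v hh (y, \<epsilon>)) has_derivative (\<lambda>v. injL *v v + injR *v (HH (y, \<epsilon>) *v v))) (at y)"
    by (intro has_derivative_add bounded_linear.has_derivative[OF matrix_vector_mul_bounded_linear] has_derivative_ident)
  then show ?thesis
    by (simp add: join_inj TT_def matrix_vector_mult_add_rdistrib matrix_vector_mul_assoc)
qed

text \<open>The solution through a point of the slow manifold over the interior of \<open>K\<close> keeps its slow
  component in \<open>K\<close> for a short time, and local invariance then holds it in the manifold.\<close>
lemma base_solution:
  "\<forall>\<^sub>F s in F. \<exists>T x. 0 < T \<and> x 0 = fst (pp s) \<and> solution_on (g (snd s)) {0..T} x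
     \<and> (\<forall>t\<in>{0..T}. x t \<in> graph_over K (h (snd s)))"
  using eventually_F_S eventually_small[OF e0] eventually_F_parameter[OF slow_inv]
proof eventually_elim
  case (elim s)
  have ck: "Ck_open (Suc 0) UNIV (g (snd s))" by (rule Ck_g) (use elim(2) in auto)
  obtain T x where x: "T > 0" "x 0 = fst (pp s)" "solution_on (g (snd s)) {0..T} x"
    by (rule local_solution[OF ck, of "fst (pp s)"])
  have "slow (x 0) \<in> interior K" using elim(1) x(2) by (auto simp: S_def pp_def)
  then obtain T' where T': "0 < T'" "T' \<le> T" "\<And>t. t \<in> {0..T'} \<Longrightarrow> slow (x t) \<in> interior K"
    by (rule solution_stays[OF x(3,1) open_interior _ bounded_linear_slow]) blast
  have sol: "solution_on (g (snd s)) {0..T'} x"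
    by (rule solution_on_subset[OF x(3)]) (use T' in auto)
  have "x 0 \<in> graph_over K (h (snd s))"
    using elim(1) x(2) interior_subset[of K] by (auto simp: graph_over_def pp_def hh_def S_def)
  moreover have "\<forall>t\<in>{0..T'}. slow (x t) \<in> K" using T'(3) interior_subset[of K] by blast
  ultimately have "\<forall>t\<in>{0..T'}. x t \<in> graph_over K (h (snd s))"
    using elim(3)[unfolded locally_invariant_graph_def, rule_format, of 0 T' x] sol T' interior_subset[of K] by auto
  with T'(1) x(2) sol show ?case by blast
qed

lemma graph_over_fast: "p \<in> graph_over K u \<Longrightarrow> slow p \<in> K \<and> fast p = u (slow p) \<and> p = join (slow p) (u (slow p))"
  by (auto simp: graph_over_def)

lemma slow_g: "slow (g \<epsilon> x) = \<epsilon> *\<^sub>R G1 (cc (x, \<epsilon>))" and fast_g: "fast (g \<epsilon> x) = G2 (cc (x, \<epsilon>))"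
  by (simp_all add: fs_field_def cc_def)

lemma solution_component:
  assumes "solution_on f {0..T} x" "0 < T" "bounded_linear L"
  shows "((\<lambda>t. L (x t)) has_vector_derivative L (f (x 0))) (at 0 within {0..T})"
  using has_vector_derivative_chain_within[of x "f (x 0)" 0 "{0..T}" L L] assms
    bounded_linear_imp_has_derivative[OF assms(3)] by (auto simp: solution_on_def)

text \<open>Fibers are only positively invariant, so velocities at time \<open>0\<close> are one-sided derivatives.\<close>
lemma initial_derivative_unique:
  fixes u v :: "real \<Rightarrow> 'b::real_normed_vector"
  assumes "0 < T" "(u has_vector_derivative u') (at 0 within {0..T})" "(v has_vector_derivative v') (at 0 within {0..T})"
    "\<And>t. t \<in> {0..T} \<Longrightarrow> u t = v t"
  shows "u' = v'"
proof -
  have "(v has_vector_derivative u') (at 0 within {0..T})"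
    using has_vector_derivative_transform[OF _ _ assms(2)] assms(1,4) by (metis atLeastAtMost_iff order.refl less_imp_le)
  moreover have "at (0::real) within {0..T} \<noteq> bot" using assms(1) at_within_Icc_at_right[OF assms(1)] by simp
  ultimately show ?thesis using vector_derivative_unique_within assms(3) by blast
qed

text \<open>The velocity at time \<open>0\<close> of the solution from \<open>base_solution\<close> is tangent to the graph.\<close>
lemma slow_pointwise: "\<forall>\<^sub>F s in F. G2 (tt s) = snd s *\<^sub>R (HH s *v G1 (tt s))"
  using base_solution hh_derivative
proof eventually_elim
  case (elim s)
  obtain y \<epsilon> where s: "s = (y, \<epsilon>)" by (cases s)
  obtain T x where x: "0 < T" "x 0 = fst (pp s)" "solution_on (g \<epsilon>) {0..T} x"
    "\<And>t. t \<in> {0..T} \<Longrightarrow> x t \<in> graph_over K (h \<epsilon>)" using elim(1) s by auto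
  have cc0: "cc (x 0, \<epsilon>) = tt s" using x(2) s cc_pp[of s] by (simp add: pp_def)
  have sl: "((\<lambda>t. slow (x t)) has_vector_derivative \<epsilon> *\<^sub>R G1 (tt s)) (at 0 within {0..T})"
    using solution_component[OF x(3,1) bounded_linear_slow] by (simp add: slow_g cc0)
  have fa: "((\<lambda>t. fast (x t)) has_vector_derivative G2 (tt s)) (at 0 within {0..T})"
    using solution_component[OF x(3,1) bounded_linear_fast] by (simp add: fast_g cc0)
  have pr: "((\<lambda>t. (slow (x t), \<epsilon>)) has_vector_derivative (\<epsilon> *\<^sub>R G1 (tt s), 0)) (at 0 within {0..T})"
    using sl by (intro has_vector_derivative_Pair has_vector_derivative_const)
  have "(slow (x 0), \<epsilon>) = s" using x(2) s by (simp add: pp_def)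
  then have "((\<lambda>t. hh (slow (x t), \<epsilon>)) has_vector_derivative frechet_derivative hh (at s) (\<epsilon> *\<^sub>R G1 (tt s), 0)) (at 0 within {0..T})"
    using has_vector_derivative_chain_within[OF pr, of hh "frechet_derivative hh (at s)"] elim(2) by simp
  from initial_derivative_unique[OF x(1) fa this]
  have "G2 (tt s) = frechet_derivative hh (at s) (\<epsilon> *\<^sub>R G1 (tt s), 0)"
    using graph_over_fast[OF x(4)] by (simp add: hh_def)
  also have "\<dots> = HH s *v (\<epsilon> *\<^sub>R G1 (tt s))" using elim(2) by simp
  finally show ?case by (simp add: s matrix_vector_mult_scaleR)
qed

lemma tt_derivative:
  assumes "(hh has_derivative h') (at s)"
  shows "(tt has_derivative (\<lambda>v. (fst v, h' v, snd v))) (at s)"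
  unfolding tt_def[abs_def]
  by (intro has_derivative_Pair assms has_derivative_fst has_derivative_snd has_derivative_ident)

text \<open>The \<open>y\<close>-derivative of \<open>slow_pointwise\<close>. Differentiating the slope in direction \<open>v\<close> and applying it
  to \<open>G1\<close> is, by symmetry of second derivatives, the derivative of the slope along the flow applied to
  \<open>v\<close>.\<close>
lemma slow_equation:
  "\<forall>\<^sub>F s in F. J2 (pp s) ** TT s - frechet_derivative HH (at s) (snd s *\<^sub>R G1 (tt s), 0)
     = snd s *\<^sub>R (HH s ** (J1 (pp s) ** TT s))"
  using ev_nhds[OF slow_pointwise] hh_derivative corner_smooth_Ck[OF hh_smooth, of "Suc (Suc 0)"]
    ev_nhds[OF hh_derivative] eventually_small[OF e0]
proof eventually_elim
  case (elim s)
  obtain y \<epsilon> where s: "s = (y, \<epsilon>)" by (cases s)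
  obtain V where V: "open V" "s \<in> V" "Ck_open (Suc (Suc 0)) V hh" using elim(3) by blast
  obtain V1 where V1: "open V1" "s \<in> V1" "\<And>s. s \<in> V1 \<Longrightarrow> G2 (tt s) = snd s *\<^sub>R (HH s *v G1 (tt s))"
    using elim(1) unfolding eventually_nhds by blast
  obtain V2 where V2: "open V2" "s \<in> V2" "\<And>s v. s \<in> V2 \<Longrightarrow> HH s *v v = frechet_derivative hh (at s) (v, 0)"
    using elim(4) unfolding eventually_nhds by blast
  have pW: "(join y (hh s), \<epsilon>) \<in> WX" using pp_in_WX[of s] elim(5) s by (auto simp: pp_def)
  have cp: "cc (join y (hh (y, \<epsilon>)), \<epsilon>) = tt (y, \<epsilon>)" for y using cc_pp[of "(y, \<epsilon>)"] by (simp add: pp_def)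
  have "Ck_open (Suc 0) V HH" unfolding HH_def[abs_def]
    by (intro Ck_open_matrix V(1)) (use V(3) in auto)
  note dH = Ck_open_has_derivative[OF this V(2)]
  let ?DH = "frechet_derivative HH (at s)"
  have DHv: "?DH a *v w = frechet_derivative (\<lambda>s. frechet_derivative hh (at s) (w, 0)) (at s) a" for a w
  proof -
    have "((\<lambda>s. frechet_derivative hh (at s) (w, 0)) has_derivative (\<lambda>a. ?DH a *v w)) (at s)"
      by (rule has_derivative_transform_within_open[OF has_derivative_matrix_apply[OF dH] V2(1,2)]) (rule V2(3))
    from fun_cong[OF frechet_derivative_at[OF this], of a] show ?thesis .
  qed
  have sym: "?DH (v, 0) *v w = ?DH (w, 0) *v v" for v w
    unfolding DHv by (rule second_derivative_symmetric[OF V])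
  have dx: "((\<lambda>y. join y (hh (y, \<epsilon>))) has_derivative (\<lambda>v. TT s *v v)) (at y)"
    using hh_partial[of y \<epsilon>] elim(2) s by simp
  have d2: "((\<lambda>y. G2 (tt (y, \<epsilon>))) has_derivative (\<lambda>v. J2 (pp s) *v (TT s *v v))) (at y)"
    using has_derivative_compose[OF dx, of "\<lambda>x. G2 (cc (x, \<epsilon>))"] J_has_derivative(2)[OF pW] s
    by (simp add: cp pp_def)
  have d1: "((\<lambda>y. G1 (tt (y, \<epsilon>))) has_derivative (\<lambda>v. J1 (pp s) *v (TT s *v v))) (at y)"
    using has_derivative_compose[OF dx, of "\<lambda>x. G1 (cc (x, \<epsilon>))"] J_has_derivative(1)[OF pW] s
    by (simp add: cp pp_def)
  have dHy: "((\<lambda>y. HH (y, \<epsilon>)) has_derivative (\<lambda>v. ?DH (v, 0))) (at y)"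
    using has_derivative_partial[of HH ?DH y \<epsilon>] dH s by simp
  have r: "((\<lambda>y. \<epsilon> *\<^sub>R (HH (y, \<epsilon>) *v G1 (tt (y, \<epsilon>)))) has_derivative
      (\<lambda>v. \<epsilon> *\<^sub>R (HH s *v (J1 (pp s) *v (TT s *v v)) + ?DH (v, 0) *v G1 (tt s)))) (at y)"
    using has_derivative_scaleR_right[OF bounded_bilinear.FDERIV[OF bounded_bilinear_matrix_vector dHy d1]] s by simp
  have oy: "open ((\<lambda>y. (y, \<epsilon>)) -` V1)" "y \<in> (\<lambda>y. (y, \<epsilon>)) -` V1"
    using V1(1,2) s by (auto intro!: open_vimage continuous_intros)
  have "((\<lambda>y. G2 (tt (y, \<epsilon>))) has_derivative
      (\<lambda>v. \<epsilon> *\<^sub>R (HH s *v (J1 (pp s) *v (TT s *v v)) + ?DH (v, 0) *v G1 (tt s)))) (at y)"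
    by (rule has_derivative_transform_within_open[OF r oy]) (use V1(3) in auto)
  from has_derivative_unique[OF d2 this]
  have key: "J2 (pp s) *v (TT s *v v) = \<epsilon> *\<^sub>R (HH s *v (J1 (pp s) *v (TT s *v v)) + ?DH (v, 0) *v G1 (tt s))" for v
    by (rule fun_cong)
  have "?DH (\<epsilon> *\<^sub>R G1 (tt s), 0) = \<epsilon> *\<^sub>R ?DH (G1 (tt s), 0)"
    using linear_scale[OF has_derivative_linear[OF dH], of \<epsilon> "(G1 (tt s), 0)"] by simp
  then have "?DH (\<epsilon> *\<^sub>R G1 (tt s), 0) *v v = \<epsilon> *\<^sub>R (?DH (v, 0) *v G1 (tt s))" for v
    by (simp add: sym[of v] scaleR_matrix_vector_assoc[symmetric])
  then have "(J2 (pp s) ** TT s - ?DH (snd s *\<^sub>R G1 (tt s), 0)) *v v = (snd s *\<^sub>R (HH s ** (J1 (pp s) ** TT s))) *v v" for v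
    using key[of v] s
    by (simp add: matrix_vector_mult_diff_rdistrib matrix_vector_mul_assoc[symmetric] scaleR_matrix_vector_assoc[symmetric] scaleR_add_right)
  then show ?case unfolding matrix_eq by blast
qed

text \<open>An open set on which the fiber parametrisation is a smooth function of all its arguments.\<close>
definition YD :: "real \<Rightarrow> ((real^'m) \<times> (real^'n) \<times> real) set" where
  "YD e = {p. fst p \<in> interior K \<and> fst (snd p) \<in> ball (h0 (fst p)) \<Delta> \<and> 0 < snd (snd p) \<and> snd (snd p) < e}"

lemma open_YD: "open (YD e)"
proof -
  let ?A = "interior K \<times> (UNIV :: (real^'n) set) \<times> {0<..<e}"
  have oA: "open ?A" by (intro open_Times) auto
  have "continuous_on ?A (\<lambda>p. dist (h0 (fst p)) (fst (snd p)))"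
    by (intro continuous_on_dist continuous_on_compose2[OF h0_cont] continuous_on_fst continuous_on_snd continuous_on_id)
      (use interior_subset[of K] in auto)
  from continuous_open_preimage[OF this oA open_lessThan[of \<Delta>]]
  have "open (?A \<inter> (\<lambda>p. dist (h0 (fst p)) (fst (snd p))) -` {..<\<Delta>})" .
  also have "?A \<inter> (\<lambda>p. dist (h0 (fst p)) (fst (snd p))) -` {..<\<Delta>} = YD e"
    by (auto simp: YD_def)
  finally show ?thesis .
qed

lemma YY_Ck: obtains e where "e > 0" "Ck_open k (YD e) YY"
proof -
  obtain e where e: "e > 0" "Ck_on k {(y, z, \<epsilon>). y \<in> K \<and> z \<in> cball (h0 y) \<Delta> \<and> \<epsilon> \<in> {0..<e}} (\<lambda>(y, z, \<epsilon>). Y y z \<epsilon>)"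
    using Y_Ck by blast
  obtain U f' where U: "open U"
    "{(y, z, \<epsilon>). y \<in> K \<and> z \<in> cball (h0 y) \<Delta> \<and> \<epsilon> \<in> {0..<e}} \<subseteq> U" "Ck_open k U f'"
    "\<forall>s\<in>{(y, z, \<epsilon>). y \<in> K \<and> z \<in> cball (h0 y) \<Delta> \<and> \<epsilon> \<in> {0..<e}}. f' s = (\<lambda>(y, z, \<epsilon>). Y y z \<epsilon>) s"
    using e(2) unfolding Ck_on_def by blast
  have sub: "YD e \<subseteq> {(y, z, \<epsilon>). y \<in> K \<and> z \<in> cball (h0 y) \<Delta> \<and> \<epsilon> \<in> {0..<e}}"
    using interior_subset[of K] by (auto simp: YD_def)
  have "f' p = YY p" if "p \<in> YD e" for p
    using U(4) subsetD[OF sub that] by (auto simp: YY_def)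
  from Ck_open_cong[OF open_YD this Ck_open_subset[OF U(3) subset_trans[OF sub U(2)]]] e(1) that
  show thesis by blast
qed

lemma hh_near_F: "\<forall>\<^sub>F s in F. hh s \<in> ball (h0 (fst s)) \<delta>"
proof -
  obtain V where V: "open V" "(y0, 0) \<in> V" "\<forall>s\<in>V \<inter> K \<times> {0..}. hh s \<in> ball (h0 (fst s)) \<delta>"
    using hh_near by blast
  from eventually_F_nhds[OF eventually_nhds_in_open[OF V(1,2)]] eventually_F_S show ?thesis
    by eventually_elim (use V(3) S_subset in auto)
qed

lemma in_YD: "s \<in> S \<Longrightarrow> snd s < e \<Longrightarrow> z \<in> ball (h0 (fst s)) \<delta> \<Longrightarrow> (fst s, z, snd s) \<in> YD e"
  using delta_le by (auto simp: YD_def S_def)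

text \<open>Follow a solution that starts in the fiber together with the solution of its base point: the
  slow component of the first is the value of \<open>Y\<close> at the base point of the second and its own fast
  component. The equation compares the velocities at time \<open>0\<close>.\<close>
lemma fiber_pointwise:
  "\<forall>\<^sub>F s in F. \<forall>z\<in>ball (h0 (fst s)) \<delta>.
     snd s *\<^sub>R G1 (Y (fst s) z (snd s), z, snd s)
     = frechet_derivative YY (at (fst s, z, snd s)) (snd s *\<^sub>R G1 (tt s), G2 (Y (fst s) z (snd s), z, snd s), 0)"
proof -
  obtain e where e: "e > 0" "Ck_open (Suc 0) (YD e) YY" by (rule YY_Ck)
  show ?thesis
    using base_solution eventually_F_S eventually_small[OF e0] eventually_small[OF e(1)]
      eventually_F_parameter[OF fibers] eventually_F_parameter[OF fib_inv]
  proof (eventually_elim, intro ballI)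
    fix s z
    assume base: "\<exists>T x. 0 < T \<and> x 0 = fst (pp s) \<and> solution_on (g (snd s)) {0..T} x
        \<and> (\<forall>t\<in>{0..T}. x t \<in> graph_over K (h (snd s)))"
      and sS: "s \<in> S" and small: "0 < snd s \<and> snd s < \<epsilon>0" "0 < snd s \<and> snd s < e"
      and fib: "\<forall>y\<in>K. open (N (snd s) y) \<and> ball (h0 y) \<delta> \<subseteq> N (snd s) y \<and> N (snd s) y \<subseteq> cball (h0 y) \<Delta> \<and>
           Y y (h (snd s) y) (snd s) = y \<and>
           Fib (snd s) (join y (h (snd s) y)) = (\<lambda>z. join (Y y z (snd s)) z) ` N (snd s) y"
      and inv: "\<forall>T\<ge>0. \<forall>x p.
           solution_on (g (snd s)) {0..T} x \<and> solution_on (g (snd s)) {0..T} p \<and>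
           (\<forall>t\<in>{0..T}. p t \<in> graph_over K (h (snd s))) \<and> x 0 \<in> Fib (snd s) (p 0)
           \<longrightarrow> (\<forall>t\<in>{0..T}. x t \<in> Fib (snd s) (p t))"
      and z: "z \<in> ball (h0 (fst s)) \<delta>"
    obtain y \<epsilon> where s: "s = (y, \<epsilon>)" by (cases s)
    have yK: "y \<in> K" using sS s interior_subset[of K] by (auto simp: S_def)
    obtain T1 q where q: "0 < T1" "q 0 = fst (pp s)" "solution_on (g \<epsilon>) {0..T1} q"
      "\<And>t. t \<in> {0..T1} \<Longrightarrow> q t \<in> graph_over K (h \<epsilon>)" using base s by auto
    have ck: "Ck_open (Suc 0) UNIV (g \<epsilon>)" by (rule Ck_g) (use small s in auto)
    obtain T2 x where x: "T2 > 0" "x 0 = join (Y y z \<epsilon>) z" "solution_on (g \<epsilon>) {0..T2} x"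
      by (rule local_solution[OF ck, of "join (Y y z \<epsilon>) z"])
    define T where "T = min T1 T2"
    have T: "0 < T" "T \<le> T1" "T \<le> T2" using q(1) x(1) by (auto simp: T_def)
    have qs: "solution_on (g \<epsilon>) {0..T} q" and xs: "solution_on (g \<epsilon>) {0..T} x"
      by (rule solution_on_subset[OF q(3)], use T in auto) (rule solution_on_subset[OF x(3)], use T in auto)
    have "x 0 \<in> Fib \<epsilon> (q 0)" using fib[rule_format, OF yK] z s q(2) x(2) by (auto simp: pp_def hh_def)
    then have "\<forall>t\<in>{0..T}. x t \<in> Fib \<epsilon> (q t)"
      using inv[rule_format, of T x q] xs qs q(4) T s by auto
    then have on_fib: "slow (x t) = YY (slow (q t), fast (x t), \<epsilon>)" if t: "t \<in> {0..T}" for t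
    proof -
      have "q t \<in> graph_over K (h \<epsilon>)" using q(4) t T by auto
      then have "slow (q t) \<in> K" "q t = join (slow (q t)) (h \<epsilon> (slow (q t)))"
        using graph_over_fast by blast+
      then have "x t \<in> (\<lambda>z. join (Y (slow (q t)) z \<epsilon>) z) ` N \<epsilon> (slow (q t))"
        using fib[rule_format, of "slow (q t)"] \<open>\<forall>t\<in>{0..T}. x t \<in> Fib \<epsilon> (q t)\<close> t s by auto
      then show ?thesis by (auto simp: YY_def)
    qed
    have cq: "cc (q 0, \<epsilon>) = tt s" using q(2) s cc_pp[of s] by (simp add: pp_def)
    have cx: "cc (x 0, \<epsilon>) = (Y y z \<epsilon>, z, \<epsilon>)" using x(2) by (simp add: cc_def)
    have d1: "((\<lambda>t. slow (x t)) has_vector_derivative \<epsilon> *\<^sub>R G1 (Y y z \<epsilon>, z, \<epsilon>)) (at 0 within {0..T})"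
      using solution_component[OF xs T(1) bounded_linear_slow] by (simp add: slow_g cx)
    have d2: "((\<lambda>t. fast (x t)) has_vector_derivative G2 (Y y z \<epsilon>, z, \<epsilon>)) (at 0 within {0..T})"
      using solution_component[OF xs T(1) bounded_linear_fast] by (simp add: fast_g cx)
    have d3: "((\<lambda>t. slow (q t)) has_vector_derivative \<epsilon> *\<^sub>R G1 (tt s)) (at 0 within {0..T})"
      using solution_component[OF qs T(1) bounded_linear_slow] by (simp add: slow_g cq)
    have pr: "((\<lambda>t. (slow (q t), fast (x t), \<epsilon>)) has_vector_derivative
        (\<epsilon> *\<^sub>R G1 (tt s), G2 (Y y z \<epsilon>, z, \<epsilon>), 0)) (at 0 within {0..T})"
      by (intro has_vector_derivative_Pair d2 d3 has_vector_derivative_const)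
    have p0: "(slow (q 0), fast (x 0), \<epsilon>) = (y, z, \<epsilon>)" using q(2) x(2) s by (simp add: pp_def)
    have "(y, z, \<epsilon>) \<in> YD e" using in_YD[OF sS _ z, of e] small s by auto
    from Ck_open_has_derivative[OF e(2) this]
    have "((\<lambda>t. YY (slow (q t), fast (x t), \<epsilon>)) has_vector_derivative
        frechet_derivative YY (at (y, z, \<epsilon>)) (\<epsilon> *\<^sub>R G1 (tt s), G2 (Y y z \<epsilon>, z, \<epsilon>), 0)) (at 0 within {0..T})"
      using has_vector_derivative_chain_within[OF pr] unfolding p0 by blast
    from initial_derivative_unique[OF T(1) d1 this on_fib]
    show "snd s *\<^sub>R G1 (Y (fst s) z (snd s), z, snd s)
     = frechet_derivative YY (at (fst s, z, snd s)) (snd s *\<^sub>R G1 (tt s), G2 (Y (fst s) z (snd s), z, snd s), 0)"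
      by (simp add: s)
  qed
qed

lemma Y_partial:
  assumes "Ck_open (Suc k) (YD e) YY" "(y, z, \<epsilon>) \<in> YD e"
  shows "((\<lambda>z. Y y z \<epsilon>) has_derivative (\<lambda>v. frechet_derivative YY (at (y, z, \<epsilon>)) (0, v, 0))) (at z)"
proof -
  have "((\<lambda>z. (y, z, \<epsilon>)) has_derivative (\<lambda>v. (0, v, 0))) (at z)"
    by (intro has_derivative_Pair has_derivative_const has_derivative_ident)
  from has_derivative_compose[OF this Ck_open_has_derivative[OF assms]] show ?thesis by (simp add: YY_def)
qed

lemma tau_apply:
  assumes "Ck_open (Suc k) (YD e) YY" "tt s \<in> YD e"
  shows "\<tau> s *v v = frechet_derivative YY (at (tt s)) (0, v, 0)"
proof -
  have d: "((\<lambda>z. Y (fst s) z (snd s)) has_derivative (\<lambda>v. frechet_derivative YY (at (tt s)) (0, v, 0))) (at (hh s))"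
    using Y_partial[OF assms(1), of "fst s" "hh s" "snd s"] assms(2) by (simp add: tt_def)
  then show ?thesis unfolding \<tau>_def jacobian_def frechet_derivative_at[OF d, symmetric]
    by (simp add: matrix_apply[OF has_derivative_linear[OF d]])
qed

text \<open>The derivative of \<open>fiber_pointwise\<close> along the fiber at its base point.\<close>
lemma fiber_equation:
  "\<forall>\<^sub>F s in F. \<tau> s ** (J2 (pp s) ** EE s) = snd s *\<^sub>R (J1 (pp s) ** EE s)
     - frechet_derivative \<tau> (at s) (snd s *\<^sub>R G1 (tt s), 0)"
proof -
  obtain e where e: "e > 0" "Ck_open (Suc (Suc 0)) (YD e) YY" by (rule YY_Ck)
  note e1 = Ck_open_Suc_imp[OF e(2)]
  have ttO: "\<forall>\<^sub>F s in F. tt s \<in> YD e"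
    using eventually_F_S eventually_small[OF e(1)] hh_near_F
    by eventually_elim (auto simp: tt_def intro!: in_YD)
  show ?thesis
    using ev_nhds[OF ttO] ttO slow_pointwise fiber_pointwise hh_derivative hh_near_F
      Jet_differentiable[OF corner_smooth_Jet[OF tau_smooth]] eventually_small[OF e0] eventually_F_parameter[OF fibers]
      eventually_F_S
  proof eventually_elim
    case (elim s)
    obtain y \<epsilon> where s: "s = (y, \<epsilon>)" by (cases s)
    have yK: "y \<in> K" using elim(10) s interior_subset[of K] by (auto simp: S_def)
    obtain V where V: "open V" "s \<in> V" "\<And>s. s \<in> V \<Longrightarrow> tt s \<in> YD e"
      using elim(1) unfolding eventually_nhds by blast
    let ?D = "\<lambda>x. frechet_derivative YY (at x)"
    define c0 where "c0 = (\<epsilon> *\<^sub>R G1 (tt s), G2 (tt s), 0::real)"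
    let ?Dtau = "frechet_derivative \<tau> (at s)"
    have pW: "(join y (hh s), \<epsilon>) \<in> WX" using pp_in_WX[of s] elim(8) s by (auto simp: pp_def)
    have Yh: "Y y (hh s) \<epsilon> = y" using elim(9) yK s by (auto simp: hh_def)
    have ccj: "cc (join a b, \<epsilon>) = (a, b, \<epsilon>)" for a b by (simp add: cc_def)
    have tts: "tt s = (y, hh s, \<epsilon>)" by (simp add: tt_def s)
    \<comment> \<open>Both sides differentiate \<open>YY\<close> twice, once along the fiber and once along the flow of base
       point and fast coordinate, whose velocity on the slow manifold is \<open>c0\<close>.\<close>
    have Dtau: "?Dtau (\<epsilon> *\<^sub>R G1 (tt s), 0) *v v = frechet_derivative (\<lambda>x. ?D x (0, v, 0)) (at (tt s)) c0" for v
    proof -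
      have "frechet_derivative hh (at s) (\<epsilon> *\<^sub>R G1 (tt s), 0) = G2 (tt s)"
        using elim(3,5) s by (metis matrix_vector_mult_scaleR snd_conv)
      moreover have Dv: "((\<lambda>x. ?D x (0, v, 0)) has_derivative frechet_derivative (\<lambda>x. ?D x (0, v, 0)) (at (tt s))) (at (tt s))"
        by (rule Ck_open_has_derivative[of 0 "YD e"]) (use e(2) elim(2) in simp_all)
      have "((\<lambda>s. \<tau> s *v v) has_derivative (\<lambda>a. frechet_derivative (\<lambda>x. ?D x (0, v, 0)) (at (tt s))
          (fst a, frechet_derivative hh (at s) a, snd a))) (at s)"
        by (rule has_derivative_transform_within_open[OF has_derivative_compose[OF tt_derivative Dv] V(1,2)])
          (use elim(5) tau_apply[OF e1 V(3)] in auto)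
      from has_derivative_unique[OF this has_derivative_matrix_apply[OF elim(7)]]
      have "?Dtau (\<epsilon> *\<^sub>R G1 (tt s), 0) *v v = frechet_derivative (\<lambda>x. ?D x (0, v, 0)) (at (tt s))
          (\<epsilon> *\<^sub>R G1 (tt s), frechet_derivative hh (at s) (\<epsilon> *\<^sub>R G1 (tt s), 0), 0)"
        by (simp add: fun_eq_iff)
      ultimately show ?thesis by (simp add: c0_def)
    qed
    \<comment> \<open>It remains to differentiate the first-order invariance equation along the fiber.\<close>
    let ?x = "\<lambda>z. join (Y y z \<epsilon>) z"
    have dY: "((\<lambda>z. Y y z \<epsilon>) has_derivative (\<lambda>v. \<tau> s *v v)) (at (hh s))"
      using Y_partial[OF e1, of y "hh s" \<epsilon>] elim(2) tau_apply[OF e1 elim(2)] by (simp add: tts)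
    have dx: "(?x has_derivative (\<lambda>v. EE s *v v)) (at (hh s))"
    proof -
      have "((\<lambda>z. injL *v Y y z \<epsilon> + injR *v z) has_derivative (\<lambda>v. injL *v (\<tau> s *v v) + injR *v v)) (at (hh s))"
        by (intro has_derivative_add bounded_linear.has_derivative[OF matrix_vector_mul_bounded_linear] dY has_derivative_ident)
      then show ?thesis
        by (simp add: join_inj EE_def matrix_vector_mult_add_rdistrib matrix_vector_mul_assoc)
    qed
    have d1: "((\<lambda>z. G1 (Y y z \<epsilon>, z, \<epsilon>)) has_derivative (\<lambda>v. J1 (pp s) *v (EE s *v v))) (at (hh s))"
      using has_derivative_compose[OF dx, of "\<lambda>x. G1 (cc (x, \<epsilon>))"] J_has_derivative(1)[OF pW] s
      by (simp add: ccj pp_def Yh[unfolded s])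
    have d2: "((\<lambda>z. G2 (Y y z \<epsilon>, z, \<epsilon>)) has_derivative (\<lambda>v. J2 (pp s) *v (EE s *v v))) (at (hh s))"
      using has_derivative_compose[OF dx, of "\<lambda>x. G2 (cc (x, \<epsilon>))"] J_has_derivative(2)[OF pW] s
      by (simp add: ccj pp_def Yh[unfolded s])
    let ?c = "\<lambda>z. (\<epsilon> *\<^sub>R G1 (tt s), G2 (Y y z \<epsilon>, z, \<epsilon>), 0::real)"
    have dc: "(?c has_derivative (\<lambda>v. (0, J2 (pp s) *v (EE s *v v), 0))) (at (hh s))"
      by (intro has_derivative_Pair has_derivative_const d2)
    have dP: "((\<lambda>z. (y, z, \<epsilon>)) has_derivative (\<lambda>v. (0, v, 0))) (at (hh s))"
      by (intro has_derivative_Pair has_derivative_const has_derivative_ident)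
    have c0: "?c (hh s) = c0" by (simp add: c0_def Yh tts)
    have R: "((\<lambda>z. ?D (y, z, \<epsilon>) (?c z)) has_derivative
        (\<lambda>v. frechet_derivative (\<lambda>x. ?D x c0) (at (tt s)) (0, v, 0) + ?D (tt s) (0, J2 (pp s) *v (EE s *v v), 0))) (at (hh s))"
      using has_derivative_derivative_apply[OF open_YD e(2) _ dP dc, unfolded c0] elim(2) unfolding tts by simp
    have "((\<lambda>z. \<epsilon> *\<^sub>R G1 (Y y z \<epsilon>, z, \<epsilon>)) has_derivative
        (\<lambda>v. frechet_derivative (\<lambda>x. ?D x c0) (at (tt s)) (0, v, 0) + ?D (tt s) (0, J2 (pp s) *v (EE s *v v), 0))) (at (hh s))"
      by (rule has_derivative_transform_within_open[OF R open_ball elim(6)]) (use elim(4) s in simp)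
    from has_derivative_unique[OF has_derivative_scaleR_right[OF d1] this]
    have "\<epsilon> *\<^sub>R (J1 (pp s) *v (EE s *v v)) = frechet_derivative (\<lambda>x. ?D x c0) (at (tt s)) (0, v, 0)
        + ?D (tt s) (0, J2 (pp s) *v (EE s *v v), 0)" for v
      by (rule fun_cong)
    then have "\<epsilon> *\<^sub>R (J1 (pp s) *v (EE s *v v)) = ?Dtau (\<epsilon> *\<^sub>R G1 (tt s), 0) *v v + \<tau> s *v (J2 (pp s) *v (EE s *v v))" for v
      unfolding Dtau tau_apply[OF e1 elim(2)]
      using second_derivative_symmetric[OF open_YD elim(2) e(2), of c0 "(0, v, 0)"] by simp
    then have "(\<tau> s ** (J2 (pp s) ** EE s)) *v v
        = (snd s *\<^sub>R (J1 (pp s) ** EE s) - ?Dtau (snd s *\<^sub>R G1 (tt s), 0)) *v v" for v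
      by (simp add: s matrix_vector_mult_diff_rdistrib matrix_vector_mul_assoc[symmetric] scaleR_matrix_vector_assoc[symmetric])
    then show ?case unfolding matrix_eq by blast
  qed
qed

end

section \<open>CSP frames along the slow manifold\<close>

context fenichel
begin

definition Bs :: "((real^'m) \<times> real) set" where "Bs = (\<lambda>b. (b, 0)) ` Basis"
definition cf :: "(real^'m) \<times> real \<Rightarrow> (real^'m) \<times> real \<Rightarrow> real" where "cf b s = fst b \<bullet> G1 (tt s)"

lemma flow_sum: "(\<Sum>b\<in>Bs. cf b s *\<^sub>R b) = (G1 (tt s), 0)"
proof -
  have "(\<Sum>b\<in>Bs. cf b s *\<^sub>R b) = (\<Sum>b\<in>Basis. ((G1 (tt s) \<bullet> b) *\<^sub>R b, 0))"
    unfolding Bs_def by (subst sum.reindex) (auto simp: inj_on_def cf_def inner_commute)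
  also have "\<dots> = (\<Sum>b\<in>Basis. (G1 (tt s) \<bullet> b) *\<^sub>R b, 0)"
    by (simp add: sum_prod)
  finally show ?thesis by (simp add: euclidean_representation)
qed

lemma tt_corner: "tt (y0, 0) \<in> W"
  using W_sup e0 by (auto simp: tt_def)

lemma pp_corner: "pp (y0, 0) = (join y0 (h0 y0), 0)"
  by (simp add: pp_def hh_corner)

lemma pp_corner_WX: "pp (y0, 0) \<in> WX"
  using tt_corner cc_pp[of "(y0, 0)"] by (simp add: WX_def)

lemma J1_smooth: "corner_smooth (\<lambda>s. J1 (pp s))" and J2_smooth: "corner_smooth (\<lambda>s. J2 (pp s))"
  by (intro corner_smooth_compose[OF pp_smooth open_WX pp_corner_WX] Ck_J1 Ck_J2)+

lemma G1_smooth: "corner_smooth (\<lambda>s. G1 (tt s))"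
  by (intro corner_smooth_compose[OF tt_smooth open_W tt_corner] G1_Ck)

lemma Jet_HH: "Jet 0 HH"
  unfolding HH_def[abs_def] matrix_sum_columns
  by (intro Jet_sum Jet_linear[OF bounded_linear_column_matrix] Jet_derivative corner_smooth_Jet hh_smooth) auto

text \<open>Here the weight \<open>w\<close> is the projection to \<open>\<epsilon>\<close>.\<close>
sublocale fr: slow_fast_frames F D snd Bs cf "\<lambda>s. J1 (pp s)" "\<lambda>s. J2 (pp s)" \<tau> HH
  "J2 (join y0 (h0 y0), 0) ** injR"
proof
  show "F \<noteq> bot" "(snd \<longlongrightarrow> 0) F" by (rule F_nontrivial snd_F)+
  show "finite Bs" "Bs \<subseteq> D" by (auto simp: Bs_def)
  show "Jet 0 (cf b)" if "b \<in> Bs" for b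
    unfolding cf_def[abs_def]
    by (rule Jet_linear[OF bounded_linear_inner_right corner_smooth_Jet[OF G1_smooth]])
  show "Jet 0 (\<lambda>s. J1 (pp s))" "Jet 0 (\<lambda>s. J2 (pp s))" "Jet 0 \<tau>" "Jet 0 HH"
    by (intro corner_smooth_Jet J1_smooth J2_smooth tau_smooth Jet_HH)+
  show "(\<tau> \<longlongrightarrow> 0) F" using corner_smooth_tendsto[OF tau_smooth] by (simp add: tau_corner)
  show "((\<lambda>s. J2 (pp s) ** injR) \<longlongrightarrow> J2 (join y0 (h0 y0), 0) ** injR) F"
    using corner_smooth_tendsto[OF J2_smooth] unfolding pp_corner
    by (intro tendsto_matrix_mult tendsto_const)
  show "invertible (J2 (join y0 (h0 y0), 0) ** injR)" by (rule hyperbolic)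
  show "\<forall>\<^sub>F s in F. \<tau> s ** (J2 (pp s) ** (injL ** \<tau> s + injR))
        = snd s *\<^sub>R (J1 (pp s) ** (injL ** \<tau> s + injR))
          - frechet_derivative \<tau> (at s) (snd s *\<^sub>R (\<Sum>b\<in>Bs. cf b s *\<^sub>R b))"
    using fiber_equation by (simp add: EE_def flow_sum)
  show "\<forall>\<^sub>F s in F. J2 (pp s) ** (injL + injR ** HH s)
          - frechet_derivative HH (at s) (snd s *\<^sub>R (\<Sum>b\<in>Bs. cf b s *\<^sub>R b))
        = snd s *\<^sub>R (HH s ** (J1 (pp s) ** (injL + injR ** HH s)))"
    using slow_equation by (simp add: TT_def flow_sum)
qed

lemma frE: "fr.E s = EE s" and frT: "fr.T s = TT s" by (simp_all add: fr.E_def EE_def fr.T_def TT_def)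

text \<open>The field is \<open>\<epsilon>\<close> times a tangent vector of the slow manifold. This makes the derivative of a
  frame along the field computable from its values on the manifold (\<open>csp_Lambda_along\<close>) and makes the
  field itself of order one there.\<close>
lemma field_tangent: "\<forall>\<^sub>F s in F. g (snd s) (fst (pp s)) = TT s *v (snd s *\<^sub>R G1 (tt s))"
  using slow_pointwise
proof eventually_elim
  case (elim s)
  have "cc (fst (pp s), snd s) = tt s" using cc_pp[of s] by (simp add: pp_def)
  then show ?case
    using elim by (simp add: g_eq TT_def matrix_vector_mult_add_rdistrib matrix_vector_mul_assoc[symmetric]
        matrix_vector_mult_scaleR scaleR_add_right)
qed

lemma csp_Lambda_along:
  assumes U: "csp_smooth A0 q U" "pp (y0, 0) \<in> U"
  shows "\<forall>\<^sub>F s in F. \<Lambda> A0 q (pp s) = csp_B g A0 q (snd s) (fst (pp s)) ** fr.J s ** csp_A g A0 q (snd s) (fst (pp s))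
    - csp_B g A0 q (snd s) (fst (pp s)) ** fr.dd (\<lambda>s. csp_A g A0 q (snd s) (fst (pp s))) s"
proof -
  have oU: "open U" "U \<subseteq> WX" using U(1) by (auto simp: csp_smooth_def)
  have "\<forall>\<^sub>F s in F. pp s \<in> U"
    by (rule topological_tendstoD[OF corner_smooth_tendsto[OF pp_smooth] oU(1) U(2)])
  then show ?thesis using field_tangent hh_derivative
  proof eventually_elim
    case (elim s)
    obtain y \<epsilon> where s: "s = (y, \<epsilon>)" by (cases s)
    obtain x where x: "pp s = (x, \<epsilon>)" "x = join y (hh s)" by (simp add: pp_def s)
    let ?A = "\<lambda>p. csp_A g A0 q (snd p) (fst p)"
    have dA: "(?A has_derivative frechet_derivative ?A (at (pp s))) (at (pp s))"
      by (rule Ck_open_has_derivative[of 0 U]) (use U(1) elim(1) in \<open>simp_all add: csp_smooth_def del: Ck_open.simps\<close>)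
    have A': "frechet_derivative (csp_A g A0 q \<epsilon>) (at x) v = frechet_derivative ?A (at (pp s)) (v, 0)" for v
      using fun_cong[OF frechet_derivative_at[OF has_derivative_partial[OF dA[unfolded x(1)]]], of v]
      by (simp add: x(1))
    have dpp: "(pp has_derivative (\<lambda>v. (injL *v fst v + injR *v frechet_derivative hh (at s) v, snd v))) (at s)"
      unfolding pp_def[abs_def] join_inj
      by (intro has_derivative_Pair has_derivative_add
          bounded_linear.has_derivative[OF matrix_vector_mul_bounded_linear]
          has_derivative_fst has_derivative_snd has_derivative_ident) (use elim(3) in simp)
    have "fr.dd (\<lambda>s. ?A (pp s)) s = frechet_derivative ?A (at (pp s)) (TT s *v (\<epsilon> *\<^sub>R G1 (tt s)), 0)"
    proof -
      have "fr.flow s = (\<epsilon> *\<^sub>R G1 (tt s), 0)" by (simp add: fr.flow_def flow_sum s)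
      then show ?thesis
        using fun_cong[OF frechet_derivative_at[OF has_derivative_compose[OF dpp dA]], of "fr.flow s"] elim(3)
        by (simp add: fr.dd_def TT_def matrix_vector_mult_add_rdistrib matrix_vector_mul_assoc[symmetric])
    qed
    also have "\<dots> = frechet_derivative (csp_A g A0 q \<epsilon>) (at x) (g \<epsilon> x)"
      unfolding A' using elim(2) s x by simp
    finally have dd: "fr.dd (\<lambda>s. csp_A g A0 q (snd s) (fst (pp s))) s = frechet_derivative (csp_A g A0 q \<epsilon>) (at x) (g \<epsilon> x)"
      by (simp add: pp_def)
    have "jacobian (g \<epsilon>) (at x) = fr.J s"
      using jacobian_g[of x \<epsilon>] elim(1) oU(2) x by (auto simp: fr.J_def s)
    moreover have "snd s = \<epsilon>" by (simp add: s)
    ultimately show ?case unfolding dd by (simp add: csp_Lambda_def x(1))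
  qed
qed

text \<open>The induction hypothesis on the frame of order \<open>q\<close>: it is smooth near the limit point, and its
  residuals have the orders that \<open>q\<close> refinements produce.\<close>
definition csp_order :: "real^('n + 'm)^('m + 'n) \<Rightarrow> nat \<Rightarrow> ((real^('m + 'n)) \<times> real) set \<Rightarrow> bool" where
  "csp_order A0 q U \<longleftrightarrow> csp_smooth A0 q U \<and> pp (y0, 0) \<in> U
     \<and> Jet (Suc q) (\<lambda>s. prR ** csp_B g A0 q (snd s) (fst (pp s)) ** EE s)
     \<and> Jet q (\<lambda>s. prL ** csp_B g A0 q (snd s) (fst (pp s)) ** TT s)"

context
  fixes A0 :: "real^('n + 'm)^('m + 'n)"
  assumes A0: "A0 ** matrix_inv A0 = mat 1" "matrix_inv A0 ** A0 = mat 1"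
    and B0: "prR ** matrix_inv A0 ** injR = (0 :: real^'n^'m)"
begin

lemma csp_smooth_along:
  assumes "csp_smooth A0 q U" "pp (y0, 0) \<in> U"
  shows "corner_smooth (\<lambda>s. csp_A g A0 q (snd s) (fst (pp s)))"
    "corner_smooth (\<lambda>s. csp_B g A0 q (snd s) (fst (pp s)))"
    "corner_smooth (\<lambda>s. \<Lambda> A0 q (pp s))"
proof -
  have oU: "open U" using assms(1) by (auto simp: csp_smooth_def)
  note c = corner_smooth_compose[OF pp_smooth oU assms(2)]
  have s: "snd (pp s) = snd s" for s by (simp add: pp_def)
  show "corner_smooth (\<lambda>s. csp_A g A0 q (snd s) (fst (pp s)))"
    "corner_smooth (\<lambda>s. csp_B g A0 q (snd s) (fst (pp s)))"
    using c[of "\<lambda>p. csp_A g A0 q (snd p) (fst p)"] c[of "\<lambda>p. csp_B g A0 q (snd p) (fst p)"] assms(1)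
    by (auto simp: csp_smooth_def s)
  show "corner_smooth (\<lambda>s. \<Lambda> A0 q (pp s))"
    by (rule c[OF csp_smooth_Lambda[OF assms(1)]])
qed

lemma refinement_along:
  assumes "csp_order A0 q U"
  shows "invertible (prL ** csp_B g A0 q 0 (join y0 (h0 y0)) ** injR :: real^'n^'n)"
    and "invertible (block11 (\<Lambda> A0 q (pp (y0, 0))))"
    and "Jet (Suc (Suc q)) (\<lambda>s. prR ** csp_B g A0 (Suc q) (snd s) (fst (pp s)) ** EE s)"
    and "Jet (Suc q) (\<lambda>s. prL ** csp_B g A0 (Suc q) (snd s) (fst (pp s)) ** TT s)"
proof -
  let ?B = "\<lambda>s. csp_B g A0 q (snd s) (fst (pp s))"
  have U: "csp_smooth A0 q U" "pp (y0, 0) \<in> U"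
    and J: "Jet (Suc q) (\<lambda>s. prR ** ?B s ** fr.E s)" "Jet q (\<lambda>s. prL ** ?B s ** fr.T s)"
    using assms(1) by (auto simp: csp_order_def frE frT)
  note sm = csp_smooth_along[OF U]
  have inv: "csp_A g A0 q \<epsilon> x ** csp_B g A0 q \<epsilon> x = mat 1 \<and> csp_B g A0 q \<epsilon> x ** csp_A g A0 q \<epsilon> x = mat 1" for \<epsilon> x
    by (rule csp_inverse[OF A0])
  have ev: "\<forall>\<^sub>F s in F. csp_A g A0 q (snd s) (fst (pp s)) ** ?B s = mat 1 \<and> ?B s ** csp_A g A0 q (snd s) (fst (pp s)) = mat 1"
    using inv by simp
  have lim: "csp_A g A0 q (snd (y0, 0)) (fst (pp (y0, 0))) ** ?B (y0, 0) = mat 1" using inv by simp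
  note step = fr.refinement_step[OF corner_smooth_Jet[OF sm(1)] corner_smooth_Jet[OF sm(2)] ev
      corner_smooth_tendsto[OF sm(1)] corner_smooth_tendsto[OF sm(2)]
      corner_smooth_tendsto[OF sm(3)] lim csp_Lambda_along[OF U] J]
  have s: "snd (pp s) = snd s" for s by (simp add: pp_def)
  show "invertible (prL ** csp_B g A0 q 0 (join y0 (h0 y0)) ** injR :: real^'n^'n)"
    using step(1) by (simp add: pp_corner)
  show "invertible (block11 (\<Lambda> A0 q (pp (y0, 0))))" by (rule step(2))
  show "Jet (Suc (Suc q)) (\<lambda>s. prR ** csp_B g A0 (Suc q) (snd s) (fst (pp s)) ** EE s)"
    using step(3) by (simp add: frE s Let_def)
  show "Jet (Suc q) (\<lambda>s. prL ** csp_B g A0 (Suc q) (snd s) (fst (pp s)) ** TT s)"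
    using step(4) by (simp add: frT s Let_def)
qed

lemma csp_order_exists: "\<exists>U. csp_order A0 q U"
proof (induction q)
  case 0
  have eq: "prR ** matrix_inv A0 ** EE s = (prR ** matrix_inv A0 ** injL) ** \<tau> s" for s
    by (simp add: EE_def mm.add_right matrix_mul_assoc B0)
  have "Jet (Suc 0) (\<lambda>s. prR ** matrix_inv A0 ** EE s)"
    unfolding eq using Jet_mult_r[OF Jet_const fr.Jet_tau] by simp
  moreover have "Jet 0 (\<lambda>s. prL ** matrix_inv A0 ** TT s)"
    using Jet_mult0[OF Jet_const fr.Jet_T] by (simp add: frT)
  ultimately show ?case
    using csp_smooth_0 pp_corner_WX by (intro exI[of _ WX]) (simp add: csp_order_def)
next
  case (Suc q)
  then obtain U where U: "csp_order A0 q U" by blast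
  note r = refinement_along[OF U]
  obtain V where "csp_smooth A0 (Suc q) V" "pp (y0, 0) \<in> V"
    using csp_smooth_Suc[of A0 q U "pp (y0, 0)"] U r(2) unfolding csp_order_def by blast
  then have "csp_order A0 (Suc q) V" unfolding csp_order_def using r(3,4) by blast
  then show ?case by blast
qed

end

end

text \<open>Differences of values along two functions with the same limit are controlled by the difference
  of the functions.\<close>
lemma tendsto_lipschitz:
  fixes f :: "'a::euclidean_space \<Rightarrow> 'b::euclidean_space"
  assumes "open U" "P \<in> U" "Ck_open (Suc 0) U f" "(a \<longlongrightarrow> P) G" "(b \<longlongrightarrow> P) G"
  obtains L where "L > 0" "\<forall>\<^sub>F t in G. norm (f (a t) - f (b t)) \<le> L * norm (a t - b t)"
proof -
  obtain r where r: "r > 0" "cball P r \<subseteq> U" using assms(1,2) open_contains_cball by metis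
  obtain L where L: "L > 0" "\<And>x y. x \<in> cball P r \<Longrightarrow> y \<in> cball P r \<Longrightarrow> norm (f x - f y) \<le> L * norm (x - y)"
    using C1_lipschitz_on_cball[OF assms(3) r(2)] by blast
  have "\<forall>\<^sub>F t in G. a t \<in> ball P r" "\<forall>\<^sub>F t in G. b t \<in> ball P r"
    using topological_tendstoD[OF assms(4) open_ball] topological_tendstoD[OF assms(5) open_ball] r(1) by auto
  then have "\<forall>\<^sub>F t in G. norm (f (a t) - f (b t)) \<le> L * norm (a t - b t)"
    by eventually_elim (auto intro!: L(2))
  with L(1) that show thesis by blast
qed

section \<open>The CSP manifolds\<close>

context fenichel
begin

context
  fixes A0 :: "real^('n + 'm)^('m + 'n)"
  assumes A0: "A0 ** matrix_inv A0 = mat 1" "matrix_inv A0 ** A0 = mat 1"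
    and B0: "prR ** matrix_inv A0 ** injR = (0 :: real^'n^'m)"
begin

lemma field_smooth: "corner_smooth (\<lambda>s. g (snd s) (fst (pp s)))"
  using corner_smooth_compose[OF pp_smooth open_WX pp_corner_WX, of "\<lambda>p. g (snd p) (fst p)"] Ck_field
  by (simp add: pp_def)

lemma field_Jet: "Jet 1 (\<lambda>s. g (snd s) (fst (pp s)))"
proof (rule Jet_cong)
  show "Jet 1 (\<lambda>s. TT s *v (snd s *\<^sub>R G1 (tt s)))"
    using Jet_matrix_vector[OF fr.Jet_T Jet_w_scale[OF corner_smooth_Jet[OF G1_smooth]], of 1] by (simp add: frT)
  show "\<forall>\<^sub>F s in F. TT s *v (snd s *\<^sub>R G1 (tt s)) = g (snd s) (fst (pp s))"
    using field_tangent by eventually_elim simp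
qed

lemma field_corner: "g 0 (join y0 (h0 y0)) = 0"
  using tendsto_unique[OF F_nontrivial corner_smooth_tendsto[OF field_smooth] Jet_tendsto_zero[OF field_Jet _ snd_F]]
  by (simp add: pp_corner)

lemma corner_bound_on_line:
  assumes "corner_smooth f" "Jet q f"
  obtains C where "C > 0" "\<forall>\<^sub>F \<epsilon> in at_right 0. norm (f (y0, \<epsilon>)) \<le> C * \<epsilon> ^ q"
proof -
  obtain U where U: "open U" "(y0, 0) \<in> U" "continuous_on (U \<inter> K \<times> {0..}) f"
    using corner_smooth_continuous[OF assms(1)] .
  have "jet 0 q f" using assms(2) unfolding Jet_def by blast
  then obtain C where "C > 0" "\<forall>\<^sub>F s in F. norm (f s) \<le> C * snd s ^ q" by (rule jet_bound)
  with bound_on_boundary_line[OF U] that show thesis by blast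
qed

lemma join_line_tendsto:
  assumes "(\<phi> \<longlongrightarrow> h0 y0) (at_right 0)"
  shows "((\<lambda>\<epsilon>. (join y0 (\<phi> \<epsilon>), \<epsilon>)) \<longlongrightarrow> pp (y0, 0)) (at_right 0)"
  unfolding pp_corner join_inj
  by (intro tendsto_Pair tendsto_add tendsto_const tendsto_ident_at
      bounded_linear.tendsto[OF matrix_vector_mul_bounded_linear] assms)

lemma csp_B_lipschitz:
  assumes U: "csp_order A0 q U" and \<phi>: "(\<phi> \<longlongrightarrow> h0 y0) (at_right 0)"
    and C: "\<forall>\<^sub>F \<epsilon> in at_right 0. norm (\<phi> \<epsilon> - hh (y0, \<epsilon>)) \<le> C * \<epsilon> ^ r"
  obtains C' where "C' > 0" "\<forall>\<^sub>F \<epsilon> in at_right 0.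
    norm (csp_B g A0 q \<epsilon> (join y0 (\<phi> \<epsilon>)) - csp_B g A0 q \<epsilon> (join y0 (hh (y0, \<epsilon>)))) \<le> C' * \<epsilon> ^ r"
proof -
  have oU: "open U" "pp (y0, 0) \<in> U" "Ck_open (Suc 0) U (\<lambda>p. csp_B g A0 q (snd p) (fst p))"
    using U unfolding csp_order_def csp_smooth_def by blast+
  have hl: "((\<lambda>\<epsilon>. hh (y0, \<epsilon>)) \<longlongrightarrow> h0 y0) (at_right 0)"
    using corner_smooth_line_tendsto[OF hh_smooth] by (simp add: hh_corner)
  obtain L where L: "L > 0" "\<forall>\<^sub>F \<epsilon> in at_right 0.
      norm (csp_B g A0 q \<epsilon> (join y0 (\<phi> \<epsilon>)) - csp_B g A0 q \<epsilon> (join y0 (hh (y0, \<epsilon>))))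
      \<le> L * norm ((join y0 (\<phi> \<epsilon>), \<epsilon>) - (join y0 (hh (y0, \<epsilon>)), \<epsilon>))"
    using tendsto_lipschitz[OF oU(1,2,3) join_line_tendsto[OF \<phi>] join_line_tendsto[OF hl]] by auto
  obtain b where b: "b > 0" "\<And>v. norm ((injR :: real^'n^('m + 'n)) *v v) \<le> norm v * b"
    using bounded_linear.pos_bounded[OF matrix_vector_mul_bounded_linear] by metis
  have "\<forall>\<^sub>F \<epsilon> in at_right 0.
    norm (csp_B g A0 q \<epsilon> (join y0 (\<phi> \<epsilon>)) - csp_B g A0 q \<epsilon> (join y0 (hh (y0, \<epsilon>)))) \<le> (L * b * max C 1) * \<epsilon> ^ r"
    using L(2) C eventually_at_right_less[of "0::real"]
  proof eventually_elim
    case (elim \<epsilon>)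
    have "(join y0 (\<phi> \<epsilon>), \<epsilon>) - (join y0 (hh (y0, \<epsilon>)), \<epsilon>) = (injR *v (\<phi> \<epsilon> - hh (y0, \<epsilon>)), 0)"
      by (simp add: join_inj matrix_vector_mult_diff_distrib)
    then have "norm ((join y0 (\<phi> \<epsilon>), \<epsilon>) - (join y0 (hh (y0, \<epsilon>)), \<epsilon>)) \<le> norm (\<phi> \<epsilon> - hh (y0, \<epsilon>)) * b"
      using b(2)[of "\<phi> \<epsilon> - hh (y0, \<epsilon>)"] by (simp add: norm_Pair)
    also have "\<dots> \<le> (C * \<epsilon> ^ r) * b" using elim b by (intro mult_right_mono) auto
    also have "\<dots> \<le> (max C 1 * \<epsilon> ^ r) * b" using elim b by (intro mult_right_mono) auto
    finally have "L * norm ((join y0 (\<phi> \<epsilon>), \<epsilon>) - (join y0 (hh (y0, \<epsilon>)), \<epsilon>)) \<le> L * ((max C 1 * \<epsilon> ^ r) * b)"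
      using L(1) by (intro mult_left_mono) auto
    then show ?case using elim(1) by (simp add: mult_ac)
  qed
  moreover have "L * b * max C 1 > 0" using L(1) b(1) by simp
  ultimately show thesis using that by blast
qed

end

end

lemma invertible_ker:
  fixes M :: "real^'n^'n"
  assumes "invertible M" "M *v v = 0"
  shows "v = 0"
  using assms matrix_left_invertible_ker[of M] invertible_left_inverse[of M] by blast

lemma span_columns_range: "span (columns M) = range ((*v) (M :: real^'n^'k))"
proof -
  have "span (columns M) = (*v) M ` span (range (\<lambda>i. axis i 1))"
    unfolding columns_image_basis by (rule linear_span_image) (rule matrix_vector_mul_linear)
  moreover have "span (range (\<lambda>i. axis i (1::real))) = (UNIV :: (real^'n) set)"
  proof -
    have "(Basis :: (real^'n) set) \<subseteq> range (\<lambda>i. axis i 1)" by (auto simp: Basis_vec_def)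
    then have "span Basis \<subseteq> span (range (\<lambda>i. axis i (1::real)) :: (real^'n) set)" by (rule span_mono)
    then show ?thesis by auto
  qed
  ultimately show ?thesis by simp
qed

lemma span_columns_mult:
  fixes P :: "real^'n^'n"
  assumes "invertible P"
  shows "span (columns (M ** P)) = span (columns (M :: real^'n^'k))"
  unfolding span_columns_range
proof (intro set_eqI iffI)
  fix x assume "x \<in> range ((*v) (M ** P))"
  then show "x \<in> range ((*v) M)" by (auto simp: matrix_vector_mul_assoc[symmetric])
next
  fix x assume "x \<in> range ((*v) M)"
  then obtain v where "x = M *v v" by auto
  then have "x = (M ** P) *v (matrix_inv P *v v)"
    by (simp add: matrix_vector_mul_assoc matrix_mul_assoc[symmetric] matrix_inv_mult[OF assms])
  then show "x \<in> range ((*v) (M ** P))" by blast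
qed

text \<open>A curve in the graph is determined by its fast component, so its velocity is the image of the fast
  velocity under the derivative of the graph map.\<close>
lemma tangent_space_graph:
  fixes f :: "real^'n \<Rightarrow> real^'m"
  assumes "open N" "z0 \<in> N" and f: "(f has_derivative (\<lambda>v. M *v v)) (at z0)"
  shows "tangent_space ((\<lambda>z. join (f z) z) ` N) (join (f z0) z0) = range ((*v) (injL ** M + injR))"
proof (intro set_eqI iffI)
  have M: "(injL ** M + injR) *v w = join (M *v w) w" for w
    by (simp add: join_inj matrix_vector_mult_add_rdistrib matrix_vector_mul_assoc)
  fix v
  {
    assume "v \<in> range ((*v) (injL ** M + injR))"
    then obtain w where v: "v = join (M *v w) w" by (auto simp: M)
    let ?c = "\<lambda>t. join (f (z0 + t *\<^sub>R w)) (z0 + t *\<^sub>R w)"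
    have l: "((\<lambda>t. z0 + t *\<^sub>R w) has_vector_derivative w) (at 0)"
      by (auto intro!: derivative_eq_intros)
    have "((\<lambda>t. f (z0 + t *\<^sub>R w)) has_vector_derivative M *v w) (at 0)"
      using has_vector_derivative_chain_within[OF l, of f "(*v) M"] f by simp
    then have "(?c has_vector_derivative v) (at 0)" unfolding v join_inj
      by (intro has_vector_derivative_add bounded_linear.has_vector_derivative[OF matrix_vector_mul_bounded_linear] l)
    moreover have "\<forall>\<^sub>F t in nhds 0. ?c t \<in> (\<lambda>z. join (f z) z) ` N"
    proof -
      have "((\<lambda>t. z0 + t *\<^sub>R w) \<longlongrightarrow> z0 + 0 *\<^sub>R w) (nhds 0)" by (intro tendsto_intros filterlim_ident)
      then have "\<forall>\<^sub>F t in nhds 0. z0 + t *\<^sub>R w \<in> N"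
        by (rule topological_tendstoD) (use assms in auto)
      then show ?thesis by eventually_elim auto
    qed
    ultimately show "v \<in> tangent_space ((\<lambda>z. join (f z) z) ` N) (join (f z0) z0)"
      unfolding tangent_space_def by (auto intro!: exI[of _ ?c])
  }
  {
    assume "v \<in> tangent_space ((\<lambda>z. join (f z) z) ` N) (join (f z0) z0)"
    then obtain c where c: "c 0 = join (f z0) z0" "\<forall>\<^sub>F t in nhds (0::real). c t \<in> (\<lambda>z. join (f z) z) ` N"
      "(c has_vector_derivative v) (at 0)" unfolding tangent_space_def by auto
    have sl: "((\<lambda>t. slow (c t)) has_vector_derivative slow v) (at 0)"
      and fa: "((\<lambda>t. fast (c t)) has_vector_derivative fast v) (at 0)"
      unfolding slow_pr fast_pr
      by (intro bounded_linear.has_vector_derivative[OF matrix_vector_mul_bounded_linear] c(3))+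
    have "(f has_derivative (*v) M) (at (fast (c 0)))" using f c(1) by simp
    from has_vector_derivative_chain_within[OF fa this]
    have fc: "((\<lambda>t. f (fast (c t))) has_vector_derivative M *v fast v) (at 0)" .
    obtain X where X: "open X" "0 \<in> X" "\<And>t. t \<in> X \<Longrightarrow> slow (c t) = f (fast (c t))"
    proof -
      have "\<forall>\<^sub>F t in nhds 0. slow (c t) = f (fast (c t))" using c(2) by eventually_elim auto
      then show thesis unfolding eventually_nhds using that by blast
    qed
    have "((\<lambda>t. slow (c t)) has_vector_derivative M *v fast v) (at 0)"
      by (rule has_vector_derivative_transform_within_open[OF fc X(1,2)]) (simp add: X(3))
    from vector_derivative_unique_at[OF sl this] have "v = join (M *v fast v) (fast v)"
      by (metis join_slow_fast)
    then show "v \<in> range ((*v) (injL ** M + injR))" using M by (metis rangeI)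
  }
qed

context fenichel
begin

context
  fixes A0 :: "real^('n + 'm)^('m + 'n)"
  assumes A0: "A0 ** matrix_inv A0 = mat 1" "matrix_inv A0 ** A0 = mat 1"
    and B0: "prR ** matrix_inv A0 ** injR = (0 :: real^'n^'m)"
begin

text \<open>\<open>B\<^sup>1\<close> is evaluated at the previous CSP manifold and the field at the slow manifold. Moving \<open>B\<^sup>1\<close> to
  the slow manifold costs \<open>O(\<epsilon>\<^sup>q)\<close> times the field, which is \<open>O(\<epsilon>)\<close>; there \<open>B\<^sup>1 g\<close> is \<open>\<epsilon> B\<^sup>1 T g\<^sub>1\<close>.\<close>
lemma residual_bound:
  assumes U: "csp_order A0 q U" and \<phi>: "(\<phi> \<longlongrightarrow> h0 y0) (at_right 0)"
    and C: "\<forall>\<^sub>F \<epsilon> in at_right 0. norm (\<phi> \<epsilon> - hh (y0, \<epsilon>)) \<le> C * \<epsilon> ^ q"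
  obtains C' where "C' > 0" "\<forall>\<^sub>F \<epsilon> in at_right 0.
    norm ((prL ** csp_B g A0 q \<epsilon> (join y0 (\<phi> \<epsilon>))) *v g \<epsilon> (join y0 (hh (y0, \<epsilon>))) :: real^'n) \<le> C' * \<epsilon> ^ Suc q"
proof -
  let ?B = "\<lambda>\<epsilon> z. csp_B g A0 q \<epsilon> (join y0 z)" and ?g = "\<lambda>\<epsilon>. g \<epsilon> (join y0 (hh (y0, \<epsilon>)))"
  obtain C1 where C1: "C1 > 0" "\<forall>\<^sub>F \<epsilon> in at_right 0. norm (?B \<epsilon> (\<phi> \<epsilon>) - ?B \<epsilon> (hh (y0, \<epsilon>))) \<le> C1 * \<epsilon> ^ q"
    by (rule csp_B_lipschitz[OF A0 B0 U \<phi> C])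
  obtain C2 where C2: "C2 > 0" "\<forall>\<^sub>F \<epsilon> in at_right 0. norm (?g \<epsilon>) \<le> C2 * \<epsilon> ^ 1"
    using corner_bound_on_line[OF A0 B0 field_smooth[OF A0 B0] field_Jet[OF A0 B0]] by (simp add: pp_def) blast
  have U': "csp_smooth A0 q U" "pp (y0, 0) \<in> U" "open U" "U \<subseteq> WX"
    and R: "Jet q (\<lambda>s. prL ** csp_B g A0 q (snd s) (fst (pp s)) ** TT s)"
    using U by (auto simp: csp_order_def csp_smooth_def)
  let ?\<beta> = "\<lambda>s. (prL ** csp_B g A0 q (snd s) (fst (pp s))) *v g (snd s) (fst (pp s)) :: real^'n"
  have "corner_smooth ?\<beta>"
  proof -
    have "Ck_open k U (\<lambda>p. (prL ** csp_B g A0 q (snd p) (fst p)) *v g (snd p) (fst p) :: real^'n)" for k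
      using U'(1) by (intro Ck_open_bilinear[OF bounded_bilinear_matrix_vector U'(3)]
          Ck_open_bilinear[OF bounded_bilinear_matrix_mult U'(3)] Ck_open_const
          Ck_open_subset[OF Ck_field U'(4)]) (simp add: csp_smooth_def)
    from corner_smooth_compose[OF pp_smooth U'(3,2) this] show ?thesis by (simp add: pp_def)
  qed
  moreover have "Jet (Suc q) ?\<beta>"
  proof (rule Jet_cong)
    show "Jet (Suc q) (\<lambda>s. (prL ** csp_B g A0 q (snd s) (fst (pp s)) ** TT s) *v (snd s *\<^sub>R G1 (tt s)))"
      by (rule Jet_matrix_vector[OF R Jet_w_scale[OF corner_smooth_Jet[OF G1_smooth]]]) simp
    show "\<forall>\<^sub>F s in F. (prL ** csp_B g A0 q (snd s) (fst (pp s)) ** TT s) *v (snd s *\<^sub>R G1 (tt s)) = ?\<beta> s"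
      using field_tangent by eventually_elim (simp add: matrix_vector_mul_assoc)
  qed
  ultimately obtain C3 where C3: "C3 > 0" "\<forall>\<^sub>F \<epsilon> in at_right 0. norm (?\<beta> (y0, \<epsilon>)) \<le> C3 * \<epsilon> ^ Suc q"
    by (rule corner_bound_on_line[OF A0 B0])
  obtain b1 where b1: "b1 > 0" "\<And>x. norm ((prL :: real^('n + 'm)^'n) *v x) \<le> norm x * b1"
    using bounded_linear.pos_bounded[OF matrix_vector_mul_bounded_linear] by metis
  obtain b2 where b2: "b2 > 0" "\<And>(X :: real^('m + 'n)^('n + 'm)) y. norm (X *v y) \<le> norm X * norm y * b2"
    using bounded_bilinear.pos_bounded[OF bounded_bilinear_matrix_vector] by metis
  have "\<forall>\<^sub>F \<epsilon> in at_right 0. norm ((prL ** ?B \<epsilon> (\<phi> \<epsilon>)) *v ?g \<epsilon> :: real^'n) \<le> (C1 * C2 * b2 * b1 + C3) * \<epsilon> ^ Suc q"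
    using C1(2) C2(2) C3(2) eventually_at_right_less[of "0::real"]
  proof eventually_elim
    case (elim \<epsilon>)
    let ?D = "?B \<epsilon> (\<phi> \<epsilon>) - ?B \<epsilon> (hh (y0, \<epsilon>))"
    have "(prL ** ?B \<epsilon> (\<phi> \<epsilon>)) *v ?g \<epsilon> = prL *v (?D *v ?g \<epsilon>) + ?\<beta> (y0, \<epsilon>)"
      by (simp add: pp_def matrix_vector_mul_assoc[symmetric] matrix_vector_mult_diff_rdistrib matrix_vector_mult_diff_distrib)
    then have "norm ((prL ** ?B \<epsilon> (\<phi> \<epsilon>)) *v ?g \<epsilon>) \<le> norm (prL *v (?D *v ?g \<epsilon>) :: real^'n) + norm (?\<beta> (y0, \<epsilon>))"
      using norm_triangle_ineq by simp
    also have "norm (prL *v (?D *v ?g \<epsilon>) :: real^'n) \<le> (norm ?D * norm (?g \<epsilon>) * b2) * b1"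
      by (rule order_trans[OF b1(2) mult_right_mono[OF b2(2)]]) (use b1(1) in simp)
    also have "\<dots> \<le> ((C1 * \<epsilon> ^ q) * (C2 * \<epsilon> ^ 1) * b2) * b1"
      using elim C1(1) C2(1) b1(1) b2(1) by (intro mult_right_mono mult_mono) auto
    finally show ?case using elim(3) by (simp add: algebra_simps)
  qed
  moreover have "C1 * C2 * b2 * b1 + C3 > 0" using C1(1) C2(1) C3(1) b1(1) b2(1) by (simp add: add_pos_pos)
  ultimately show thesis using that by blast
qed

text \<open>The equation \<open>B\<^sup>1 g = 0\<close> is solvable for \<open>z\<close> near the limit point because \<open>B\<^sup>1\<close> restricted to the
  fast directions and \<open>D\<^sub>z g\<^sub>2\<close> are both invertible there. The implicit function gives regularity in
  \<open>\<epsilon>\<close>, and its Lipschitz constant converts the residual of \<open>h\<^sub>\<epsilon>\<close> into a distance.\<close>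
lemma manifold_step:
  assumes U: "csp_order A0 q U" and \<phi>J: "rjets.Jet 0 \<phi>" and \<phi>: "(\<phi> \<longlongrightarrow> h0 y0) (at_right 0)"
    and C: "\<forall>\<^sub>F \<epsilon> in at_right 0. norm (\<phi> \<epsilon> - hh (y0, \<epsilon>)) \<le> C * \<epsilon> ^ q"
    and \<psi>: "(\<psi> \<longlongrightarrow> h0 y0) (at_right 0)"
    and eq: "\<forall>\<^sub>F \<epsilon> in at_right 0. (prL ** csp_B g A0 q \<epsilon> (join y0 (\<phi> \<epsilon>))) *v g \<epsilon> (join y0 (\<psi> \<epsilon>)) = (0 :: real^'n)"
  shows "rjets.Jet 0 \<psi>" "\<exists>C. \<forall>\<^sub>F \<epsilon> in at_right 0. norm (\<psi> \<epsilon> - hh (y0, \<epsilon>)) \<le> C * \<epsilon> ^ Suc q"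
proof -
  have U': "csp_smooth A0 q U" "pp (y0, 0) \<in> U" "open U"
    using U by (auto simp: csp_order_def csp_smooth_def)
  define u1 :: "((real^'n) \<times> real) \<times> (real^'n) \<Rightarrow> (real^('m + 'n)) \<times> real"
    where "u1 = (\<lambda>p. (join y0 (fst (fst p)), snd (fst p)))"
  define u2 :: "((real^'n) \<times> real) \<times> (real^'n) \<Rightarrow> (real^('m + 'n)) \<times> real"
    where "u2 = (\<lambda>p. (join y0 (snd p), snd (fst p)))"
  define \<Phi> where "\<Phi> = (\<lambda>p. (prL ** csp_B g A0 q (snd (u1 p)) (fst (u1 p))) *v g (snd (u2 p)) (fst (u2 p)) :: real^'n)"
  let ?a0 = "(h0 y0, 0::real)"
  let ?p0 = "(?a0, h0 y0)"
  have u: "Ck_open k UNIV u1" "Ck_open k UNIV u2" for k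
    unfolding u1_def u2_def join_inj
    by (intro Ck_open_Pair open_UNIV Ck_open_add Ck_open_const Ck_open_bounded_linear
        bounded_linear_compose[OF matrix_vector_mul_bounded_linear] bounded_linear_compose[OF bounded_linear_fst bounded_linear_fst]
        bounded_linear_compose[OF bounded_linear_snd bounded_linear_fst] bounded_linear_snd)+
  have u0: "u1 ?p0 = pp (y0, 0)" "u2 ?p0 = pp (y0, 0)" by (simp_all add: u1_def u2_def pp_corner)
  define X where "X = u1 -` U \<inter> u2 -` WX"
  have oX: "open X" unfolding X_def
    by (intro open_Int open_vimage U'(3) open_WX Ck_open_continuous_on[OF u(1)] Ck_open_continuous_on[OF u(2)])
  have pX: "?p0 \<in> X" using U'(2) pp_corner_WX by (simp add: X_def u0)
  have BU: "Ck_open k U (\<lambda>p. csp_B g A0 q (snd p) (fst p))" for k using U'(1) by (simp add: csp_smooth_def)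
  have uX: "Ck_open k X u1" "Ck_open k X u2" for k by (rule Ck_open_subset[OF u(1)], simp) (rule Ck_open_subset[OF u(2)], simp)
  have \<Phi>k: "Ck_open k X \<Phi>" for k unfolding \<Phi>_def
    by (intro Ck_open_bilinear[OF bounded_bilinear_matrix_vector oX] Ck_open_bilinear[OF bounded_bilinear_matrix_mult oX]
        Ck_open_const Ck_open_compose[OF oX BU uX(1)] Ck_open_compose[OF oX Ck_field uX(2)]) (auto simp: X_def)
  have \<Phi>0: "\<Phi> ?p0 = 0" using field_corner[OF A0 B0] by (simp add: \<Phi>_def u0 pp_corner)
  have inj: "v = 0" if v: "frechet_derivative \<Phi> (at ?p0) (0, v) = 0" for v
  proof -
    let ?x0 = "join y0 (h0 y0)"
    let ?M = "prL ** csp_B g A0 q 0 ?x0 :: real^('m + 'n)^'n"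
    have "((\<lambda>z. (?a0, z)) has_derivative (\<lambda>v. (0, v))) (at (h0 y0))"
      by (intro has_derivative_Pair has_derivative_const has_derivative_ident)
    note d1 = has_derivative_compose[OF this Ck_open_has_derivative[OF \<Phi>k pX]]
    have "((\<lambda>z. join y0 z) has_derivative (\<lambda>v. injR *v v)) (at (h0 y0))"
      unfolding join_inj
      by (rule has_derivative_eq_rhs[OF has_derivative_add[OF has_derivative_const
            bounded_linear_imp_has_derivative[OF matrix_vector_mul_bounded_linear]]]) simp
    note dg = has_derivative_compose[OF this g_has_derivative[OF pp_corner_WX[unfolded pp_corner]]]
    have "((\<lambda>z. ?M *v g 0 (join y0 z)) has_derivative
        (\<lambda>v. ?M *v ((0 *\<^sub>R (injL ** J1 (?x0, 0)) + injR ** J2 (?x0, 0)) *v (injR *v v)))) (at (h0 y0))"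
      by (rule bounded_linear.has_derivative[OF matrix_vector_mul_bounded_linear dg])
    moreover have "(\<lambda>z. \<Phi> (?a0, z)) = (\<lambda>z. ?M *v g 0 (join y0 z))" by (simp add: \<Phi>_def u1_def u2_def)
    ultimately have "(\<lambda>v. frechet_derivative \<Phi> (at ?p0) (0, v)) =
        (\<lambda>v. ?M *v ((0 *\<^sub>R (injL ** J1 (?x0, 0)) + injR ** J2 (?x0, 0)) *v (injR *v v)))"
      using has_derivative_unique[OF d1] by simp
    from fun_cong[OF this, of v] v
    have "(?M ** injR) *v ((J2 (?x0, 0) ** injR) *v v) = 0"
      by (simp add: matrix_vector_mul_assoc matrix_mul_assoc)
    then have "(J2 (?x0, 0) ** injR) *v v = 0"
      by (rule invertible_ker[OF refinement_along(1)[OF A0 B0 U]])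
    then show ?thesis by (rule invertible_ker[OF hyperbolic])
  qed
  obtain V G where V: "open V" "(?a0, \<Phi> ?p0) \<in> V" "\<And>k. Ck_open k V G"
    "\<forall>\<^sub>F p in nhds ?p0. (fst p, \<Phi> p) \<in> V \<and> G (fst p, \<Phi> p) = snd p"
  proof (rule smooth_implicit_function[OF oX \<Phi>k pX inj])
    fix V and G :: "((real^'n) \<times> real) \<times> (real^'n) \<Rightarrow> real^'n"
    assume "open V" "(?a0, \<Phi> ?p0) \<in> V" "\<And>k. Ck_open k V G"
      "\<forall>\<^sub>F p in nhds ?p0. (fst p, \<Phi> p) \<in> V \<and> G (fst p, \<Phi> p) = snd p"
    then show thesis by (rule that)
  qed
  define a where "a = (\<lambda>\<epsilon>. (\<phi> \<epsilon>, \<epsilon>))"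
  have al: "(a \<longlongrightarrow> ?a0) (at_right 0)" unfolding a_def by (intro tendsto_Pair \<phi> tendsto_ident_at)
  have hl: "((\<lambda>\<epsilon>. hh (y0, \<epsilon>)) \<longlongrightarrow> h0 y0) (at_right 0)"
    using corner_smooth_line_tendsto[OF hh_smooth] by (simp add: hh_corner)
  \<comment> \<open>Both \<open>\<psi>\<close> and the slow manifold are values of \<open>G\<close>: at the exact residual \<open>0\<close> and at the
     residual of the slow manifold.\<close>
  have G\<psi>: "\<forall>\<^sub>F \<epsilon> in at_right 0. G (a \<epsilon>, \<Phi> (a \<epsilon>, \<psi> \<epsilon>)) = \<psi> \<epsilon>"
    using eventually_compose_filterlim[OF V(4) tendsto_Pair[OF al \<psi>]] by eventually_elim simp
  have Gh: "\<forall>\<^sub>F \<epsilon> in at_right 0. G (a \<epsilon>, \<Phi> (a \<epsilon>, hh (y0, \<epsilon>))) = hh (y0, \<epsilon>)"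
    using eventually_compose_filterlim[OF V(4) tendsto_Pair[OF al hl]] by eventually_elim simp
  have \<Phi>\<psi>: "\<forall>\<^sub>F \<epsilon> in at_right 0. \<Phi> (a \<epsilon>, \<psi> \<epsilon>) = 0"
    using eq by eventually_elim (simp add: \<Phi>_def a_def u1_def u2_def)
  have V0: "(?a0, 0) \<in> V" using V(2) \<Phi>0 by simp
  have aJ: "rjets.Jet 0 a" unfolding a_def by (intro rjets.Jet_Pair \<phi>J rjets_ident)
  have a0l: "((\<lambda>\<epsilon>. (a \<epsilon>, 0 :: real^'n)) \<longlongrightarrow> (?a0, 0)) (at_right 0)" by (intro tendsto_Pair al tendsto_const)
  have "rjets.Jet 0 (\<lambda>\<epsilon>. G (a \<epsilon>, 0))"
    by (rule rjets.Jet_compose[OF V(1) V0 a0l V(3)]) (intro rjets.Jet_Pair aJ rjets.Jet_const)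
  then show "rjets.Jet 0 \<psi>"
    by (rule rjets.Jet_cong[rotated]) (use G\<psi> \<Phi>\<psi> in \<open>eventually_elim, simp\<close>)
  have "isCont \<Phi> ?p0"
    using Ck_open_continuous_on[OF \<Phi>k] oX pX by (simp add: continuous_on_eq_continuous_at)
  from isCont_tendsto_compose[OF this tendsto_Pair[OF al hl]]
  have "((\<lambda>\<epsilon>. \<Phi> (a \<epsilon>, hh (y0, \<epsilon>))) \<longlongrightarrow> 0) (at_right 0)" by (simp add: \<Phi>0)
  then have b0l: "((\<lambda>\<epsilon>. (a \<epsilon>, \<Phi> (a \<epsilon>, hh (y0, \<epsilon>)))) \<longlongrightarrow> (?a0, 0)) (at_right 0)"
    by (intro tendsto_Pair al)
  obtain L where L: "L > 0" "\<forall>\<^sub>F \<epsilon> in at_right 0. norm (G (a \<epsilon>, 0) - G (a \<epsilon>, \<Phi> (a \<epsilon>, hh (y0, \<epsilon>))))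
      \<le> L * norm ((a \<epsilon>, 0) - (a \<epsilon>, \<Phi> (a \<epsilon>, hh (y0, \<epsilon>))))"
    by (rule tendsto_lipschitz[OF V(1) V0 V(3) a0l b0l])
  obtain C' where C': "C' > 0" "\<forall>\<^sub>F \<epsilon> in at_right 0.
    norm ((prL ** csp_B g A0 q \<epsilon> (join y0 (\<phi> \<epsilon>))) *v g \<epsilon> (join y0 (hh (y0, \<epsilon>))) :: real^'n) \<le> C' * \<epsilon> ^ Suc q"
    by (rule residual_bound[OF U \<phi> C])
  have "\<forall>\<^sub>F \<epsilon> in at_right 0. norm (\<psi> \<epsilon> - hh (y0, \<epsilon>)) \<le> (L * C') * \<epsilon> ^ Suc q"
    using L(2) C'(2) G\<psi> Gh \<Phi>\<psi>
  proof eventually_elim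
    case (elim \<epsilon>)
    have "norm (\<psi> \<epsilon> - hh (y0, \<epsilon>)) \<le> L * norm ((a \<epsilon>, 0) - (a \<epsilon>, \<Phi> (a \<epsilon>, hh (y0, \<epsilon>))))"
      using elim(1,3,4,5) by simp
    also have "\<dots> = L * norm (\<Phi> (a \<epsilon>, hh (y0, \<epsilon>)))" by (simp add: norm_Pair)
    also have "\<dots> \<le> L * (C' * \<epsilon> ^ Suc q)"
      using elim(2) L(1) by (intro mult_left_mono) (auto simp: \<Phi>_def a_def u1_def u2_def)
    finally show ?case by (simp only: mult.assoc)
  qed
  then show "\<exists>C. \<forall>\<^sub>F \<epsilon> in at_right 0. norm (\<psi> \<epsilon> - hh (y0, \<epsilon>)) \<le> C * \<epsilon> ^ Suc q" by blast
qed

text \<open>For \<open>q = 0\<close> the matrix \<open>B\<close> is constant, so the slow manifold itself may serve as the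
  previous approximation.\<close>
lemma csp_manifolds:
  assumes lim: "\<And>q. (\<psi> q \<longlongrightarrow> h0 y0) (at_right 0)"
    and start: "\<forall>\<^sub>F \<epsilon> in at_right 0. (prL ** matrix_inv A0) *v g \<epsilon> (join y0 (\<psi> 0 \<epsilon>)) = (0 :: real^'n)"
    and step: "\<And>q. \<forall>\<^sub>F \<epsilon> in at_right 0.
      (prL ** csp_B g A0 (Suc q) \<epsilon> (join y0 (\<psi> q \<epsilon>))) *v g \<epsilon> (join y0 (\<psi> (Suc q) \<epsilon>)) = (0 :: real^'n)"
  shows "rjets.Jet 0 (\<psi> q) \<and> (\<exists>C. \<forall>\<^sub>F \<epsilon> in at_right 0. norm (\<psi> q \<epsilon> - hh (y0, \<epsilon>)) \<le> C * \<epsilon> ^ Suc q)"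
proof (induction q)
  case 0
  obtain U where U: "csp_order A0 0 U" using csp_order_exists[OF A0 B0] by blast
  have hl: "((\<lambda>\<epsilon>. hh (y0, \<epsilon>)) \<longlongrightarrow> h0 y0) (at_right 0)"
    using corner_smooth_line_tendsto[OF hh_smooth] by (simp add: hh_corner)
  show ?case
    using manifold_step[OF U corner_smooth_line_Jet[OF hh_smooth] hl _ lim[of 0], of 0] start by simp
next
  case (Suc q)
  obtain U where U: "csp_order A0 (Suc q) U" using csp_order_exists[OF A0 B0] by blast
  from Suc obtain C where C: "\<forall>\<^sub>F \<epsilon> in at_right 0. norm (\<psi> q \<epsilon> - hh (y0, \<epsilon>)) \<le> C * \<epsilon> ^ Suc q" by blast
  show ?case using manifold_step[OF U _ lim[of q] C lim[of "Suc q"] step] Suc by blast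
qed

end

end

section \<open>Agreement of CSP fibers and fast fibers\<close>

interpretation mag: jets "at_right (0::real)" "{}" "\<lambda>\<epsilon>. \<epsilon>"
proof
  show "\<forall>\<^sub>F x in at_right 0. eventually P (nhds x)" if "eventually P (at_right 0)" for P :: "real \<Rightarrow> bool"
    by (rule eventually_at_within_open_nhds[OF _ that]) auto
  have "\<forall>\<^sub>F \<epsilon> in at_right (0::real). \<epsilon> < 1" by (rule order_tendstoD[OF tendsto_ident_at]) simp
  with eventually_at_right_less[of "0::real"] show "\<forall>\<^sub>F \<epsilon> in at_right (0::real). 0 \<le> \<epsilon> \<and> \<epsilon> \<le> 1"
    by eventually_elim auto
qed auto

lemma mag_iff: "mag.jet 0 q f \<longleftrightarrow> (\<exists>C. \<forall>\<^sub>F \<epsilon> in at_right 0. norm (f \<epsilon>) \<le> C * \<epsilon> ^ q)"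
  by simp

lemma mag_mult: "mag.jet 0 p f \<Longrightarrow> mag.jet 0 q f' \<Longrightarrow> mag.jet 0 (p + q) (\<lambda>\<epsilon>. f \<epsilon> ** f' \<epsilon>)"
  for f :: "real \<Rightarrow> real^'b^'a" and f' :: "real \<Rightarrow> real^'c^'b"
  by (rule mag.jet_bilinear[OF bounded_bilinear_matrix_mult])

lemma rjets_mag: "rjets.Jet 0 f \<Longrightarrow> mag.jet 0 0 f"
  using rjets.Jet_bound[of 0 f] by simp

lemma rank_injR: "rank (injR :: real^'n^('m::finite + 'n)) = CARD('n)"
proof -
  have "inj ((*v) (injR :: real^'n^('m + 'n)))"
  proof (rule injI)
    fix v w assume "injR *v v = (injR *v w :: real^('m + 'n))"
    from arg_cong[OF this, of "\<lambda>x. prR *v x"]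
    show "v = w" by (simp only: matrix_vector_mul_assoc pr_inj matrix_vector_mul_lid)
  qed
  then show ?thesis by (simp add: full_rank_injective)
qed

lemma (in corner) corner_smooth_bilinear:
  assumes "bounded_bilinear pr" "corner_smooth u" "corner_smooth v"
  shows "corner_smooth (\<lambda>s. pr (u s) (v s))"
proof -
  have "Ck_open k UNIV (\<lambda>p. pr (fst p) (snd p))" for k
    by (intro Ck_open_bilinear[OF assms(1)] open_UNIV Ck_open_bounded_linear bounded_linear_fst bounded_linear_snd)
  from corner_smooth_compose[OF corner_smooth_Pair[OF assms(2,3)] open_UNIV _ this] show ?thesis by simp
qed

lemma (in corner) corner_smooth_const: "corner_smooth (\<lambda>s. c)"
  by (rule corner_smooth_compose[OF corner_smooth_ident open_UNIV]) auto

context fenichel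
begin

lemma EE_smooth: "corner_smooth EE"
proof -
  have "Ck_open k UNIV (\<lambda>M. injL ** M + (injR :: real^'n^('m + 'n)))" for k
    by (intro Ck_open_add open_UNIV Ck_open_bounded_linear mm.bounded_linear_right Ck_open_const)
  from corner_smooth_compose[OF tau_smooth open_UNIV _ this] show ?thesis by (simp add: EE_def[abs_def])
qed

lemma tangent_space_line:
  "\<forall>\<^sub>F \<epsilon> in at_right 0. tangent_space (Fib \<epsilon> (join y0 (h \<epsilon> y0))) (join y0 (h \<epsilon> y0)) = span (columns (EE (y0, \<epsilon>)))"
proof -
  obtain M e where e: "e > 0"
    "\<And>y z \<epsilon>. y \<in> K \<Longrightarrow> \<epsilon> \<in> {0..<e} \<Longrightarrow> z \<in> ball (h0 y) \<Delta> \<Longrightarrow> ((\<lambda>z. Y y z \<epsilon>) has_derivative (\<lambda>v. M (y, z, \<epsilon>) *v v)) (at z)"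
    by (rule Y_derivative[of 0]) blast
  obtain V where V: "open V" "(y0, 0) \<in> V" "\<forall>s\<in>V \<inter> K \<times> {0..}. hh s \<in> ball (h0 (fst s)) \<delta>"
    using hh_near by blast
  have "\<forall>\<^sub>F \<epsilon> in at_right 0. \<epsilon> < e" by (rule order_tendstoD[OF tendsto_ident_at e(1)])
  with eventually_boundary_line[OF V(1,2)] fibers eventually_at_right_less[of "0::real"] show ?thesis
  proof eventually_elim
    case (elim \<epsilon>)
    have z: "h \<epsilon> y0 \<in> ball (h0 y0) \<delta>" using V(3)[rule_format, of "(y0, \<epsilon>)"] elim(1) by (simp add: hh_def)
    have "h \<epsilon> y0 \<in> ball (h0 y0) \<Delta>" using z delta_le by auto
    then have d: "((\<lambda>z. Y y0 z \<epsilon>) has_derivative (\<lambda>v. M (y0, h \<epsilon> y0, \<epsilon>) *v v)) (at (h \<epsilon> y0))"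
      using e(2)[OF y0] elim by auto
    have \<tau>: "\<tau> (y0, \<epsilon>) = M (y0, h \<epsilon> y0, \<epsilon>)" using jacobian_unique[OF d] by (simp add: \<tau>_def hh_def)
    have N: "open (N \<epsilon> y0)" "h \<epsilon> y0 \<in> N \<epsilon> y0" "Y y0 (h \<epsilon> y0) \<epsilon> = y0"
      "Fib \<epsilon> (join y0 (h \<epsilon> y0)) = (\<lambda>z. join (Y y0 z \<epsilon>) z) ` N \<epsilon> y0"
      using elim(2)[rule_format, OF y0] z by blast+
    show ?case
      using tangent_space_graph[OF N(1,2) d] N(3,4) by (simp add: span_columns_range EE_def \<tau>)
  qed
qed

context
  fixes A0 :: "real^('n + 'm)^('m + 'n)"
  assumes A0: "A0 ** matrix_inv A0 = mat 1" "matrix_inv A0 ** A0 = mat 1"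
    and B0: "prR ** matrix_inv A0 ** injR = (0 :: real^'n^'m)"
begin

text \<open>The chosen bases are \<open>E\<close> for the tangent space of the fiber and its projection
  \<open>A\<^sub>1 B\<^sup>1 E\<close> for the CSP fiber. The projection, rather than \<open>A\<^sub>1\<close>, is normalised like \<open>E\<close>.\<close>
lemma fiber_agreement:
  assumes \<phi>J: "rjets.Jet 0 \<phi>" and \<phi>: "(\<phi> \<longlongrightarrow> h0 y0) (at_right 0)"
    and C: "\<forall>\<^sub>F \<epsilon> in at_right 0. norm (\<phi> \<epsilon> - hh (y0, \<epsilon>)) \<le> C * \<epsilon> ^ Suc q"
  shows "subspaces_agree TYPE('n) q
    (\<lambda>\<epsilon>. span (columns (left_cols (csp_A g A0 q \<epsilon> (join y0 (\<phi> \<epsilon>))))))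
    (\<lambda>\<epsilon>. tangent_space (Fib \<epsilon> (join y0 (h \<epsilon> y0))) (join y0 (h \<epsilon> y0)))"
proof -
  obtain U where U: "csp_order A0 q U" using csp_order_exists[OF A0 B0] by blast
  have U': "csp_smooth A0 q U" "pp (y0, 0) \<in> U" "open U"
    and QJ: "Jet (Suc q) (\<lambda>s. prR ** csp_B g A0 q (snd s) (fst (pp s)) ** EE s)"
    using U by (auto simp: csp_order_def csp_smooth_def)
  define A where "A = (\<lambda>\<epsilon>. csp_A g A0 q \<epsilon> (join y0 (\<phi> \<epsilon>)))"
  define B where "B = (\<lambda>\<epsilon>. csp_B g A0 q \<epsilon> (join y0 (\<phi> \<epsilon>)))"
  define E where "E = (\<lambda>\<epsilon>. EE (y0, \<epsilon>))"
  define P where "P = (\<lambda>\<epsilon>. prL ** B \<epsilon> ** E \<epsilon> :: real^'n^'n)"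
  define X where "X = (\<lambda>\<epsilon>. (A \<epsilon> ** injL) ** P \<epsilon>)"
  let ?u = "\<lambda>\<epsilon>. (join y0 (\<phi> \<epsilon>), \<epsilon>)"
  note ul = join_line_tendsto[OF A0 B0 \<phi>]
  have uJ: "rjets.Jet 0 ?u"
    unfolding join_inj
    by (intro rjets.Jet_Pair rjets.Jet_add rjets.Jet_const rjets.Jet_linear[OF matrix_vector_mul_bounded_linear] \<phi>J rjets_ident)
  have AJ: "rjets.Jet 0 A"
    unfolding A_def using rjets.Jet_compose[OF U'(3,2) ul _ uJ, of "\<lambda>p. csp_A g A0 q (snd p) (fst p)"] U'(1)
    by (simp add: csp_smooth_def)
  have BJ: "rjets.Jet 0 B"
    unfolding B_def using rjets.Jet_compose[OF U'(3,2) ul _ uJ, of "\<lambda>p. csp_B g A0 q (snd p) (fst p)"] U'(1)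
    by (simp add: csp_smooth_def)
  have EJ: "rjets.Jet 0 E" unfolding E_def by (rule corner_smooth_line_Jet[OF EE_smooth])
  have PJ: "rjets.Jet 0 P" unfolding P_def by (intro rjets.Jet_mult0 rjets.Jet_const BJ EJ)
  have XJ: "rjets.Jet 0 X" unfolding X_def by (intro rjets.Jet_mult0 rjets.Jet_const AJ PJ)
  have El: "(E \<longlongrightarrow> injR) (at_right 0)"
    unfolding E_def using corner_smooth_line_tendsto[OF EE_smooth] by (simp add: EE_def tau_corner)
  \<comment> \<open>\<open>X = A\<^sub>1 B\<^sup>1 E\<close> is the component of \<open>E\<close> in the CSP fiber; what is missing is \<open>A\<^sub>2 B\<^sup>2 E\<close>.\<close>
  have "A \<epsilon> ** B \<epsilon> = mat 1" for \<epsilon> using csp_inverse[OF A0] by (simp add: A_def B_def)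
  then have diff: "E \<epsilon> - X \<epsilon> = (A \<epsilon> ** injR) ** (prR ** B \<epsilon> ** E \<epsilon>)" for \<epsilon>
    using matrix_split_product[of "A \<epsilon>" "B \<epsilon> ** E \<epsilon>"]
    by (simp add: X_def P_def matrix_mul_assoc algebra_simps)
  let ?B = "\<lambda>\<epsilon>. csp_B g A0 q \<epsilon> (join y0 (hh (y0, \<epsilon>)))"
  have Bd: "mag.jet 0 (Suc q) (\<lambda>\<epsilon>. B \<epsilon> - ?B \<epsilon>)"
    using csp_B_lipschitz[OF A0 B0 U \<phi> C] unfolding mag_iff B_def by metis
  have "mag.jet 0 (Suc q) (\<lambda>\<epsilon>. prR ** ?B \<epsilon> ** E \<epsilon>)"
  proof -
    have "corner_smooth (\<lambda>s. prR ** csp_B g A0 q (snd s) (fst (pp s)) ** EE s)"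
      by (intro corner_smooth_bilinear[OF bounded_bilinear_matrix_mult] corner_smooth_const EE_smooth
          csp_smooth_along(2)[OF A0 B0 U'(1,2)])
    from corner_bound_on_line[OF A0 B0 this QJ]
    show ?thesis unfolding mag_iff E_def by (simp add: pp_def) blast
  qed
  moreover have "mag.jet 0 (Suc q) (\<lambda>\<epsilon>. prR ** (B \<epsilon> - ?B \<epsilon>) ** E \<epsilon>)"
    using mag_mult[OF mag_mult[OF mag.jet_const Bd] rjets_mag[OF EJ]] by simp
  ultimately have "mag.jet 0 (Suc q) (\<lambda>\<epsilon>. prR ** (B \<epsilon> - ?B \<epsilon>) ** E \<epsilon> + prR ** ?B \<epsilon> ** E \<epsilon>)"
    by (intro mag.jet_add)
  then have "mag.jet 0 (Suc q) (\<lambda>\<epsilon>. prR ** B \<epsilon> ** E \<epsilon>)"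
    by (simp add: mm.diff_left mm.diff_right)
  then have "mag.jet 0 (Suc q) (\<lambda>\<epsilon>. (A \<epsilon> ** injR) ** (prR ** B \<epsilon> ** E \<epsilon>))"
    using mag_mult[OF mag_mult[OF rjets_mag[OF AJ] mag.jet_const]] by fastforce
  then have EX: "mag.jet 0 (Suc q) (\<lambda>\<epsilon>. E \<epsilon> - X \<epsilon>)" by (simp only: diff)
  have "((\<lambda>\<epsilon>. E \<epsilon> - X \<epsilon>) \<longlongrightarrow> 0) (at_right 0)"
    by (rule mag.jet_tendsto_zero[OF EX]) (auto intro: tendsto_ident_at)
  from tendsto_diff[OF El this] have Xl: "(X \<longlongrightarrow> injR) (at_right 0)" by simp
  obtain a where a: "asymp_expansion X a" "a 0 = injR" by (rule Jet_asymp_expansion[OF XJ Xl])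
  obtain b where b: "asymp_expansion E b" "b 0 = injR" by (rule Jet_asymp_expansion[OF EJ El])
  \<comment> \<open>\<open>X\<close> is a basis of the CSP fiber because \<open>P\<close> tends to an invertible matrix.\<close>
  have "isCont (\<lambda>p. csp_B g A0 q (snd p) (fst p)) (pp (y0, 0))"
    using U' by (auto simp: csp_smooth_def continuous_on_eq_continuous_at dest!: Ck_open_continuous_on[of 0 U] spec[of _ 0])
  from isCont_tendsto_compose[OF this ul]
  have "(B \<longlongrightarrow> csp_B g A0 q 0 (join y0 (h0 y0))) (at_right 0)" by (simp add: B_def pp_corner)
  then have "(P \<longlongrightarrow> prL ** csp_B g A0 q 0 (join y0 (h0 y0)) ** injR) (at_right 0)"
    unfolding P_def by (intro tendsto_matrix_mult tendsto_const El)
  then have Pinv: "\<forall>\<^sub>F \<epsilon> in at_right 0. invertible (P \<epsilon>)"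
    using topological_tendstoD[OF _ open_invertible] refinement_along(1)[OF A0 B0 U] by fastforce
  have spans: "\<forall>\<^sub>F \<epsilon> in at_right 0.
      span (columns (left_cols (csp_A g A0 q \<epsilon> (join y0 (\<phi> \<epsilon>))))) = span (columns (X \<epsilon>)) \<and>
      tangent_space (Fib \<epsilon> (join y0 (h \<epsilon> y0))) (join y0 (h \<epsilon> y0)) = span (columns (E \<epsilon>))"
    using Pinv tangent_space_line
  proof eventually_elim
    case (elim \<epsilon>)
    show ?case using span_columns_mult[OF elim(1), of "A \<epsilon> ** injL"] elim(2)
      by (simp add: X_def A_def E_def left_cols_inj)
  qed
  obtain C' where C': "\<forall>\<^sub>F \<epsilon> in at_right 0. norm (E \<epsilon> - X \<epsilon>) \<le> C' * \<epsilon> ^ Suc q"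
    using EX unfolding mag_iff by blast
  have "(\<lambda>\<epsilon>. norm (X \<epsilon> - E \<epsilon>)) \<in> O[at_right 0](\<lambda>\<epsilon>. \<epsilon> ^ (q + 1))"
  proof (rule bigoI[of _ C'])
    show "\<forall>\<^sub>F \<epsilon> in at_right 0. norm (norm (X \<epsilon> - E \<epsilon>)) \<le> C' * norm (\<epsilon> ^ (q + 1))"
      using C' eventually_at_right_less[of "0::real"]
    proof eventually_elim
      case (elim \<epsilon>)
      then show ?case by (simp add: norm_minus_commute abs_mult power_abs)
    qed
  qed
  then show ?thesis
    unfolding subspaces_agree_def using a b spans rank_injR
    by (intro exI[of _ X] exI[of _ E] exI[of _ a] exI[of _ b]) simp
qed

end

end

section \<open>Passage to a smooth extension of the vector field\<close>

text \<open>The construction at a parameter value involves the field at this value only, so the field may be replaced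
  by its extension for small \<open>\<epsilon>\<close>.\<close>
lemma csp_cong:
  assumes "f \<epsilon> = f' \<epsilon>"
  shows "csp_A f A0 q \<epsilon> x = csp_A f' A0 q \<epsilon> x \<and> csp_B f A0 q \<epsilon> x = csp_B f' A0 q \<epsilon> x"
proof (induction q arbitrary: x)
  case (Suc q)
  have "csp_A f A0 q \<epsilon> = csp_A f' A0 q \<epsilon>" "csp_B f A0 q \<epsilon> = csp_B f' A0 q \<epsilon>"
    using Suc by (auto simp: fun_eq_iff)
  then show ?case by (simp add: assms)
qed simp

lemma subspaces_agree_cong:
  fixes S S' T :: "real \<Rightarrow> (real^'k) set"
  assumes "\<forall>\<^sub>F \<epsilon> in at_right 0. S \<epsilon> = S' \<epsilon>" "subspaces_agree TYPE('n::finite) q S T"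
  shows "subspaces_agree TYPE('n) q S' T"
proof -
  obtain X Y a b where XY: "asymp_expansion (X :: real \<Rightarrow> real^'n^'k) a" "rank (a 0) = CARD('n)"
    "asymp_expansion Y b" "rank (b 0) = CARD('n)"
    "\<forall>\<^sub>F \<epsilon> in at_right 0. S \<epsilon> = span (columns (X \<epsilon>)) \<and> T \<epsilon> = span (columns (Y \<epsilon>))"
    "(\<lambda>\<epsilon>. norm (X \<epsilon> - Y \<epsilon>)) \<in> O[at_right 0](\<lambda>\<epsilon>. \<epsilon> ^ (q + 1))"
    using assms(2) unfolding subspaces_agree_def by blast
  have "\<forall>\<^sub>F \<epsilon> in at_right 0. S' \<epsilon> = span (columns (X \<epsilon>)) \<and> T \<epsilon> = span (columns (Y \<epsilon>))"
    using assms(1) XY(5) by eventually_elim simp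
  with XY(1-4,6) show ?thesis unfolding subspaces_agree_def by blast
qed

text \<open>A real vector in the kernel would be a complex eigenvector for the eigenvalue \<open>0\<close>.\<close>
lemma stable_matrix_invertible:
  fixes M :: "real^'n^'n"
  assumes "\<forall>l. complex_eigenvalue M l \<longrightarrow> Re l < 0"
  shows "invertible M"
proof -
  have "v = 0" if v: "M *v v = 0" for v
  proof (rule ccontr)
    assume "v \<noteq> 0"
    let ?v = "\<chi> i. complex_of_real (v $ i)"
    have "?v \<noteq> 0" using \<open>v \<noteq> 0\<close> by (auto simp: vec_eq_iff)
    moreover have "map_matrix complex_of_real M *v ?v = 0 *s ?v"
    proof -
      have "(map_matrix complex_of_real M *v ?v) $ i = complex_of_real ((M *v v) $ i)" for i
        by (simp add: map_matrix_def matrix_vector_mult_def)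
      then show ?thesis using v by (simp add: vec_eq_iff)
    qed
    ultimately have "complex_eigenvalue M 0" unfolding complex_eigenvalue_def by blast
    then show False using assms by force
  qed
  then show ?thesis
    using matrix_left_invertible_ker[of M] invertible_left_inverse[of M] by blast
qed

theorem theorem3p2:
  fixes g1 :: "real^'m \<Rightarrow> real^'n \<Rightarrow> real \<Rightarrow> real^'m"
    and g2 :: "real^'m \<Rightarrow> real^'n \<Rightarrow> real \<Rightarrow> real^'n"
    and \<epsilon>0 :: real
    and K :: "(real^'m) set"
    and h0 :: "real^'m \<Rightarrow> real^'n"
    and h :: "real \<Rightarrow> real^'m \<Rightarrow> real^'n"
    and F :: "real \<Rightarrow> real^('m + 'n) \<Rightarrow> (real^('m + 'n)) set"
    and A12 :: "real^'m^'m" and A21 :: "real^'n^'n" and A22 :: "real^'m^'n"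
    and A0 :: "real^('n + 'm)^('m + 'n)"
    and \<psi> :: "nat \<Rightarrow> real^'m \<Rightarrow> real \<Rightarrow> real^'n"
  assumes "\<epsilon>0 > 0"
    and "smooth_on (UNIV \<times> UNIV \<times> {0..<\<epsilon>0}) (\<lambda>(y, z, \<epsilon>). g1 y z \<epsilon>)"
    and "smooth_on (UNIV \<times> UNIV \<times> {0..<\<epsilon>0}) (\<lambda>(y, z, \<epsilon>). g2 y z \<epsilon>)"
    and "compact_domain K"
    and "smooth_on K h0"
    and "\<forall>y\<in>K. g2 y (h0 y) 0 = 0"
    and "\<forall>y\<in>K. \<forall>l. complex_eigenvalue (jacobian (\<lambda>z. g2 y z 0) (at (h0 y))) l \<longrightarrow> Re l < 0"
    and "slow_manifold_family (fs_field g1 g2) K h0 h"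
    and "fast_fiber_family (fs_field g1 g2) K h0 h F"
    and "A0 = block_mat 0 A12 A21 A22"
    and "invertible A12" and "invertible A21"
    and "csp_manifold_functions (fs_field g1 g2) A0 K h0 \<psi>"
  shows "\<forall>y\<in>K. \<forall>q.
    subspaces_agree TYPE('n) q
      (\<lambda>\<epsilon>. csp_fiber (fs_field g1 g2) A0 \<psi> q \<epsilon> y)
      (\<lambda>\<epsilon>. tangent_space (F \<epsilon> (join y (h \<epsilon> y))) (join y (h \<epsilon> y)))"
proof (intro ballI allI)
  fix y0 q assume y0: "y0 \<in> K"
  obtain W1 G1 where W1: "open W1" "UNIV \<times> UNIV \<times> {0..<\<epsilon>0} \<subseteq> W1" "\<And>k. Ck_open k W1 G1"
    "\<And>y z \<epsilon>. \<epsilon> \<in> {0..<\<epsilon>0} \<Longrightarrow> G1 (y, z, \<epsilon>) = g1 y z \<epsilon>"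
    using assms(2) unfolding smooth_on_def by fastforce
  obtain W2 G2 where W2: "open W2" "UNIV \<times> UNIV \<times> {0..<\<epsilon>0} \<subseteq> W2" "\<And>k. Ck_open k W2 G2"
    "\<And>y z \<epsilon>. \<epsilon> \<in> {0..<\<epsilon>0} \<Longrightarrow> G2 (y, z, \<epsilon>) = g2 y z \<epsilon>"
    using assms(3) unfolding smooth_on_def by fastforce
  have oW: "open (W1 \<inter> W2)" using W1 W2 by auto
  interpret sf: smooth_field G1 G2 "W1 \<inter> W2"
    by unfold_locales (use oW Ck_open_subset[OF W1(3)] Ck_open_subset[OF W2(3)] in auto)
  let ?f = "fs_field g1 g2"
  have same: "?f \<epsilon> = sf.g \<epsilon>" if "0 \<le> \<epsilon>" "\<epsilon> < \<epsilon>0" for \<epsilon>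
    using that W1(4) W2(4) by (simp add: fun_eq_iff fs_field_def)
  have "\<forall>\<^sub>F \<epsilon> in at_right 0. \<epsilon> < \<epsilon>0" by (rule order_tendstoD[OF tendsto_ident_at assms(1)])
  with eventually_at_right_less[of "0::real"]
  have ev: "\<forall>\<^sub>F \<epsilon> in at_right 0. ?f \<epsilon> = sf.g \<epsilon>"
    by eventually_elim (simp add: same)
  obtain U h0' where h0': "open U" "K \<subseteq> U" "Ck_open 0 U h0'" "\<forall>y\<in>K. h0' y = h0 y"
    using assms(5) unfolding smooth_on_def by blast
  have h0c: "continuous_on K h0"
    using continuous_on_subset[OF Ck_open_continuous_on[OF h0'(3)] h0'(2)] h0'(4)
    by (simp cong: continuous_on_cong)
  note slow = assms(8)[unfolded slow_manifold_family_def]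
  note fast = assms(9)[unfolded fast_fiber_family_def]
  obtain Y N \<delta> \<Delta> where Y: "0 < \<delta>"
    "\<forall>r. \<exists>e>0. Ck_on r {(y, z, \<epsilon>). y \<in> K \<and> z \<in> cball (h0 y) \<Delta> \<and> \<epsilon> \<in> {0..<e}} (\<lambda>(y, z, \<epsilon>). Y y z \<epsilon>)"
    "\<forall>y\<in>K. \<forall>z\<in>cball (h0 y) \<Delta>. Y y z 0 = y"
    "\<forall>\<^sub>F \<epsilon> in at_right 0. \<forall>y\<in>K.
           open (N \<epsilon> y) \<and> ball (h0 y) \<delta> \<subseteq> N \<epsilon> y \<and> N \<epsilon> y \<subseteq> cball (h0 y) \<Delta> \<and>
           Y y (h \<epsilon> y) \<epsilon> = y \<and>
           F \<epsilon> (join y (h \<epsilon> y)) = (\<lambda>z. join (Y y z \<epsilon>) z) ` N \<epsilon> y"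
    using fast unfolding smooth_fiber_graphs_def by blast
  have x0W: "(join y0 (h0 y0), 0) \<in> sf.WX"
    using W1(2) W2(2) assms(1) by (auto simp: sf.WX_def sf.cc_def)
  have hyper: "invertible (sf.J2 (join y0 (h0 y0), 0) ** injR)"
  proof -
    have "((\<lambda>z. join y0 z) has_derivative (\<lambda>v. injR *v v)) (at (h0 y0))"
      unfolding join_inj
      by (rule has_derivative_eq_rhs[OF has_derivative_add[OF has_derivative_const
            bounded_linear_imp_has_derivative[OF matrix_vector_mul_bounded_linear]]]) simp
    from has_derivative_compose[OF this sf.J_has_derivative(2)[OF x0W]]
    have "((\<lambda>z. g2 y0 z 0) has_derivative (\<lambda>v. (sf.J2 (join y0 (h0 y0), 0) ** injR) *v v)) (at (h0 y0))"
      using W2(4)[of 0] assms(1) by (simp add: sf.cc_def matrix_vector_mul_assoc)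
    from frechet_derivative_at[OF this]
    have "jacobian (\<lambda>z. g2 y0 z 0) (at (h0 y0)) = sf.J2 (join y0 (h0 y0), 0) ** injR"
      unfolding jacobian_def by (metis matrix_of_matrix_vector_mul)
    then show ?thesis using stable_matrix_invertible assms(7) y0 by metis
  qed
  interpret fenichel G1 G2 "W1 \<inter> W2" K y0 \<epsilon>0 h0 h Y N \<delta> \<Delta> F
  proof
    show "y0 \<in> K" "closure (interior K) = K" using y0 assms(4) by (auto simp: compact_domain_def)
    show "\<epsilon>0 > 0" "UNIV \<times> UNIV \<times> {0..<\<epsilon>0} \<subseteq> W1 \<inter> W2" using assms(1) W1(2) W2(2) by auto
    show "continuous_on K h0" by (rule h0c)
    show "h 0 y = h0 y" if "y \<in> K" for y using slow that by blast
    show "\<exists>e>0. Ck_on r (K \<times> {0..<e}) (\<lambda>(y, \<epsilon>). h \<epsilon> y)" for r using slow by blast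
    show "\<forall>\<^sub>F \<epsilon> in at_right 0. locally_invariant_graph (sf.g \<epsilon>) K (h \<epsilon>)"
      using slow ev by (auto elim: eventually_elim2)
    show "0 < \<delta>" by (rule Y)
    show "\<exists>e>0. Ck_on r {(y, z, \<epsilon>). y \<in> K \<and> z \<in> cball (h0 y) \<Delta> \<and> \<epsilon> \<in> {0..<e}} (\<lambda>(y, z, \<epsilon>). Y y z \<epsilon>)" for r
      using Y(2) by blast
    show "Y y z 0 = y" if "y \<in> K" "z \<in> cball (h0 y) \<Delta>" for y z using Y(3) that by blast
    show "\<forall>\<^sub>F \<epsilon> in at_right 0. \<forall>y\<in>K.
           open (N \<epsilon> y) \<and> ball (h0 y) \<delta> \<subseteq> N \<epsilon> y \<and> N \<epsilon> y \<subseteq> cball (h0 y) \<Delta> \<and>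
           Y y (h \<epsilon> y) \<epsilon> = y \<and>
           F \<epsilon> (join y (h \<epsilon> y)) = (\<lambda>z. join (Y y z \<epsilon>) z) ` N \<epsilon> y" by (rule Y)
    obtain C \<gamma> where "\<forall>\<^sub>F \<epsilon> in at_right 0. \<forall>T\<ge>0. \<forall>x p.
           solution_on (?f \<epsilon>) {0..T} x \<and> solution_on (?f \<epsilon>) {0..T} p \<and>
           (\<forall>t\<in>{0..T}. p t \<in> graph_over K (h \<epsilon>)) \<and> x 0 \<in> F \<epsilon> (p 0)
           \<longrightarrow> (\<forall>t\<in>{0..T}. x t \<in> F \<epsilon> (p t) \<and>
                  norm (x t - p t) \<le> C * exp (- \<gamma> * t) * norm (x 0 - p 0))"
      using fast by blast
    with ev show "\<forall>\<^sub>F \<epsilon> in at_right 0. \<forall>T\<ge>0. \<forall>x p.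
           solution_on (sf.g \<epsilon>) {0..T} x \<and> solution_on (sf.g \<epsilon>) {0..T} p \<and>
           (\<forall>t\<in>{0..T}. p t \<in> graph_over K (h \<epsilon>)) \<and> x 0 \<in> F \<epsilon> (p 0)
           \<longrightarrow> (\<forall>t\<in>{0..T}. x t \<in> F \<epsilon> (p t))"
      by eventually_elim (metis (no_types, lifting))
    show "invertible (sf.J2 (join y0 (h0 y0), 0) ** injR)" by (rule hyper)
  qed
  note A0 = invertible_csp_start[OF assms(11,12,10)]
  note man = assms(13)[unfolded csp_manifold_functions_def, rule_format, OF y0]
  have lim: "(\<psi> q y0 \<longlongrightarrow> h0 y0) (at_right 0)" for q using man by blast
  have start: "\<forall>\<^sub>F \<epsilon> in at_right 0. (prL ** matrix_inv A0) *v sf.g \<epsilon> (join y0 (\<psi> 0 y0 \<epsilon>)) = (0 :: real^'n)"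
    using conjunct1[OF man] ev by eventually_elim (simp add: upper_rows_pr)
  have step: "\<forall>\<^sub>F \<epsilon> in at_right 0.
      (prL ** csp_B sf.g A0 (Suc q) \<epsilon> (join y0 (\<psi> q y0 \<epsilon>))) *v sf.g \<epsilon> (join y0 (\<psi> (Suc q) y0 \<epsilon>)) = (0 :: real^'n)" for q
    using conjunct1[OF conjunct2[OF man], rule_format, of q] ev
  proof eventually_elim
    case (elim \<epsilon>)
    then show ?case using csp_cong[of ?f \<epsilon> sf.g A0 "Suc q", OF elim(2)] by (simp only: upper_rows_pr)
  qed
  from csp_manifolds[OF A0 lim start step, of q]
  obtain C where C: "rjets.Jet 0 (\<psi> q y0)" "\<forall>\<^sub>F \<epsilon> in at_right 0. norm (\<psi> q y0 \<epsilon> - hh (y0, \<epsilon>)) \<le> C * \<epsilon> ^ Suc q"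
    by blast
  have "\<forall>\<^sub>F \<epsilon> in at_right 0. span (columns (left_cols (csp_A sf.g A0 q \<epsilon> (join y0 (\<psi> q y0 \<epsilon>)))))
      = csp_fiber ?f A0 \<psi> q \<epsilon> y0"
    using ev
  proof eventually_elim
    case (elim \<epsilon>)
    show ?case unfolding csp_fiber_def conjunct1[OF csp_cong[of ?f \<epsilon> sf.g, OF elim]] ..
  qed
  from subspaces_agree_cong[OF this fiber_agreement[OF A0 C(1) lim C(2)]]
  show "subspaces_agree TYPE('n) q (\<lambda>\<epsilon>. csp_fiber ?f A0 \<psi> q \<epsilon> y0)
      (\<lambda>\<epsilon>. tangent_space (F \<epsilon> (join y0 (h \<epsilon> y0))) (join y0 (h \<epsilon> y0)))" .
qed

end
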